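(* Let $M$ be a closed Riemannian manifold and fix a perturbation $\mathcal V:\mathcal LM\to\mathbb R$ that satisfies (V0) and (V1). (F) Let $u$ and $v$ be smooth solutions of the heat equation $\partial_su-\nabla_t\partial_tu-\mathrm{grad}\,\mathcal V(u)=0$ defined on the forward halfcylinder $[0,\infty)\times S^1$. If $u$ and $v$ agree along the loop at $s=0$, then $u=v$. (B) Let $u$ and $v$ be smooth solutions of the heat equation $\partial_su-\nabla_t\partial_tu-\mathrm{grad}\,\mathcal V(u)=0$ defined on the backward halfcylinder $(-\infty,0]\times S^1$. Assume further that $$\sup_{s\in(-\infty,0]}\mathcal S_{\mathcal V}(u(s,\cdot))\le c_0,\qquad\sup_{s\in(-\infty,0]}\mathcal S_{\mathcal V}(v(s,\cdot))\le c_0$$ for some constant $c_0>0$. If $u$ and $v$ agree along the loop at $s=0$, then $u=v$.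
   Context: $S^1=\mathbb R/\mathbb Z$, $\mathcal LM=C^\infty(S^1,M)$, $\nabla$ is the Levi-Civita connection, and $\nabla_s,\nabla_t$ are covariant derivatives along maps $u(s,t)$ to $M$. A perturbation is a smooth function $\mathcal V:\mathcal LM\to\mathbb R$. Its $L^2$-gradient $\mathrm{grad}\,\mathcal V(x)$, a vector field along $x$, is defined by $\int_0^1\langle\mathrm{grad}\,\mathcal V(u),\partial_su\rangle\,dt=\frac{d}{ds}\mathcal V(u)$ for every smooth path $s\mapsto u(s,\cdot)$ in $\mathcal LM$. In the heat equation $\mathrm{grad}\,\mathcal V(u)$ at $(s,t)$ is the value at $t$ of $\mathrm{grad}\,\mathcal V(u(s,\cdot))$. The action functional is $\mathcal S_{\mathcal V}(x)=\frac12\int_0^1|\dot x(t)|^2dt-\mathcal V(x)$. Agreeing along the loop at $s=0$ means $u(0,t)=v(0,t)$ for all $t\in S^1$. Axioms (the estimates in (V1) are required for every smooth map $\mathbb R\to\mathcal LM:s\mapsto u(s,\cdot)$ and every $(s,t)$; $|\cdot|$ is the pointwise norm at $(s,t)$, $\|\cdot\|_{L^1}$ the $L^1$-norm over $S^1$ at time $s$): (V0) $\mathcal V$ is continuous with respect to the $C^0$ topology on $\mathcal LM$, and there is $C=C(\mathcal V)$ with $\sup_x|\mathcal V(x)|+\sup_x\|\mathrm{grad}\,\mathcal V(x)\|_{L^\infty(S^1)}\le C$. (V1) There is $C=C(\mathcal V)$ with $|\nabla_s\mathrm{grad}\,\mathcal V(u)|\le C(|\partial_su|+\|\partial_su\|_{L^1})$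 and $|\nabla_t\mathrm{grad}\,\mathcal V(u)|\le C(1+|\partial_tu|)$. *)

theory Defs
  imports "HOL-Analysis.Analysis"
begin

section \<open>Smooth maps between Euclidean spaces\<close>

text \<open>Derivatives are taken within the set, so that on relatively open subsets of a half line or
  a half plane smoothness means smoothness up to the boundary (with one-sided derivatives).\<close>

primrec Ck_on :: "nat \<Rightarrow> 'a::real_normed_vector set \<Rightarrow> ('a \<Rightarrow> 'b::real_normed_vector) \<Rightarrow> bool" where
  "Ck_on 0 S f \<longleftrightarrow> continuous_on S f"
| "Ck_on (Suc k) S f \<longleftrightarrow>
     (\<forall>x\<in>S. f differentiable (at x within S)) \<and>
     (\<forall>v. Ck_on k S (\<lambda>x. frechet_derivative f (at x within S) v))"

definition smooth_on :: "'a::real_normed_vector set \<Rightarrow> ('a \<Rightarrow> 'b::real_normed_vector) \<Rightarrow> bool" where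
  "smooth_on S f \<longleftrightarrow> (\<forall>k. Ck_on k S f)"


section \<open>Closed manifolds\<close>

text \<open>A chart is a coordinate domain together with a coordinate map; values of the map outside
  the domain are irrelevant. The manifold is the whole type \<open>'m\<close>, with its Hausdorff topology,
  modelled on the Euclidean space \<open>'e\<close> (of arbitrary positive dimension).\<close>

type_synonym ('m, 'e) chart = "'m set \<times> ('m \<Rightarrow> 'e)"

definition dom_chart :: "('m, 'e) chart \<Rightarrow> 'm set" where
  "dom_chart c = fst c"

definition app_chart :: "('m, 'e) chart \<Rightarrow> 'm \<Rightarrow> 'e" where
  "app_chart c = snd c"

definition img_chart :: "('m, 'e) chart \<Rightarrow> 'e set" where
  "img_chart c = app_chart c ` dom_chart c"

definition inv_chart :: "('m, 'e) chart \<Rightarrow> 'e \<Rightarrow> 'm" where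
  "inv_chart c = inv_into (dom_chart c) (app_chart c)"

definition transition :: "('m, 'e) chart \<Rightarrow> ('m, 'e) chart \<Rightarrow> 'e \<Rightarrow> 'e" where
  "transition c c' = app_chart c' \<circ> inv_chart c"

definition smooth_atlas :: "('m::t2_space, 'e::euclidean_space) chart set \<Rightarrow> bool" where
  "smooth_atlas A \<longleftrightarrow>
     (\<Union>c\<in>A. dom_chart c) = UNIV \<and>
     (\<forall>c\<in>A. open (dom_chart c) \<and> open (img_chart c) \<and>
        homeomorphism (dom_chart c) (img_chart c) (app_chart c) (inv_chart c)) \<and>
     (\<forall>c\<in>A. \<forall>c'\<in>A.
        smooth_on (app_chart c ` (dom_chart c \<inter> dom_chart c')) (transition c c'))"

definition closed_manifold :: "('m::t2_space, 'e::euclidean_space) chart set \<Rightarrow> bool" where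
  "closed_manifold A \<longleftrightarrow> smooth_atlas A \<and> compact (UNIV :: 'm set)"

definition smooth_map ::
  "('m::topological_space, 'e::euclidean_space) chart set \<Rightarrow> 'a::real_normed_vector set \<Rightarrow> ('a \<Rightarrow> 'm) \<Rightarrow> bool" where
  "smooth_map A S f \<longleftrightarrow>
     continuous_on S f \<and>
     (\<forall>c\<in>A. smooth_on (S \<inter> f -` dom_chart c) (app_chart c \<circ> f))"


section \<open>Tangent vectors\<close>

text \<open>A tangent vector at \<open>p\<close> is the family of its coordinate representatives in all charts
  at \<open>p\<close>, related by the derivatives of the transition maps. The family is set to \<open>0\<close> at all
  other charts, so that equality of tangent vectors is equality of functions.\<close>

type_synonym ('m, 'e) tvec = "('m, 'e) chart \<Rightarrow> 'e"

definition charts_at :: "('m, 'e) chart set \<Rightarrow> 'm \<Rightarrow> ('m, 'e) chart set" where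
  "charts_at A p = {c \<in> A. p \<in> dom_chart c}"

definition tangent_space ::
  "('m, 'e::euclidean_space) chart set \<Rightarrow> 'm \<Rightarrow> ('m, 'e) tvec set" where
  "tangent_space A p = {\<xi>.
     (\<forall>c\<in>charts_at A p. \<forall>c'\<in>charts_at A p.
        \<xi> c' = frechet_derivative (transition c c') (at (app_chart c p)) (\<xi> c)) \<and>
     (\<forall>c. c \<notin> charts_at A p \<longrightarrow> \<xi> c = 0)}"

text \<open>The tangent vector at \<open>p\<close> whose representative in the chart \<open>c\<close> is \<open>v\<close>.\<close>

definition tvec_of ::
  "('m, 'e::euclidean_space) chart set \<Rightarrow> ('m, 'e) chart \<Rightarrow> 'm \<Rightarrow> 'e \<Rightarrow> ('m, 'e) tvec" where
  "tvec_of A c p v = (\<lambda>c'. if c' \<in> charts_at A p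
     then frechet_derivative (transition c c') (at (app_chart c p)) v else 0)"

text \<open>Velocity of a curve defined on the interval \<open>T\<close>; one-sided at end points of \<open>T\<close>.\<close>

definition velocity ::
  "('m, 'e::euclidean_space) chart set \<Rightarrow> real set \<Rightarrow> (real \<Rightarrow> 'm) \<Rightarrow> real \<Rightarrow> ('m, 'e) tvec" where
  "velocity A T \<gamma> t = (\<lambda>c. if c \<in> charts_at A (\<gamma> t)
     then vector_derivative (\<lambda>r. app_chart c (\<gamma> r)) (at t within T) else 0)"

definition smooth_field_along ::
  "('m, 'e::euclidean_space) chart set \<Rightarrow> (real \<Rightarrow> 'm) \<Rightarrow> (real \<Rightarrow> ('m, 'e) tvec) \<Rightarrow> bool" where
  "smooth_field_along A \<gamma> X \<longleftrightarrow>
     (\<forall>t. X t \<in> tangent_space A (\<gamma> t)) \<and>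
     (\<forall>c\<in>A. smooth_on (\<gamma> -` dom_chart c) (\<lambda>t. X t c))"


section \<open>Riemannian metrics and the Levi-Civita connection\<close>

type_synonym ('m, 'e) metric = "'m \<Rightarrow> ('m, 'e) tvec \<Rightarrow> ('m, 'e) tvec \<Rightarrow> real"

text \<open>The metric in the chart \<open>c\<close>, as a bilinear form depending on \<open>x\<close> in the image of \<open>c\<close>.\<close>

definition metric_coeff ::
  "('m, 'e::euclidean_space) chart set \<Rightarrow> ('m, 'e) metric \<Rightarrow> ('m, 'e) chart \<Rightarrow> 'e \<Rightarrow> 'e \<Rightarrow> 'e \<Rightarrow> real" where
  "metric_coeff A g c x v w =
     g (inv_chart c x) (tvec_of A c (inv_chart c x) v) (tvec_of A c (inv_chart c x) w)"

text \<open>For a chart \<open>c\<close> at \<open>p\<close> the map \<open>tvec_of A c p\<close> is a linear isomorphism onto the tangent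
  space at \<open>p\<close>, so the following says that \<open>g p\<close> is an inner product on each tangent space and
  depends smoothly on \<open>p\<close>.\<close>

definition riemannian_metric ::
  "('m, 'e::euclidean_space) chart set \<Rightarrow> ('m, 'e) metric \<Rightarrow> bool" where
  "riemannian_metric A g \<longleftrightarrow>
     (\<forall>c\<in>A.
        (\<forall>x\<in>img_chart c.
           bilinear (metric_coeff A g c x) \<and>
           (\<forall>v w. metric_coeff A g c x v w = metric_coeff A g c x w v) \<and>
           (\<forall>v. v \<noteq> 0 \<longrightarrow> metric_coeff A g c x v v > 0)) \<and>
        (\<forall>v w. smooth_on (img_chart c) (\<lambda>x. metric_coeff A g c x v w)))"

definition tnorm :: "('m, 'e) metric \<Rightarrow> 'm \<Rightarrow> ('m, 'e) tvec \<Rightarrow> real" where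
  "tnorm g p \<xi> = sqrt (g p \<xi> \<xi>)"

text \<open>The Christoffel symbol at \<open>x\<close> in the chart \<open>c\<close>, i.e. \<open>(v, w) \<mapsto> \<nabla>\<^sub>v w\<close> for constant
  coordinate fields, of the unique connection that is torsion free and compatible with the metric.\<close>

definition christoffel ::
  "('m, 'e::euclidean_space) chart set \<Rightarrow> ('m, 'e) metric \<Rightarrow> ('m, 'e) chart \<Rightarrow> 'e \<Rightarrow> 'e \<Rightarrow> 'e \<Rightarrow> 'e" where
  "christoffel A g c x = (THE \<Gamma>.
     bilinear \<Gamma> \<and>
     (\<forall>v w. \<Gamma> v w = \<Gamma> w v) \<and>
     (\<forall>z v w. frechet_derivative (\<lambda>y. metric_coeff A g c y v w) (at x) z =
        metric_coeff A g c x (\<Gamma> z v) w + metric_coeff A g c x v (\<Gamma> z w)))"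

text \<open>Levi-Civita covariant derivative of a vector field \<open>X\<close> along a curve \<open>\<gamma>\<close> on the interval \<open>T\<close>.\<close>

definition cov_deriv ::
  "('m, 'e::euclidean_space) chart set \<Rightarrow> ('m, 'e) metric \<Rightarrow> real set \<Rightarrow> (real \<Rightarrow> 'm) \<Rightarrow>
   (real \<Rightarrow> ('m, 'e) tvec) \<Rightarrow> real \<Rightarrow> ('m, 'e) tvec" where
  "cov_deriv A g T \<gamma> X t = (\<lambda>c. if c \<in> charts_at A (\<gamma> t)
     then vector_derivative (\<lambda>r. X r c) (at t within T)
          + christoffel A g c (app_chart c (\<gamma> t)) (velocity A T \<gamma> t c) (X t c)
     else 0)"

definition cov_differentiable ::
  "('m, 'e::euclidean_space) chart set \<Rightarrow> real set \<Rightarrow> (real \<Rightarrow> 'm) \<Rightarrow>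
   (real \<Rightarrow> ('m, 'e) tvec) \<Rightarrow> real \<Rightarrow> bool" where
  "cov_differentiable A T \<gamma> X t \<longleftrightarrow>
     (\<forall>c\<in>charts_at A (\<gamma> t). (\<lambda>r. X r c) differentiable (at t within T))"


section \<open>The loop space and perturbations\<close>

text \<open>Maps on the circle \<open>\<real>/\<int>\<close> are 1-periodic maps on \<open>\<real>\<close>.\<close>

definition loop_space ::
  "('m::topological_space, 'e::euclidean_space) chart set \<Rightarrow> (real \<Rightarrow> 'm) set" where
  "loop_space A = {x. (\<forall>t. x (t + 1) = x t) \<and> smooth_map A UNIV x}"

text \<open>Smooth maps \<open>(s, t) \<mapsto> u s t\<close> on \<open>T \<times> \<real>/\<int>\<close>; values of \<open>u s\<close> for \<open>s \<notin> T\<close> are irrelevant.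
  For \<open>T = UNIV\<close> these are the smooth paths \<open>\<real> \<rightarrow> C\<^sup>\<infinity>(S\<^sup>1, M)\<close>.\<close>

definition smooth_cylinder ::
  "('m::topological_space, 'e::euclidean_space) chart set \<Rightarrow> real set \<Rightarrow> (real \<Rightarrow> real \<Rightarrow> 'm) \<Rightarrow> bool" where
  "smooth_cylinder A T u \<longleftrightarrow>
     (\<forall>s\<in>T. \<forall>t. u s (t + 1) = u s t) \<and>
     smooth_map A (T \<times> UNIV) (\<lambda>(s, t). u s t)"

abbreviation d_s ::
  "('m, 'e::euclidean_space) chart set \<Rightarrow> real set \<Rightarrow> (real \<Rightarrow> real \<Rightarrow> 'm) \<Rightarrow> real \<Rightarrow> real \<Rightarrow> ('m, 'e) tvec" where
  "d_s A T u s t \<equiv> velocity A T (\<lambda>r. u r t) s"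

abbreviation d_t ::
  "('m, 'e::euclidean_space) chart set \<Rightarrow> (real \<Rightarrow> real \<Rightarrow> 'm) \<Rightarrow> real \<Rightarrow> real \<Rightarrow> ('m, 'e) tvec" where
  "d_t A u s t \<equiv> velocity A UNIV (u s) t"

text \<open>Smoothness of a function on the Frechet manifold of loops, in the sense of convenient
  calculus: smooth paths are mapped to smooth functions. On Frechet manifolds this agrees with
  the notion defined through iterated directional derivatives.\<close>

definition smooth_functional ::
  "('m::topological_space, 'e::euclidean_space) chart set \<Rightarrow> ((real \<Rightarrow> 'm) \<Rightarrow> real) \<Rightarrow> bool" where
  "smooth_functional A V \<longleftrightarrow>
     (\<forall>u. smooth_cylinder A UNIV u \<longrightarrow> smooth_on UNIV (\<lambda>s. V (u s)))"

text \<open>\<open>grad x\<close> is the vector field \<open>t \<mapsto> grad x t\<close> along the loop \<open>x\<close>. On smooth loops \<open>grad\<close> is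
  uniquely determined by \<open>V\<close>.\<close>

definition is_L2_gradient ::
  "('m::topological_space, 'e::euclidean_space) chart set \<Rightarrow> ('m, 'e) metric \<Rightarrow>
   ((real \<Rightarrow> 'm) \<Rightarrow> real) \<Rightarrow> ((real \<Rightarrow> 'm) \<Rightarrow> real \<Rightarrow> ('m, 'e) tvec) \<Rightarrow> bool" where
  "is_L2_gradient A g V grad \<longleftrightarrow>
     (\<forall>x\<in>loop_space A. smooth_field_along A x (grad x) \<and> (\<forall>t. grad x (t + 1) = grad x t)) \<and>
     (\<forall>u. smooth_cylinder A UNIV u \<longrightarrow>
        (\<forall>s. ((\<lambda>r. V (u r)) has_real_derivative
               integral {0..1} (\<lambda>t. g (u s t) (grad (u s) t) (d_s A UNIV u s t))) (at s)))"

text \<open>The \<open>C\<^sup>0\<close> topology (topology of uniform convergence) on loops is the compact-open topology.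
  Compact sets of reals suffice, since these project onto all compact subsets of the circle.\<close>

definition C0_topology ::
  "('m::topological_space, 'e::euclidean_space) chart set \<Rightarrow> (real \<Rightarrow> 'm) topology" where
  "C0_topology A = topology_generated_by
     {{x \<in> loop_space A. x ` K \<subseteq> U} | K U. compact K \<and> open U}"

text \<open>The bound on the sum of the two suprema is expressed by independent loops \<open>x\<close>, \<open>y\<close>; since
  \<open>grad y\<close> is continuous, its \<open>L\<^sup>\<infinity>\<close>-norm is the pointwise supremum.\<close>

definition axiom_V0 ::
  "('m::topological_space, 'e::euclidean_space) chart set \<Rightarrow> ('m, 'e) metric \<Rightarrow>
   ((real \<Rightarrow> 'm) \<Rightarrow> real) \<Rightarrow> ((real \<Rightarrow> 'm) \<Rightarrow> real \<Rightarrow> ('m, 'e) tvec) \<Rightarrow> bool" where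
  "axiom_V0 A g V grad \<longleftrightarrow>
     continuous_map (C0_topology A) euclideanreal V \<and>
     (\<exists>C. \<forall>x\<in>loop_space A. \<forall>y\<in>loop_space A. \<forall>t. \<bar>V x\<bar> + tnorm g (y t) (grad y t) \<le> C)"

text \<open>The covariant derivatives in the estimates are part of the axiom, hence so is their
  existence.\<close>

definition axiom_V1 ::
  "('m::topological_space, 'e::euclidean_space) chart set \<Rightarrow> ('m, 'e) metric \<Rightarrow>
   ((real \<Rightarrow> 'm) \<Rightarrow> real \<Rightarrow> ('m, 'e) tvec) \<Rightarrow> bool" where
  "axiom_V1 A g grad \<longleftrightarrow>
     (\<exists>C. \<forall>u. smooth_cylinder A UNIV u \<longrightarrow> (\<forall>s t.
        cov_differentiable A UNIV (\<lambda>r. u r t) (\<lambda>r. grad (u r) t) s \<and>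
        cov_differentiable A UNIV (u s) (grad (u s)) t \<and>
        tnorm g (u s t) (cov_deriv A g UNIV (\<lambda>r. u r t) (\<lambda>r. grad (u r) t) s)
          \<le> C * (tnorm g (u s t) (d_s A UNIV u s t)
                 + integral {0..1} (\<lambda>\<tau>. tnorm g (u s \<tau>) (d_s A UNIV u s \<tau>))) \<and>
        tnorm g (u s t) (cov_deriv A g UNIV (u s) (grad (u s)) t)
          \<le> C * (1 + tnorm g (u s t) (d_t A u s t))))"

definition action ::
  "('m, 'e::euclidean_space) chart set \<Rightarrow> ('m, 'e) metric \<Rightarrow> ((real \<Rightarrow> 'm) \<Rightarrow> real) \<Rightarrow> (real \<Rightarrow> 'm) \<Rightarrow> real" where
  "action A g V x = 1/2 * integral {0..1} (\<lambda>t. (tnorm g (x t) (velocity A UNIV x t))\<^sup>2) - V x"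


section \<open>The heat equation\<close>

definition heat_solution ::
  "('m::topological_space, 'e::euclidean_space) chart set \<Rightarrow> ('m, 'e) metric \<Rightarrow>
   ((real \<Rightarrow> 'm) \<Rightarrow> real \<Rightarrow> ('m, 'e) tvec) \<Rightarrow> real set \<Rightarrow> (real \<Rightarrow> real \<Rightarrow> 'm) \<Rightarrow> bool" where
  "heat_solution A g grad T u \<longleftrightarrow>
     smooth_cylinder A T u \<and>
     (\<forall>s\<in>T. \<forall>t. \<forall>c\<in>charts_at A (u s t).
        d_s A T u s t c - cov_deriv A g UNIV (u s) (d_t A u s) t c - grad (u s) t c = 0)"

end

theory Submission
  imports Defs
begin

text \<open>
  Composing a solution \<open>u\<close> of the heat equation with a function \<open>f\<close> on \<open>M\<close> gives the scalar equation
  \<open>\<partial>\<^sub>s f(u) - \<partial>\<^sub>t\<^sup>2 f(u) = df(grad) - Hess f(\<partial>\<^sub>t u, \<partial>\<^sub>t u)\<close>, whose right hand side contains no second derivatives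
  of \<open>u\<close> (\<open>heat_equation_along\<close>). Take for \<open>f\<close> the components \<open>emb j\<close> of Whitney's embedding
  of \<open>M\<close> built from a finite cover by coordinate balls. Then two solutions \<open>u\<close>, \<open>v\<close> can be compared by the
  differences of finitely many real functions \<open>w\<^sub>j\<close>, which vanish exactly where \<open>u = v\<close>. While \<open>u\<close> and \<open>v\<close>
  are close, they lie in common charts, and on a compact \<open>s\<close>-interval
  \<open>|\<partial>\<^sub>s w\<^sub>j - \<partial>\<^sub>t\<^sup>2 w\<^sub>j| \<le> C \<Sum>\<^sub>k (|w\<^sub>k| + |\<partial>\<^sub>t w\<^sub>k| + \<parallel>w\<^sub>k\<parallel>\<^sub>1)\<close> (\<open>parabolic_difference\<close>).

  The Hessian term is locally Lipschitz because Christoffel symbols are. The gradient term is nonlocal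
  and is known only through its covariant derivatives along smooth paths of loops, so a path
  from \<open>u(s)\<close> to \<open>v(s)\<close> is needed whose speed is bounded by their distance. It is built from straight
  segments in one coordinate ball after the other, each cut off in terms of the target point, so that after
  the last ball every point has arrived (\<open>gradient_Lipschitz\<close>). To convert the hypothesis on the norm of
  the covariant derivative into a bound on coordinates, the covariant derivative must be shown to be
  a tangent vector, that is, Christoffel symbols must obey their transformation law
  (\<open>christoffel_transformation\<close>, \<open>cov_deriv_tangent\<close>).

  From the parabolic inequality, forward uniqueness follows by Gronwall's inequality for
  \<open>a = \<Sum>\<^sub>j \<parallel>w\<^sub>j\<parallel>\<^sup>2\<close>. Backward uniqueness is the argument of Agmon and Nirenberg: with
  \<open>b = \<Sum>\<^sub>j \<parallel>\<partial>\<^sub>t w\<^sub>j\<parallel>\<^sup>2\<close> the Dirichlet quotient \<open>b / a\<close> grows at most exponentially, hence \<open>log a\<close> is bounded below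
  and a nonzero \<open>w\<close> cannot vanish in finite time (\<open>log_convexity_backward\<close>, \<open>dirichlet_quotient\<close>). Both
  statements are local in \<open>s\<close>; since the set where \<open>u\<close> and \<open>v\<close> agree is closed, they propagate from \<open>s = 0\<close>
  along the whole half cylinder (\<open>extension_near\<close>, \<open>forward_continuation\<close>).
\<close>

section \<open>Calculus up to the boundary\<close>

text \<open>Through every point there are, in every coordinate direction, points of the set arbitrarily close
  to it. This makes derivatives within the set unique. Open sets and closed half planes have this
  property, so that one calculus of \<^const>\<open>Ck_on\<close> covers loops, paths of loops and half cylinders.\<close>

definition fat :: "'a::euclidean_space set \<Rightarrow> bool" where
  "fat S \<longleftrightarrow> (\<forall>x\<in>S. \<forall>i\<in>Basis. \<forall>e>0. \<exists>d. 0 < \<bar>d\<bar> \<and> \<bar>d\<bar> < e \<and> x + d *\<^sub>R i \<in> S)"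

lemma frechet_derivative_fat:
  assumes "fat S" "x \<in> S" "(f has_derivative f') (at x within S)"
  shows "frechet_derivative f (at x within S) = f'"
proof (rule frechet_derivative_unique_within[OF _ assms(3)])
  show "(f has_derivative frechet_derivative f (at x within S)) (at x within S)"
    using assms(3) differentiable_def frechet_derivative_works by blast
qed (use assms in \<open>auto simp: fat_def\<close>)

lemma fat_open:
  assumes "open S" shows "fat S"
  unfolding fat_def
proof (intro ballI allI impI)
  fix x i :: 'a and e :: real assume x: "x \<in> S" "i \<in> Basis" "0 < e"
  obtain r where r: "r > 0" "ball x r \<subseteq> S" using assms x openE by blast
  show "\<exists>d. 0 < \<bar>d\<bar> \<and> \<bar>d\<bar> < e \<and> x + d *\<^sub>R i \<in> S"
    by (rule exI[of _ "min e r / 2"]) (use x r in \<open>auto simp: dist_norm intro!: subsetD[OF r(2)]\<close>)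
qed

lemma fat_Int_open:
  assumes "fat S" "open U" shows "fat (S \<inter> U)"
  unfolding fat_def
proof (intro ballI allI impI)
  fix x i :: 'a and e :: real assume x: "x \<in> S \<inter> U" "i \<in> Basis" "0 < e"
  obtain r where r: "r > 0" "ball x r \<subseteq> U" using assms x openE by blast
  obtain d where "0 < \<bar>d\<bar>" "\<bar>d\<bar> < min e r" "x + d *\<^sub>R i \<in> S"
    using assms(1) x r unfolding fat_def by (metis IntD1 min_less_iff_conj)
  then show "\<exists>d. 0 < \<bar>d\<bar> \<and> \<bar>d\<bar> < e \<and> x + d *\<^sub>R i \<in> S \<inter> U"
    using r x by (auto simp: dist_norm intro!: exI[of _ d] subsetD[OF r(2)])
qed

lemma fat_halfplanes: "fat ({0..} \<times> UNIV :: (real\<times>real) set)" "fat ({..0} \<times> UNIV :: (real\<times>real) set)"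
proof -
  show "fat ({0..} \<times> UNIV :: (real\<times>real) set)" unfolding fat_def
  proof (intro ballI allI impI)
    fix x i :: "real\<times>real" and e :: real assume "x \<in> {0..} \<times> UNIV" "i \<in> Basis" "0 < e"
    then show "\<exists>d. 0 < \<bar>d\<bar> \<and> \<bar>d\<bar> < e \<and> x + d *\<^sub>R i \<in> {0..} \<times> UNIV"
      by (intro exI[of _ "e/2"]) (auto simp: Basis_prod_def)
  qed
  show "fat ({..0} \<times> UNIV :: (real\<times>real) set)" unfolding fat_def
  proof (intro ballI allI impI)
    fix x i :: "real\<times>real" and e :: real assume "x \<in> {..0} \<times> UNIV" "i \<in> Basis" "0 < e"
    then show "\<exists>d. 0 < \<bar>d\<bar> \<and> \<bar>d\<bar> < e \<and> x + d *\<^sub>R i \<in> {..0} \<times> UNIV"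
      by (intro exI[of _ "-e/2"]) (auto simp: Basis_prod_def)
  qed
qed

lemma has_derivative_cong_on:
  assumes "x \<in> S" "\<And>y. y \<in> S \<Longrightarrow> f y = g y"
  shows "(f has_derivative f') (at x within S) \<longleftrightarrow> (g has_derivative f') (at x within S)"
  using has_derivative_transform[of x S f g f'] has_derivative_transform[of x S g f f'] assms by auto

lemma frechet_derivative_cong_on:
  assumes "x \<in> S" "\<And>y. y \<in> S \<Longrightarrow> f y = g y"
  shows "frechet_derivative f (at x within S) = frechet_derivative g (at x within S)"
  unfolding frechet_derivative_def using has_derivative_cong_on[OF assms] by simp

lemma Ck_on_cong:
  assumes "\<And>x. x \<in> S \<Longrightarrow> f x = g x"
  shows "Ck_on k S f \<longleftrightarrow> Ck_on k S g"
  using assms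
proof (induction k arbitrary: f g)
  case 0 then show ?case by (auto cong: continuous_on_cong)
next
  case (Suc k)
  have "\<And>v. Ck_on k S (\<lambda>x. frechet_derivative f (at x within S) v) =
      Ck_on k S (\<lambda>x. frechet_derivative g (at x within S) v)"
    by (rule Suc.IH) (use frechet_derivative_cong_on[of _ S f g] Suc.prems in auto)
  moreover have "\<forall>x\<in>S. f differentiable (at x within S) \<longleftrightarrow> g differentiable (at x within S)"
    unfolding differentiable_def using has_derivative_cong_on[of _ S f g] Suc.prems by auto
  ultimately show ?case by auto
qed

lemma at_within_Int_open_eq: "open U \<Longrightarrow> x \<in> U \<Longrightarrow> at x within (S \<inter> U) = at x within S"
  by (rule at_within_nhd[of _ U]) auto

lemma Ck_on_Int_open:
  assumes "Ck_on k S f" "open U" shows "Ck_on k (S \<inter> U) f"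
  using assms
proof (induction k arbitrary: f)
  case 0 then show ?case using continuous_on_subset[of S f "S \<inter> U"] by auto
next
  case (Suc k)
  have "Ck_on k (S \<inter> U) (\<lambda>x. frechet_derivative f (at x within S \<inter> U) v)" for v
    using Suc by (subst Ck_on_cong[of _ _ "\<lambda>x. frechet_derivative f (at x within S) v"])
      (auto simp: at_within_Int_open_eq)
  then show ?case using Suc.prems by (auto simp: at_within_Int_open_eq)
qed

text \<open>Derivatives within \<open>S\<close> and within \<open>S \<inter> U\<close> agree at points of an open set \<open>U\<close>, so regularity can be
  checked near each point. Maps into the manifold are only ever known in one chart at a time.\<close>

lemma Ck_on_local:
  assumes "\<And>x. x \<in> S \<Longrightarrow> \<exists>U. open U \<and> x \<in> U \<and> Ck_on k (S \<inter> U) f"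
  shows "Ck_on k S f"
  using assms
proof (induction k arbitrary: f)
  case 0
  have "continuous (at x within S) f" if x: "x \<in> S" for x
  proof -
    obtain U where U: "open U" "x \<in> U" "continuous_on (S \<inter> U) f" using 0[OF x] by auto
    then have "continuous (at x within S \<inter> U) f"
      using x by (simp add: continuous_on_eq_continuous_within)
    then show ?thesis using U at_within_Int_open_eq by metis
  qed
  then show ?case by (simp add: continuous_on_eq_continuous_within)
next
  case (Suc k)
  have "\<exists>U. open U \<and> x \<in> U \<and> Ck_on k (S \<inter> U) (\<lambda>x. frechet_derivative f (at x within S) v)"
    if x: "x \<in> S" for x v
  proof -
    obtain U where U: "open U" "x \<in> U" "Ck_on (Suc k) (S \<inter> U) f" using Suc.prems[OF x] by auto
    have "Ck_on k (S \<inter> U) (\<lambda>x. frechet_derivative f (at x within S \<inter> U) v)" using U by simp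
    then have "Ck_on k (S \<inter> U) (\<lambda>x. frechet_derivative f (at x within S) v)"
      by (subst Ck_on_cong[where g = "\<lambda>x. frechet_derivative f (at x within S \<inter> U) v"])
        (auto simp: at_within_Int_open_eq U)
    then show ?thesis using U by auto
  qed
  then have "Ck_on k S (\<lambda>x. frechet_derivative f (at x within S) v)" for v
    using Suc.IH by blast
  moreover have "f differentiable (at x within S)" if x: "x \<in> S" for x
  proof -
    obtain U where U: "open U" "x \<in> U" "Ck_on (Suc k) (S \<inter> U) f" using Suc.prems[OF x] by auto
    then show ?thesis using x by (auto simp: at_within_Int_open_eq)
  qed
  ultimately show ?case by simp
qed

lemma Ck_on_Suc_lower: "Ck_on (Suc k) S f \<Longrightarrow> Ck_on k S f"
proof (induction k arbitrary: f)
  case 0 then show ?case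
    by (simp add: continuous_on_eq_continuous_within differentiable_imp_continuous_within)
next
  case (Suc k) then show ?case by auto
qed

text \<open>By uniqueness of derivatives on a fat set, any family of derivatives may replace the one that the
  choice operator picks in the definition of \<^const>\<open>Ck_on\<close>.\<close>

lemma Ck_on_SucI:
  assumes "fat S" "\<And>x. x \<in> S \<Longrightarrow> (f has_derivative f' x) (at x within S)"
    "\<And>v. Ck_on k S (\<lambda>x. f' x v)"
  shows "Ck_on (Suc k) S f"
proof -
  have "Ck_on k S (\<lambda>x. frechet_derivative f (at x within S) v)" for v
    by (rule iffD2[OF Ck_on_cong assms(3)]) (simp add: frechet_derivative_fat[OF assms(1) _ assms(2)])
  then show ?thesis using assms(2) unfolding Ck_on.simps differentiable_def by blast
qed

lemma Ck_on_Suc_has_derivative: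
  "Ck_on (Suc k) S f \<Longrightarrow> x \<in> S \<Longrightarrow>
    (f has_derivative frechet_derivative f (at x within S)) (at x within S)"
  using frechet_derivative_works by auto

lemma Ck_on_const: "fat S \<Longrightarrow> Ck_on k S (\<lambda>x. c)"
proof (induction k arbitrary: c)
  case (Suc k)
  show ?case by (rule Ck_on_SucI[where f'="\<lambda>x v. 0"]) (use Suc in auto)
qed auto

lemma Ck_on_add:
  "fat S \<Longrightarrow> Ck_on k S f \<Longrightarrow> Ck_on k S g \<Longrightarrow> Ck_on k S (\<lambda>x. f x + g x)"
proof (induction k arbitrary: f g)
  case 0 then show ?case by (auto intro: continuous_intros)
next
  case (Suc k)
  show ?case
    by (rule Ck_on_SucI[OF Suc.prems(1) has_derivative_add[OF
            Ck_on_Suc_has_derivative[OF Suc.prems(2)] Ck_on_Suc_has_derivative[OF Suc.prems(3)]]])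
      (use Suc in auto)
qed

lemma Ck_on_sum:
  assumes "fat S" "\<And>i. i \<in> I \<Longrightarrow> Ck_on k S (f i)"
  shows "Ck_on k S (\<lambda>x. \<Sum>i\<in>I. f i x)"
  using assms(2)
  by (induction I rule: infinite_finite_induct) (auto intro: Ck_on_add Ck_on_const assms(1))

lemma Ck_on_bounded_linear:
  assumes h: "bounded_linear h"
  shows "fat S \<Longrightarrow> Ck_on k S f \<Longrightarrow> Ck_on k S (\<lambda>x. h (f x))"
proof (induction k arbitrary: f)
  case 0 then show ?case by (auto intro: bounded_linear.continuous_on[OF h])
next
  case (Suc k)
  show ?case
    by (rule Ck_on_SucI[OF Suc.prems(1) bounded_linear.has_derivative[OF h
            Ck_on_Suc_has_derivative[OF Suc.prems(2)]]])
      (use Suc in auto)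
qed

lemma Ck_on_bounded_bilinear:
  assumes h: "bounded_bilinear h"
  shows "fat S \<Longrightarrow> Ck_on k S f \<Longrightarrow> Ck_on k S g \<Longrightarrow> Ck_on k S (\<lambda>x. h (f x) (g x))"
proof (induction k arbitrary: f g)
  case 0 then show ?case by (auto intro: bounded_bilinear.continuous_on[OF h])
next
  case (Suc k)
  show ?case
    by (rule Ck_on_SucI[OF Suc.prems(1) bounded_bilinear.FDERIV[OF h
            Ck_on_Suc_has_derivative[OF Suc.prems(2)] Ck_on_Suc_has_derivative[OF Suc.prems(3)]]])
      (use Suc Ck_on_Suc_lower[OF Suc.prems(2)] Ck_on_Suc_lower[OF Suc.prems(3)]
        in \<open>auto intro!: Ck_on_add\<close>)
qed

lemma linear_Basis_expand:
  fixes v :: "'a::euclidean_space"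
  assumes "linear h" shows "h v = (\<Sum>b\<in>Basis. (v \<bullet> b) *\<^sub>R h b)"
  by (subst euclidean_representation[of v, symmetric]) (simp add: linear_sum[OF assms] linear_cmul[OF assms])

text \<open>Bounds on basis vectors are all that compactness provides; this turns them into operator bounds.\<close>

lemma norm_linear_le_Basis:
  fixes h :: "'a::euclidean_space \<Rightarrow> 'b::real_normed_vector"
  assumes h: "linear h" and d: "\<And>b. b \<in> Basis \<Longrightarrow> norm (h b) \<le> d b"
  shows "norm (h v) \<le> (\<Sum>b\<in>Basis. d b) * norm v"
proof -
  have "norm (h v) \<le> (\<Sum>b\<in>Basis. norm ((v \<bullet> b) *\<^sub>R h b))"
    by (subst linear_Basis_expand[OF h]) (rule norm_sum)
  also have "\<dots> \<le> (\<Sum>b\<in>Basis. norm v * d b)"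
    by (rule sum_mono) (auto intro!: mult_mono d simp: Basis_le_norm)
  finally show ?thesis by (simp add: sum_distrib_left mult.commute)
qed

text \<open>Written out over the basis, the chain rule is a sum of products of components of the derivative of
  \<open>f\<close> with partial derivatives of \<open>g\<close> along \<open>f\<close>; the latter are compositions to which the induction
  hypothesis applies.\<close>

lemma Ck_on_compose:
  fixes f :: "'a::euclidean_space \<Rightarrow> 'b::euclidean_space"
  shows "fat S \<Longrightarrow> Ck_on k S f \<Longrightarrow> Ck_on k T g \<Longrightarrow> f ` S \<subseteq> T \<Longrightarrow> Ck_on k S (\<lambda>x. g (f x))"
proof (induction k arbitrary: g)
  case 0 then show ?case using continuous_on_compose2 by auto
next
  case (Suc k)
  let ?f = "\<lambda>x. frechet_derivative f (at x within S)" and ?g = "\<lambda>x. frechet_derivative g (at x within T)"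
  have gT: "(g has_derivative ?g (f x)) (at (f x) within T)" if "x \<in> S" for x
    using Suc.prems that by (intro Ck_on_Suc_has_derivative) auto
  have "((\<lambda>x. g (f x)) has_derivative (\<lambda>v. ?g (f x) (?f x v))) (at x within S)" if x: "x \<in> S" for x
    using has_derivative_in_compose[OF Ck_on_Suc_has_derivative[OF Suc.prems(2) x]
       has_derivative_subset[OF gT[OF x] Suc.prems(4)]] by simp
  moreover have "Ck_on k S (\<lambda>x. ?g (f x) (?f x v))" for v
  proof -
    have "Ck_on k S (\<lambda>x. \<Sum>b\<in>Basis. (?f x v \<bullet> b) *\<^sub>R ?g (f x) b)"
    proof (intro Ck_on_sum Suc.prems(1) Ck_on_bounded_bilinear[OF bounded_bilinear_scaleR])
      fix b :: 'b
      show "Ck_on k S (\<lambda>x. ?f x v \<bullet> b)"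
        using Suc.prems by (intro Ck_on_bounded_linear[OF bounded_linear_inner_left]) auto
      show "Ck_on k S (\<lambda>x. ?g (f x) b)"
        by (rule Suc.IH[where g="\<lambda>y. ?g y b"]) (use Suc.prems Ck_on_Suc_lower[OF Suc.prems(2)] in auto)
    qed
    then show ?thesis
      by (rule iffD1[OF Ck_on_cong, rotated])
        (metis gT has_derivative_linear linear_Basis_expand)
  qed
  ultimately show ?case by (rule Ck_on_SucI[OF Suc.prems(1)])
qed

lemma smooth_on_cong: "(\<And>x. x \<in> S \<Longrightarrow> f x = g x) \<Longrightarrow> smooth_on S f \<longleftrightarrow> smooth_on S g"
  proof -
  assume "\<And>x. x \<in> S \<Longrightarrow> f x = g x"
  then have "Ck_on k S f \<longleftrightarrow> Ck_on k S g" for k by (rule Ck_on_cong)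
  then show ?thesis unfolding smooth_on_def by blast
qed

lemma smooth_on_Int_open: "smooth_on S f \<Longrightarrow> open U \<Longrightarrow> smooth_on (S \<inter> U) f"
  unfolding smooth_on_def using Ck_on_Int_open by blast

lemma smooth_on_local:
  assumes "\<And>x. x \<in> S \<Longrightarrow> \<exists>U. open U \<and> x \<in> U \<and> smooth_on (S \<inter> U) f"
  shows "smooth_on S f"
  unfolding smooth_on_def
proof
  fix k show "Ck_on k S f"
    by (rule Ck_on_local) (use assms in \<open>auto simp: smooth_on_def\<close>)
qed

lemma smooth_on_const: "fat S \<Longrightarrow> smooth_on S (\<lambda>x. c)"
  unfolding smooth_on_def using Ck_on_const by blast

lemma smooth_on_ident: "fat S \<Longrightarrow> smooth_on S (\<lambda>x. x)"
  unfolding smooth_on_def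
proof
  fix k show "fat S \<Longrightarrow> Ck_on k S (\<lambda>x. x)"
    by (cases k) (auto simp: continuous_on_id simp del: Ck_on.simps(2)
       intro!: Ck_on_SucI has_derivative_ident Ck_on_const)
qed

lemma smooth_on_add: "fat S \<Longrightarrow> smooth_on S f \<Longrightarrow> smooth_on S g \<Longrightarrow> smooth_on S (\<lambda>x. f x + g x)"
  unfolding smooth_on_def using Ck_on_add by blast

lemma smooth_on_bounded_linear:
  "bounded_linear h \<Longrightarrow> fat S \<Longrightarrow> smooth_on S f \<Longrightarrow> smooth_on S (\<lambda>x. h (f x))"
  unfolding smooth_on_def using Ck_on_bounded_linear by blast

lemma smooth_on_bounded_bilinear:
  "bounded_bilinear h \<Longrightarrow> fat S \<Longrightarrow> smooth_on S f \<Longrightarrow> smooth_on S g \<Longrightarrow> smooth_on S (\<lambda>x. h (f x) (g x))"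
  unfolding smooth_on_def using Ck_on_bounded_bilinear by blast

lemma smooth_on_diff: "fat S \<Longrightarrow> smooth_on S f \<Longrightarrow> smooth_on S g \<Longrightarrow> smooth_on S (\<lambda>x. f x - g x)"
  using smooth_on_add[of S f "\<lambda>x. - g x"] smooth_on_bounded_linear[OF bounded_linear_minus[OF bounded_linear_ident], of S g]
  by simp

lemma smooth_on_compose:
  fixes f :: "'a::euclidean_space \<Rightarrow> 'b::euclidean_space"
  shows "fat S \<Longrightarrow> smooth_on S f \<Longrightarrow> smooth_on T g \<Longrightarrow> f ` S \<subseteq> T \<Longrightarrow> smooth_on S (\<lambda>x. g (f x))"
  unfolding smooth_on_def using Ck_on_compose by blast

lemma smooth_on_derivative:
  "smooth_on S f \<Longrightarrow> smooth_on S (\<lambda>x. frechet_derivative f (at x within S) v)"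
  unfolding smooth_on_def using Ck_on.simps(2) by blast

lemma smooth_on_derivative_open:
  assumes "smooth_on S f" "open S"
  shows "smooth_on S (\<lambda>x. frechet_derivative f (at x) v)"
  using smooth_on_derivative[OF assms(1), of v]
  by (rule iffD1[OF smooth_on_cong, rotated]) (simp add: at_within_open[OF _ assms(2)])

lemma smooth_on_has_derivative:
  "smooth_on S f \<Longrightarrow> x \<in> S \<Longrightarrow>
    (f has_derivative frechet_derivative f (at x within S)) (at x within S)"
  unfolding smooth_on_def using Ck_on_Suc_has_derivative by blast

lemma smooth_on_has_derivative_open:
  "smooth_on S f \<Longrightarrow> open S \<Longrightarrow> x \<in> S \<Longrightarrow> (f has_derivative frechet_derivative f (at x)) (at x)"
  using smooth_on_has_derivative[of S f x] at_within_open[of x S] by simp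

lemma smooth_on_imp_continuous_on: "smooth_on S f \<Longrightarrow> continuous_on S f"
  unfolding smooth_on_def using Ck_on.simps(1) by blast

lemma smooth_on_pair:
  fixes f :: "'a::euclidean_space \<Rightarrow> 'b::euclidean_space" and g :: "'a \<Rightarrow> 'c::euclidean_space"
  assumes "fat S" "smooth_on S f" "smooth_on S g"
  shows "smooth_on S (\<lambda>x. (f x, g x))"
proof -
  have "smooth_on S (\<lambda>x. (f x, 0) + (0, g x))"
    by (intro smooth_on_add assms smooth_on_bounded_linear[of "\<lambda>y. (y, 0)"] smooth_on_bounded_linear[of "\<lambda>y. (0, y)"]
        bounded_linear_Pair bounded_linear_ident bounded_linear_zero)
  then show ?thesis by simp
qed

section \<open>Smooth cutoff functions of one variable\<close>

text \<open>Differentiating \<open>inverse x ^ n\<close> raises the exponent, so the induction on the order of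
  differentiability has to run over all exponents simultaneously.\<close>

lemma smooth_on_real_inverse: "smooth_on {0<..} (\<lambda>x::real. inverse x)"
proof -
  have S: "fat {0::real<..}" by (rule fat_open) auto
  have "Ck_on k {0<..} (\<lambda>x::real. inverse x ^ n)" for k n
  proof (induction k arbitrary: n)
    case 0 show ?case by (auto intro!: continuous_intros)
  next
    case (Suc k)
    have d: "((\<lambda>x::real. inverse x ^ n) has_derivative (\<lambda>v. (v * - real n) * inverse x ^ (n+1))) (at x within {0<..})"
      if "x \<in> {0<..}" for x :: real
    proof -
      have "((\<lambda>x::real. inverse x ^ n) has_field_derivative - real n * inverse x ^ (n+1)) (at x within {0<..})"
      proof -
        have "((\<lambda>x::real. inverse x ^ n) has_field_derivative
            real n * (- (inverse x * 1 * inverse x) * inverse x ^ (n - 1))) (at x within {0<..})"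
          using that by (auto intro!: derivative_eq_intros)
        moreover have "real n * (- (inverse x * 1 * inverse x) * inverse x ^ (n - 1)) = - real n * inverse x ^ (n+1)"
          by (cases n) (auto simp: algebra_simps)
        ultimately show ?thesis by (simp only:)
      qed
      then show ?thesis by (auto simp: has_field_derivative_def ac_simps elim!: has_derivative_eq_rhs)
    qed
    show ?case
      by (rule Ck_on_SucI[OF S d], assumption) (intro Ck_on_bounded_linear[OF bounded_linear_mult_right] S Suc)
  qed
  from this[of _ 1] show ?thesis by (simp add: smooth_on_def)
qed

text \<open>The functions \<open>x\<close> to the power \<open>- n\<close> times \<open>exp (- 1 / x)\<close>, extended by zero. Their span is closed under differentiation, which
  gives smoothness across the origin for all of them at once.\<close>

definition flat_exp :: "nat \<Rightarrow> real \<Rightarrow> real" where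
  "flat_exp n x = (if x > 0 then inverse x ^ n * exp (- inverse x) else 0)"

lemma flat_exp_at_right: "(flat_exp n \<longlongrightarrow> 0) (at 0)"
proof -
  have "((\<lambda>x. inverse x ^ n * exp (- inverse x)) \<longlongrightarrow> 0) (at_right (0::real))"
    using filterlim_compose[OF tendsto_power_div_exp_0[of n] filterlim_inverse_at_top_right]
    by (simp add: exp_minus divide_inverse)
  then have r: "(flat_exp n \<longlongrightarrow> 0) (at_right 0)"
    by (rule Lim_transform_eventually)
      (auto simp: flat_exp_def eventually_at_right_less intro!: eventually_mono[OF eventually_at_right_less])
  have "eventually (\<lambda>x. flat_exp n x = 0) (at_left 0)"
    by (auto simp: flat_exp_def eventually_at_filter)
  then have "(flat_exp n \<longlongrightarrow> 0) (at_left 0)" by (simp add: tendsto_eventually)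
  with r show ?thesis by (simp add: filterlim_at_split)
qed

lemma flat_exp_deriv: "(flat_exp n has_real_derivative (flat_exp (n+2) x - real n * flat_exp (n+1) x)) (at x)"
proof -
  consider "x > 0" | "x < 0" | "x = 0" by linarith
  then show ?thesis
  proof cases
    case 1
    have "((\<lambda>x. inverse x ^ n * exp (- inverse x)) has_real_derivative (flat_exp (n+2) x - real n * flat_exp (n+1) x)) (at x)"
    proof -
      have "((\<lambda>x. inverse x ^ n * exp (- inverse x)) has_real_derivative
          (real n * (- (inverse x * 1 * inverse x) * inverse x ^ (n - 1))) * exp (- inverse x)
          + exp (- inverse x) * (inverse x * 1 * inverse x) * inverse x ^ n) (at x)"
        using 1 by (auto intro!: derivative_eq_intros)
      moreover have "real n * (- (inverse x * 1 * inverse x) * inverse x ^ (n - 1)) = - real n * inverse x ^ (n+1)"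
        by (cases n) (auto simp: algebra_simps)
      ultimately have "((\<lambda>x. inverse x ^ n * exp (- inverse x)) has_real_derivative
          (- real n * inverse x ^ (n+1)) * exp (- inverse x)
          + exp (- inverse x) * (inverse x * 1 * inverse x) * inverse x ^ n) (at x)"
        by (simp only:)
      then show ?thesis using 1 by (simp add: flat_exp_def algebra_simps)
    qed
    then show ?thesis
      by (rule has_field_derivative_transform_within_open[where S="{0<..}"]) (use 1 in \<open>auto simp: flat_exp_def\<close>)
  next
    case 2
    have "((\<lambda>x. 0) has_real_derivative (flat_exp (n+2) x - real n * flat_exp (n+1) x)) (at x)"
      using 2 by (simp add: flat_exp_def)
    then show ?thesis
      by (rule has_field_derivative_transform_within_open[where S="{..<0}"]) (use 2 in \<open>auto simp: flat_exp_def\<close>)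
  next
    case 3
    have "((\<lambda>y. (flat_exp n y - flat_exp n 0) / (y - 0)) \<longlongrightarrow> 0) (at 0)"
      by (rule Lim_transform_eventually[OF flat_exp_at_right[of "n+1"]])
        (auto simp: flat_exp_def eventually_at_filter field_simps)
    then show ?thesis using 3 by (simp add: has_field_derivative_iff flat_exp_def)
  qed
qed

lemma smooth_on_flat_exp: "smooth_on UNIV (flat_exp n)"
proof -
  have S: "fat (UNIV::real set)" by (rule fat_open) auto
  have "Ck_on k UNIV (flat_exp n)" for k n
  proof (induction k arbitrary: n)
    case 0 show ?case by (simp add: DERIV_continuous_on[OF flat_exp_deriv])
  next
    case (Suc k)
    have d: "(flat_exp n has_derivative (\<lambda>v. v * flat_exp (n+2) x + (v * (- real n)) * flat_exp (n+1) x)) (at x within UNIV)" for x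
      using flat_exp_deriv[of n x] by (auto simp: has_field_derivative_def algebra_simps elim!: has_derivative_eq_rhs)
    show ?case
      by (rule Ck_on_SucI[OF S d])
        (intro Ck_on_add Ck_on_bounded_linear[OF bounded_linear_mult_right] S Suc)
  qed
  then show ?thesis by (simp add: smooth_on_def)
qed

definition smooth_step :: "real \<Rightarrow> real" where
  "smooth_step x = flat_exp 0 x * inverse (flat_exp 0 x + flat_exp 0 (1 - x))"

lemma smooth_step_denominator: "0 < flat_exp 0 x + flat_exp 0 (1 - x)"
  by (auto simp: flat_exp_def add_pos_pos)

lemma smooth_step_simps: "x \<le> 0 \<Longrightarrow> smooth_step x = 0" "x \<ge> 1 \<Longrightarrow> smooth_step x = 1"
  by (auto simp: smooth_step_def flat_exp_def)

lemma smooth_step_bounds: "0 \<le> smooth_step x" "smooth_step x \<le> 1"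
proof -
  have "0 \<le> flat_exp 0 y" for y by (simp add: flat_exp_def)
  then show "0 \<le> smooth_step x" "smooth_step x \<le> 1"
    using smooth_step_denominator[of x] by (auto simp: smooth_step_def field_simps)
qed

lemma smooth_on_smooth_step: "smooth_on UNIV smooth_step"
proof -
  have S: "fat (UNIV::real set)" by (rule fat_open) auto
  have 1: "smooth_on UNIV (\<lambda>x. flat_exp 0 (1 - x))"
    by (rule smooth_on_compose[OF S _ smooth_on_flat_exp]) (auto intro!: smooth_on_diff S smooth_on_const smooth_on_ident)
  have "smooth_on UNIV (\<lambda>x. inverse (flat_exp 0 x + flat_exp 0 (1 - x)))"
    by (rule smooth_on_compose[OF S _ smooth_on_real_inverse])
      (auto intro!: smooth_on_add S 1 smooth_on_flat_exp smooth_step_denominator)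
  then have "smooth_on UNIV (\<lambda>x. flat_exp 0 x * inverse (flat_exp 0 x + flat_exp 0 (1 - x)))"
    by (rule smooth_on_bounded_bilinear[OF bounded_bilinear_mult S smooth_on_flat_exp])
  then show ?thesis unfolding smooth_step_def[abs_def] .
qed

section \<open>Symmetry of second derivatives and families of multilinear maps\<close>

text \<open>On a small parallelogram the increment of \<open>f\<close> in direction \<open>w\<close> is the integral of its derivative in
  that direction. Differentiating this identity in direction \<open>v\<close> under the integral sign, and then in
  direction \<open>w\<close>, produces the two mixed derivatives on its two sides.\<close>

lemma smooth_second_derivative_symmetric:
  fixes f :: "'a::euclidean_space \<Rightarrow> 'b::euclidean_space"
  assumes f: "smooth_on S f" and S: "open S" and x: "x \<in> S"
  shows "frechet_derivative (\<lambda>y. frechet_derivative f (at y) v) (at x) w =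
    frechet_derivative (\<lambda>y. frechet_derivative f (at y) w) (at x) v"
proof -
  define p where "p = (\<lambda>y. frechet_derivative f (at y) v)"
  define q where "q = (\<lambda>y. frechet_derivative f (at y) w)"
  define Dp where "Dp = (\<lambda>y. frechet_derivative p (at y))"
  define Dq where "Dq = (\<lambda>y. frechet_derivative q (at y))"
  have sp: "smooth_on S p" and sq: "smooth_on S q"
    unfolding p_def q_def by (rule smooth_on_derivative_open[OF f S])+
  have sDq: "smooth_on S (\<lambda>y. Dq y v)"
    unfolding Dq_def by (rule smooth_on_derivative_open[OF sq S])
  obtain r0 where r0: "r0 > 0" "ball x r0 \<subseteq> S" using S x openE by blast
  \<comment> \<open>so small that the parallelogram spanned at \<open>x\<close> by multiples of \<open>v\<close> and \<open>w\<close> stays in the ball\<close>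
  define r where "r = r0 / (2 * (1 + norm v + norm w))"
  have pos: "1 + norm v + norm w > 0" by (simp add: add_pos_nonneg)
  have r: "r > 0" unfolding r_def using r0 pos by simp
  define z where "z = (\<lambda>a b. x + a *\<^sub>R v + b *\<^sub>R w)"
  have zS: "z a b \<in> S" if "\<bar>a\<bar> \<le> r" "\<bar>b\<bar> \<le> r" for a b
  proof -
    have "norm (a *\<^sub>R v + b *\<^sub>R w) \<le> \<bar>a\<bar> * norm v + \<bar>b\<bar> * norm w"
      by (metis norm_scaleR norm_triangle_ineq)
    also have "\<dots> \<le> r * norm v + r * norm w" using that by (intro add_mono mult_right_mono) auto
    also have "\<dots> < r * (1 + norm v + norm w)" using r by (simp add: algebra_simps)
    also have "\<dots> = r0 / 2" unfolding r_def using pos by (simp add: field_simps)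
    finally have "dist (z a b) x < r0" using r0 by (simp add: z_def dist_norm add.assoc)
    then show ?thesis using r0 by (auto simp: dist_commute)
  qed
  have za: "((\<lambda>a. z a b) has_vector_derivative v) F" for a b F
    unfolding z_def has_vector_derivative_def by (auto intro!: derivative_eq_intros)
  have zb: "((\<lambda>b. z a b) has_vector_derivative w) F" for a b F
    unfolding z_def has_vector_derivative_def by (auto intro!: derivative_eq_intros)
  have fb: "((\<lambda>b. f (z a b)) has_vector_derivative q (z a b)) (at b within T)"
    if "\<bar>a\<bar> \<le> r" "\<bar>b\<bar> \<le> r" for a b T
    using vector_derivative_diff_chain_within[OF zb has_derivative_at_withinI[OF smooth_on_has_derivative_open[OF f S zS[OF that]]]]
    by (simp add: q_def o_def)
  have fa: "((\<lambda>a. f (z a b)) has_vector_derivative p (z a b)) (at a within T)"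
    if "\<bar>a\<bar> \<le> r" "\<bar>b\<bar> \<le> r" for a b T
    using vector_derivative_diff_chain_within[OF za has_derivative_at_withinI[OF smooth_on_has_derivative_open[OF f S zS[OF that]]]]
    by (simp add: p_def o_def)
  have qa: "((\<lambda>a. q (z a b)) has_vector_derivative Dq (z a b) v) (at a within T)"
    if "\<bar>a\<bar> \<le> r" "\<bar>b\<bar> \<le> r" for a b T
    using vector_derivative_diff_chain_within[OF za has_derivative_at_withinI[OF smooth_on_has_derivative_open[OF sq S zS[OF that]]]]
    by (simp add: Dq_def o_def)
  have pb: "((\<lambda>b. p (z a b)) has_vector_derivative Dp (z a b) w) (at b within T)"
    if "\<bar>a\<bar> \<le> r" "\<bar>b\<bar> \<le> r" for a b T
    using vector_derivative_diff_chain_within[OF zb has_derivative_at_withinI[OF smooth_on_has_derivative_open[OF sp S zS[OF that]]]]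
    by (simp add: Dp_def o_def)
  have cz: "continuous_on T (\<lambda>(a, b). z a b)" for T
    unfolding z_def case_prod_beta by (intro continuous_intros)
  have cDq: "continuous_on ({-r..r} \<times> {0..b}) (\<lambda>(a, b). Dq (z a b) v)" if "b \<le> r" for b
    using continuous_on_compose2[OF smooth_on_imp_continuous_on[OF sDq] cz[of "{-r..r} \<times> {0..b}"]] zS that
    by (force simp: case_prod_beta)
  have cq: "continuous_on {0..b} (\<lambda>b. q (z a b))" if "b \<le> r" "\<bar>a\<bar> \<le> r" for a b
    by (rule continuous_on_compose2[OF smooth_on_imp_continuous_on[OF sq]])
      (use zS that in \<open>auto simp: z_def intro!: continuous_intros\<close>)
  \<comment> \<open>differentiate the fundamental theorem of calculus in the second variable with respect to the first\<close>
  have eq: "p (z 0 b) - p (z 0 0) = integral {0..b} (\<lambda>\<tau>. Dq (z 0 \<tau>) v)" if b: "0 \<le> b" "b \<le> r" for b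
  proof -
    have ftc: "integral {0..b} (\<lambda>\<tau>. q (z a \<tau>)) = f (z a b) - f (z a 0)" if "a \<in> {-r..r}" for a
      by (rule integral_unique, rule fundamental_theorem_of_calculus[OF b(1)]) (use fb that b in auto)
    have "((\<lambda>a. integral (cbox 0 b) (\<lambda>\<tau>. q (z a \<tau>))) has_vector_derivative
        integral (cbox 0 b) (\<lambda>\<tau>. Dq (z 0 \<tau>) v)) (at 0 within {-r..r})"
      by (rule leibniz_rule_vector_derivative)
        (use b r qa cDq cq in \<open>auto intro!: integrable_continuous_real\<close>)
    from has_vector_derivative_transform[OF _ _ this[unfolded cbox_interval]]
    have "((\<lambda>a. f (z a b) - f (z a 0)) has_vector_derivative
        integral {0..b} (\<lambda>\<tau>. Dq (z 0 \<tau>) v)) (at 0 within {-r..r})"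
      using r ftc by auto
    moreover have "((\<lambda>a. f (z a b) - f (z a 0)) has_vector_derivative p (z 0 b) - p (z 0 0)) (at 0 within {-r..r})"
      using b r by (intro has_vector_derivative_diff fa) auto
    ultimately show ?thesis
      using vector_derivative_unique_within_closed_interval[of "-r" r 0] r by fastforce
  qed
  have "((\<lambda>b. integral {0..b} (\<lambda>\<tau>. Dq (z 0 \<tau>) v)) has_vector_derivative Dq (z 0 0) v) (at 0 within {0..r})"
    by (rule integral_has_vector_derivative)
     (use r zS[of 0] in \<open>auto simp: z_def intro!: continuous_intros continuous_on_compose2[OF smooth_on_imp_continuous_on[OF sDq]]\<close>)
  then have "((\<lambda>b. p (z 0 b) - p (z 0 0)) has_vector_derivative Dq (z 0 0) v) (at 0 within {0..r})"
    by (rule has_vector_derivative_transform[rotated 2]) (use r eq in auto)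
  moreover have "((\<lambda>b. p (z 0 b) - p (z 0 0)) has_vector_derivative Dp (z 0 0) w - 0) (at 0 within {0..r})"
    using r by (intro has_vector_derivative_diff pb has_vector_derivative_const) auto
  ultimately have "Dp (z 0 0) w = Dq (z 0 0) v"
    using vector_derivative_unique_within_closed_interval[of 0 r 0] r by fastforce
  then show ?thesis by (simp add: Dp_def Dq_def p_def q_def z_def)
qed

text \<open>Only finitely many partial derivatives enter the operator norm of the derivative, and each is
  bounded on a compact set; convexity then permits the mean value inequality.\<close>

lemma smooth_on_bounded_Lipschitz:
  fixes f :: "'a::euclidean_space \<Rightarrow> 'b::euclidean_space"
  assumes f: "smooth_on S f" and S: "open S" and K: "compact K" "convex K" "K \<subseteq> S"
  shows "\<exists>C\<ge>0. \<forall>x\<in>K. norm (f x) \<le> C \<and> (\<forall>y\<in>K. norm (f x - f y) \<le> C * norm (x - y))"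
proof -
  have "\<exists>B\<ge>0. \<forall>x\<in>K. norm (g x) \<le> B" if "smooth_on S g" for g :: "'a \<Rightarrow> 'b"
  proof -
    have "bounded (g ` K)"
      using compact_continuous_image[OF continuous_on_subset[OF smooth_on_imp_continuous_on[OF that] K(3)] K(1)]
      by (rule compact_imp_bounded)
    then obtain B where "\<forall>x\<in>K. norm (g x) \<le> B" unfolding bounded_iff by auto
    then show ?thesis by (intro exI[of _ "max B 0"]) (auto simp: le_max_iff_disj)
  qed note bd = this
  obtain B0 where B0: "B0 \<ge> 0" "\<And>x. x \<in> K \<Longrightarrow> norm (f x) \<le> B0" using bd[OF f] by blast
  have "\<forall>b. \<exists>B\<ge>0. \<forall>x\<in>K. norm (frechet_derivative f (at x) b) \<le> B"
    using bd[OF smooth_on_derivative_open[OF f S]] by blast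
  then obtain B where B: "\<And>b. B b \<ge> 0" "\<And>b x. x \<in> K \<Longrightarrow> norm (frechet_derivative f (at x) b) \<le> B b"
    by metis
  define L where "L = (\<Sum>b\<in>Basis. B b)"
  have L0: "L \<ge> 0" unfolding L_def by (rule sum_nonneg) (use B in auto)
  have d: "(f has_derivative frechet_derivative f (at x)) (at x)" if "x \<in> K" for x
    using smooth_on_has_derivative_open[OF f S] that K by auto
  have "norm (frechet_derivative f (at x) v) \<le> L * norm v" if x: "x \<in> K" for x v
    unfolding L_def by (rule norm_linear_le_Basis[OF has_derivative_linear[OF d[OF x]] B(2)[OF x]])
  then have on: "onorm (frechet_derivative f (at x)) \<le> L" if "x \<in> K" for x
    using that by (intro onorm_le) auto
  have "norm (f x - f y) \<le> L * norm (x - y)" if "x \<in> K" "y \<in> K" for x y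
    by (rule differentiable_bound[OF K(2) has_derivative_at_withinI[OF d] on]) (use that in auto)
  then show ?thesis
    using B0 L0 by (intro exI[of _ "max B0 L"])
      (auto simp: le_max_iff_disj intro!: order_trans[OF _ mult_right_mono[of L "max B0 L"]])
qed

text \<open>Coordinate expressions of geometric objects are families of linear or bilinear maps depending on the
  base point, smooth for fixed arguments. The constants below are uniform in the arguments because
  linearity reduces them to the finitely many basis vectors.\<close>

lemma smooth_linear_family_Lipschitz:
  fixes f :: "'a::euclidean_space \<Rightarrow> 'c::euclidean_space \<Rightarrow> 'b::euclidean_space"
  assumes f: "\<And>v. smooth_on S (\<lambda>x. f x v)" and lin: "\<And>x. x \<in> K \<Longrightarrow> linear (f x)"
    and S: "open S" and K: "compact K" "convex K" "K \<subseteq> S"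
  shows "\<exists>C\<ge>0. \<forall>x\<in>K. \<forall>v. norm (f x v) \<le> C * norm v \<and>
    (\<forall>y\<in>K. norm (f x v - f y v) \<le> C * norm (x - y) * norm v)"
proof -
  have "\<forall>b. \<exists>C\<ge>0. \<forall>x\<in>K. norm (f x b) \<le> C \<and> (\<forall>y\<in>K. norm (f x b - f y b) \<le> C * norm (x - y))"
    using smooth_on_bounded_Lipschitz[OF f S K] by blast
  then obtain B where B: "\<And>b. B b \<ge> 0" "\<And>b x. x \<in> K \<Longrightarrow> norm (f x b) \<le> B b"
    "\<And>b x y. x \<in> K \<Longrightarrow> y \<in> K \<Longrightarrow> norm (f x b - f y b) \<le> B b * norm (x - y)"
    by metis
  define L where "L = (\<Sum>b\<in>Basis. B b)"
  have L0: "L \<ge> 0" unfolding L_def by (rule sum_nonneg) (use B in auto)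
  have "norm (f x v) \<le> L * norm v" if "x \<in> K" for x v
    unfolding L_def by (rule norm_linear_le_Basis[OF lin[OF that] B(2)[OF that]])
  moreover have "norm (f x v - f y v) \<le> L * norm (x - y) * norm v" if "x \<in> K" "y \<in> K" for x y v
    using norm_linear_le_Basis[of "\<lambda>v. f x v - f y v" "\<lambda>b. B b * norm (x - y)" v] lin B that
    by (auto intro!: linear_compose_sub simp: L_def sum_distrib_right)
  ultimately show ?thesis using L0 by blast
qed

lemma smooth_bilinear_family_Lipschitz:
  fixes f :: "'a::euclidean_space \<Rightarrow> 'c::euclidean_space \<Rightarrow> 'd::euclidean_space \<Rightarrow> 'b::euclidean_space"
  assumes f: "\<And>v w. smooth_on S (\<lambda>x. f x v w)" and bil: "\<And>x. x \<in> K \<Longrightarrow> bilinear (f x)"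
    and S: "open S" and K: "compact K" "convex K" "K \<subseteq> S"
  shows "\<exists>C\<ge>0. \<forall>x\<in>K. \<forall>v w. norm (f x v w) \<le> C * norm v * norm w \<and>
    (\<forall>y\<in>K. norm (f x v w - f y v w) \<le> C * norm (x - y) * norm v * norm w)"
proof -
  have "\<exists>C\<ge>0. \<forall>x\<in>K. \<forall>v. norm (f x v w) \<le> C * norm v \<and>
      (\<forall>y\<in>K. norm (f x v w - f y v w) \<le> C * norm (x - y) * norm v)" for w
    by (rule smooth_linear_family_Lipschitz[OF f _ S K]) (use bil in \<open>auto simp: bilinear_def\<close>)
  then obtain B where B: "\<And>b. B b \<ge> 0" "\<And>b x v. x \<in> K \<Longrightarrow> norm (f x v b) \<le> B b * norm v"
    "\<And>b x y v. x \<in> K \<Longrightarrow> y \<in> K \<Longrightarrow> norm (f x v b - f y v b) \<le> B b * norm (x - y) * norm v"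
    by metis
  define L where "L = (\<Sum>b\<in>Basis. B b)"
  have L0: "L \<ge> 0" unfolding L_def by (rule sum_nonneg) (use B in auto)
  have "norm (f x v w) \<le> L * norm v * norm w" if "x \<in> K" for x v w
    using norm_linear_le_Basis[of "f x v" "\<lambda>b. B b * norm v" w] bil B that
    by (auto simp: L_def sum_distrib_right bilinear_def)
  moreover have "norm (f x v w - f y v w) \<le> L * norm (x - y) * norm v * norm w"
    if "x \<in> K" "y \<in> K" for x y v w
    using norm_linear_le_Basis[of "\<lambda>w. f x v w - f y v w" "\<lambda>b. B b * norm (x - y) * norm v" w] bil B that
    by (auto intro!: linear_compose_sub simp: L_def sum_distrib_right bilinear_def)
  ultimately show ?thesis using L0 by blast
qed

section \<open>Forward and backward uniqueness for parabolic inequalities\<close>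

text \<open>\<open>a s * exp (- K * s)\<close> is nonincreasing.\<close>

lemma gronwall_forward:
  fixes a :: "real \<Rightarrow> real"
  assumes "continuous_on {\<alpha>..\<beta>} a" "\<And>s. s \<in> {\<alpha><..<\<beta>} \<Longrightarrow> (a has_real_derivative a' s) (at s)"
    "\<And>s. s \<in> {\<alpha><..<\<beta>} \<Longrightarrow> a' s \<le> K * a s" "s \<in> {\<alpha>..\<beta>}"
  shows "a s \<le> a \<alpha> * exp (K * (s - \<alpha>))"
proof -
  have "a s * exp (- K * s) \<le> a \<alpha> * exp (- K * \<alpha>)"
  proof (rule DERIV_nonpos_imp_decreasing_open[where f="\<lambda>s. a s * exp (- K * s)"])
    show "continuous_on {\<alpha>..s} (\<lambda>s. a s * exp (- K * s))"
      using assms(4) by (intro continuous_intros continuous_on_subset[OF assms(1)]) auto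
    fix x assume x: "\<alpha> < x" "x < s"
    then have "((\<lambda>s. a s * exp (- K * s)) has_real_derivative (a' x - K * a x) * exp (- K * x)) (at x)"
      using assms(4) by (auto intro!: derivative_eq_intros assms(2) simp: algebra_simps)
    moreover have "(a' x - K * a x) * exp (- K * x) \<le> 0"
      using assms(3)[of x] x assms(4) by (intro mult_nonpos_nonneg) auto
    ultimately show "\<exists>y. ((\<lambda>s. a s * exp (- K * s)) has_real_derivative y) (at x) \<and> y \<le> 0" by blast
  qed (use assms(4) in auto)
  then have "a s * exp (- K * s) * exp (K * s) \<le> a \<alpha> * exp (- K * \<alpha>) * exp (K * s)"
    by (rule mult_right_mono) auto
  then show ?thesis by (simp add: exp_minus right_diff_distrib exp_diff field_simps)
qed

text \<open>The method of Agmon and Nirenberg. As long as \<open>a\<close> is positive, the quotient \<open>1 + b / a\<close> grows at most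
  exponentially in \<open>s\<close>, hence stays bounded on a compact interval. The lower bound on \<open>a'\<close> then says
  that the logarithm of \<open>a\<close> decreases at most at a linear rate, so \<open>a\<close> cannot reach zero at a finite
  time unless it vanishes before. In the application \<open>a\<close> is the squared \<open>L\<^sup>2\<close> norm of a solution, \<open>b\<close>
  that of its spatial derivative, and \<open>b / a\<close> is the Dirichlet quotient.\<close>

lemma log_convexity_backward:
  fixes a b :: "real \<Rightarrow> real"
  assumes ca: "continuous_on {\<alpha>..\<beta>} a" and pos: "\<And>s. s \<in> {\<alpha>..\<beta>} \<Longrightarrow> a s \<ge> 0"
    and b: "\<And>s. s \<in> {\<alpha><..<\<beta>} \<Longrightarrow> b s \<ge> 0"
    and da: "\<And>s. s \<in> {\<alpha><..<\<beta>} \<Longrightarrow> (a has_real_derivative a' s) (at s)"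
    and db: "\<And>s. s \<in> {\<alpha><..<\<beta>} \<Longrightarrow> (b has_real_derivative b' s) (at s)"
    and a': "\<And>s. s \<in> {\<alpha><..<\<beta>} \<Longrightarrow> a' s \<ge> - K * (a s + b s)"
    and ab: "\<And>s. s \<in> {\<alpha><..<\<beta>} \<Longrightarrow> a s > 0 \<Longrightarrow> b' s * a s - b s * a' s \<le> K * (a s + b s) * a s"
    and K: "K \<ge> 0" and z: "a \<beta> = 0" and s: "s \<in> {\<alpha>..\<beta>}" and "\<alpha> < \<beta>"
  shows "a s = 0"
proof -
  have interior: "a s0 = 0" if s0: "s0 \<in> {\<alpha><..<\<beta>}" for s0
  proof (rule ccontr)
    assume "a s0 \<noteq> 0"
    then have as0: "a s0 > 0" using pos[of s0] s0 by auto
    define Z where "Z = {s \<in> {s0..\<beta>}. a s = 0}"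
    have "closed Z"
      unfolding Z_def using continuous_closed_preimage_constant[OF continuous_on_subset[OF ca, of "{s0..\<beta>}"]] s0 by auto
    moreover have "Z \<noteq> {}" "bdd_below Z" using z s0 by (auto simp: Z_def)
    ultimately have s1: "Inf Z \<in> Z" by (intro closed_contains_Inf)
    \<comment> \<open>the first zero after \<open>s0\<close>; up to it the quotient is defined\<close>
    define s1 where "s1 = Inf Z"
    have s1Z: "a s1 = 0" "s0 \<le> s1" "s1 \<le> \<beta>" using s1 by (auto simp: Z_def s1_def)
    have lt: "s0 < s1" using s1Z as0 by (cases "s0 = s1") auto
    have ap: "a s > 0" if "s0 \<le> s" "s < s1" for s
    proof -
      have "s \<notin> Z" using that cInf_lower[OF _ \<open>bdd_below Z\<close>, of s] by (auto simp: s1_def)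
      then show ?thesis using that pos[of s] s0 s1Z by (auto simp: Z_def)
    qed
    define L where "L = (\<lambda>s. 1 + b s / a s)"
    define L' where "L' = (\<lambda>s. (b' s * a s - b s * a' s) / (a s * a s))"
    have inI: "s \<in> {\<alpha><..<\<beta>}" if "s0 \<le> s" "s < s1" for s using that s0 s1Z by auto
    have dL: "(L has_real_derivative L' s) (at s)" if "s0 \<le> s" "s < s1" for s
    proof -
      have "(L has_real_derivative 0 + (b' s * a s - b s * a' s) / (a s * a s)) (at s)"
        unfolding L_def
        using ap[OF that] by (intro DERIV_add[OF DERIV_const] DERIV_divide[OF db[OF inI[OF that]] da[OF inI[OF that]]]) simp
      then show ?thesis by (simp add: L'_def)
    qed
    have L'K: "L' s \<le> K * L s" if "s0 \<le> s" "s < s1" for s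
    proof -
      have "L' s \<le> (K * (a s + b s) * a s) / (a s * a s)"
        unfolding L'_def using ab[OF inI[OF that] ap[OF that]] ap[OF that] by (intro divide_right_mono) auto
      also have "\<dots> = K * L s" using ap[OF that] by (simp add: L_def field_simps)
      finally show ?thesis .
    qed
    define M where "M = L s0 * exp (K * (s1 - s0))"
    have L1: "L s \<ge> 1" if "s0 \<le> s" "s < s1" for s
      using ap[OF that] b[OF inI[OF that]] by (simp add: L_def)
    have LM: "L s \<le> M" if "s0 \<le> s" "s < s1" for s
    proof -
      have "continuous_on {s0..s} L"
        by (rule DERIV_continuous_on[OF has_field_derivative_at_within[OF dL]]) (use that in auto)
      then have "L s \<le> L s0 * exp (K * (s - s0))"
        by (rule gronwall_forward[where \<beta>=s and a'=L']) (use that dL L'K in auto)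
      also have "\<dots> \<le> M"
        unfolding M_def using L1[of s0] lt K that by (intro mult_left_mono) (auto intro!: mult_left_mono)
      finally show ?thesis .
    qed
    have "- a s1 \<le> - a s0 * exp (- K * M * (s1 - s0))"
    proof (rule gronwall_forward[where \<beta>=s1 and a'="\<lambda>s. - a' s"])
      show "continuous_on {s0..s1} (\<lambda>s. - a s)"
        by (intro continuous_intros continuous_on_subset[OF ca]) (use s0 s1Z in auto)
      fix s assume s: "s \<in> {s0<..<s1}"
      then show "((\<lambda>s. - a s) has_real_derivative - a' s) (at s)"
        by (intro derivative_intros da inI) auto
      have "K * (a s + b s) = K * a s * L s" using ap[of s] s by (simp add: L_def field_simps)
      also have "\<dots> \<le> K * a s * M" using s ap[of s] K by (intro mult_left_mono LM) auto
      finally show "- a' s \<le> - K * M * - a s" using a'[OF inI[of s]] s by (simp add: algebra_simps)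
    qed (use lt in auto)
    then have "0 \<le> - (a s0 * exp (- K * M * (s1 - s0)))" using s1Z by simp
    moreover have "a s0 * exp (- K * M * (s1 - s0)) > 0" using as0 by simp
    ultimately show False by linarith
  qed
  have "a s = 0" if "s \<in> closure {\<alpha><..<\<beta>}"
    by (rule continuous_constant_on_closure[OF _ interior that]) (use ca \<open>\<alpha> < \<beta>\<close> in auto)
  then show ?thesis using s \<open>\<alpha> < \<beta>\<close> by simp
qed

text \<open>The variance of \<open>f\<close> is nonnegative.\<close>

lemma square_integral_le_integral_square:
  fixes f :: "real \<Rightarrow> real"
  assumes "continuous_on {0..1} f"
  shows "(integral {0..1} f)\<^sup>2 \<le> integral {0..1} (\<lambda>t. (f t)\<^sup>2)"
proof -
  define m where "m = integral {0..1} f"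
  have i: "f integrable_on {0..1}" "(\<lambda>t. (f t)\<^sup>2) integrable_on {0..1}"
    using assms by (auto intro!: integrable_continuous_real continuous_intros)
  have "0 \<le> integral {0..1} (\<lambda>t. (f t - m)\<^sup>2)" by (rule integral_nonneg) (use assms in \<open>auto intro!: integrable_continuous_real continuous_intros\<close>)
  also have "\<dots> = integral {0..1} (\<lambda>t. (f t)\<^sup>2 - 2 * m * f t + m\<^sup>2)"
    by (simp add: power2_eq_square algebra_simps)
  also have "\<dots> = integral {0..1} (\<lambda>t. (f t)\<^sup>2) - 2 * m * integral {0..1} f + m\<^sup>2"
  proof -
    have j: "(\<lambda>t. 2 * m * f t) integrable_on {0..1}" using i by (intro integrable_on_mult_right)
    have "integral {0..1} (\<lambda>t. (f t)\<^sup>2 - 2 * m * f t + m\<^sup>2) = integral {0..1} (\<lambda>t. (f t)\<^sup>2 - 2 * m * f t) + integral {0..1} (\<lambda>t::real. m\<^sup>2)"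
      by (intro Henstock_Kurzweil_Integration.integral_add integrable_diff i j) auto
    also have "\<dots> = (integral {0..1} (\<lambda>t. (f t)\<^sup>2) - integral {0..1} (\<lambda>t. 2 * m * f t)) + m\<^sup>2"
      by (simp add: Henstock_Kurzweil_Integration.integral_diff i j)
    finally show ?thesis by simp
  qed
  finally show ?thesis by (simp add: m_def power2_eq_square)
qed

text \<open>A finite family of periodic functions that solve one-dimensional heat equations up to an error
  bounded by the functions, their spatial derivatives and their spatial \<open>L\<^sup>1\<close> norms. The last sum is
  what a nonlocal term contributes. Derivatives are only demanded on the open strip, together with
  continuity of \<open>w\<close> up to its two ends, where the uniqueness statements start from.\<close>

locale parabolic_family =
  fixes J :: "'j set" and \<alpha> \<beta> C :: real
    and w ws wt wtt wts :: "'j \<Rightarrow> real \<Rightarrow> real \<Rightarrow> real"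
  assumes fin: "finite J" and \<alpha>\<beta>: "\<alpha> < \<beta>" and C: "C \<ge> 0"
    and cont_w: "\<And>j. j \<in> J \<Longrightarrow> continuous_on ({\<alpha>..\<beta>} \<times> UNIV) (\<lambda>(s, t). w j s t)"
    and cont_derivs:
      "\<And>j. j \<in> J \<Longrightarrow> continuous_on ({\<alpha><..<\<beta>} \<times> UNIV) (\<lambda>(s, t). ws j s t)"
      "\<And>j. j \<in> J \<Longrightarrow> continuous_on ({\<alpha><..<\<beta>} \<times> UNIV) (\<lambda>(s, t). wt j s t)"
      "\<And>j. j \<in> J \<Longrightarrow> continuous_on ({\<alpha><..<\<beta>} \<times> UNIV) (\<lambda>(s, t). wtt j s t)"
      "\<And>j. j \<in> J \<Longrightarrow> continuous_on ({\<alpha><..<\<beta>} \<times> UNIV) (\<lambda>(s, t). wts j s t)"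
    and deriv_w_s: "\<And>j s t. j \<in> J \<Longrightarrow> s \<in> {\<alpha><..<\<beta>} \<Longrightarrow> ((\<lambda>s. w j s t) has_real_derivative ws j s t) (at s)"
    and deriv_w_t: "\<And>j s t. j \<in> J \<Longrightarrow> s \<in> {\<alpha><..<\<beta>} \<Longrightarrow> ((\<lambda>t. w j s t) has_real_derivative wt j s t) (at t)"
    and deriv_wt_t: "\<And>j s t. j \<in> J \<Longrightarrow> s \<in> {\<alpha><..<\<beta>} \<Longrightarrow> ((\<lambda>t. wt j s t) has_real_derivative wtt j s t) (at t)"
    and deriv_wt_s: "\<And>j s t. j \<in> J \<Longrightarrow> s \<in> {\<alpha><..<\<beta>} \<Longrightarrow> ((\<lambda>s. wt j s t) has_real_derivative wts j s t) (at s)"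
    and deriv_ws_t: "\<And>j s t. j \<in> J \<Longrightarrow> s \<in> {\<alpha><..<\<beta>} \<Longrightarrow> ((\<lambda>t. ws j s t) has_real_derivative wts j s t) (at t)"
    and periodic: "\<And>j s t. j \<in> J \<Longrightarrow> s \<in> {\<alpha><..<\<beta>} \<Longrightarrow> w j s (t + 1) = w j s t"
    and ineq: "\<And>j s t. j \<in> J \<Longrightarrow> s \<in> {\<alpha><..<\<beta>} \<Longrightarrow> t \<in> {0..1} \<Longrightarrow>
      \<bar>ws j s t - wtt j s t\<bar> \<le> C * ((\<Sum>k\<in>J. \<bar>w k s t\<bar>) + (\<Sum>k\<in>J. \<bar>wt k s t\<bar>)
         + (\<Sum>k\<in>J. integral {0..1} (\<lambda>\<tau>. \<bar>w k s \<tau>\<bar>)))"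
begin

lemma cont_slice:
  assumes "j \<in> J" "s \<in> {\<alpha><..<\<beta>}"
  shows "continuous_on T (w j s)" "continuous_on T (ws j s)" "continuous_on T (wt j s)"
    "continuous_on T (wtt j s)" "continuous_on T (wts j s)"
proof -
  have *: "continuous_on T (f s)" if "continuous_on ({\<alpha><..<\<beta>} \<times> UNIV) (\<lambda>(s, t). f s t)"
    for f :: "real \<Rightarrow> real \<Rightarrow> real"
    by (rule continuous_on_compose2[OF that continuous_on_Pair[OF continuous_on_const[of T s] continuous_on_id], simplified])
      (use assms in auto)
  show "continuous_on T (w j s)"
    using assms by (intro *) (auto intro: continuous_on_subset[OF cont_w])
  show "continuous_on T (ws j s)" "continuous_on T (wt j s)" "continuous_on T (wtt j s)" "continuous_on T (wts j s)"
    by (rule *[OF cont_derivs(1)[OF assms(1)]] *[OF cont_derivs(2)[OF assms(1)]]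
        *[OF cont_derivs(3)[OF assms(1)]] *[OF cont_derivs(4)[OF assms(1)]])+
qed

lemma cont_strip: "j \<in> J \<Longrightarrow> continuous_on ({\<alpha><..<\<beta>} \<times> UNIV) (\<lambda>(s, t). w j s t)"
  by (rule continuous_on_subset[OF cont_w]) auto

definition energy :: "real \<Rightarrow> real" where
  "energy s = (\<Sum>j\<in>J. integral {0..1} (\<lambda>t. (w j s t)\<^sup>2))"

definition dirichlet :: "real \<Rightarrow> real" where
  "dirichlet s = (\<Sum>j\<in>J. integral {0..1} (\<lambda>t. (wt j s t)\<^sup>2))"

definition forcing :: "real \<Rightarrow> real" where
  "forcing s = (\<Sum>j\<in>J. integral {0..1} (\<lambda>t. (ws j s t - wtt j s t)\<^sup>2))"

lemma integrableI:
  fixes f :: "real \<Rightarrow> real"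
  assumes "continuous_on {0..1} f" shows "f integrable_on {0..1}"
  using assms by (rule integrable_continuous_real)

lemma energy_nonneg: "0 \<le> energy s"
  unfolding energy_def
  by (intro sum_nonneg) (metis integral_nonneg not_integrable_integral order_refl zero_le_power2)

lemma dirichlet_nonneg: "0 \<le> dirichlet s"
  unfolding dirichlet_def
  by (intro sum_nonneg) (metis integral_nonneg not_integrable_integral order_refl zero_le_power2)

lemma energy_continuous: "continuous_on {\<alpha>..\<beta>} energy"
proof -
  have "continuous_on ({\<alpha>..\<beta>} \<times> cbox 0 1) (\<lambda>(s, t). (w j s t)\<^sup>2)" if "j \<in> J" for j
    using continuous_on_power[OF continuous_on_subset[OF cont_w[OF that] Sigma_mono[OF order_refl subset_UNIV]], of "\<lambda>_. cbox 0 1" 2]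
    by (simp add: case_prod_beta)
  from integral_continuous_on_param[OF this] show ?thesis
    unfolding energy_def[abs_def] by (intro continuous_on_sum) simp
qed

lemma Leibniz_square:
  fixes f f' :: "real \<Rightarrow> real \<Rightarrow> real"
  assumes "continuous_on ({\<alpha><..<\<beta>} \<times> UNIV) (\<lambda>(s, t). f s t)" "continuous_on ({\<alpha><..<\<beta>} \<times> UNIV) (\<lambda>(s, t). f' s t)"
    and "\<And>s t. s \<in> {\<alpha><..<\<beta>} \<Longrightarrow> ((\<lambda>s. f s t) has_real_derivative f' s t) (at s)" and s: "s \<in> {\<alpha><..<\<beta>}"
  shows "((\<lambda>s. integral {0..1} (\<lambda>t. (f s t)\<^sup>2)) has_real_derivative integral {0..1} (\<lambda>t. 2 * f s t * f' s t)) (at s)"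
proof -
  have cf: "continuous_on T (f s)" if "s \<in> {\<alpha><..<\<beta>}" for s T
    by (rule continuous_on_compose2[OF assms(1) continuous_on_Pair[OF continuous_on_const[of T s] continuous_on_id], simplified])
      (use that in auto)
  have c2: "continuous_on ({\<alpha><..<\<beta>} \<times> cbox 0 1) (\<lambda>(s, t). 2 * f s t * f' s t)"
    using continuous_on_subset[OF assms(1), of "{\<alpha><..<\<beta>} \<times> cbox 0 1"] continuous_on_subset[OF assms(2), of "{\<alpha><..<\<beta>} \<times> cbox 0 1"]
    by (auto simp: case_prod_beta intro!: continuous_intros)
  have "((\<lambda>s. integral (cbox 0 1) (\<lambda>t. (f s t)\<^sup>2)) has_real_derivative integral (cbox 0 1) (\<lambda>t. 2 * f s t * f' s t)) (at s within {\<alpha><..<\<beta>})"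
  proof (rule leibniz_rule_field_derivative[OF _ _ c2 s])
    fix x t :: real assume x: "x \<in> {\<alpha><..<\<beta>}"
    show "((\<lambda>x. (f x t)\<^sup>2) has_real_derivative 2 * f x t * f' x t) (at x within {\<alpha><..<\<beta>})"
      using has_field_derivative_at_within[OF DERIV_power[OF assms(3)[OF x, of t], of 2]] by (simp add: ac_simps)
    show "(\<lambda>t. (f x t)\<^sup>2) integrable_on cbox 0 1"
      using cf[OF x] by (auto intro!: integrableI continuous_intros)
  qed auto
  then show ?thesis using at_within_open[OF s] by simp
qed

lemma periodic_integral_by_parts:
  fixes f g f' g' :: "real \<Rightarrow> real"
  assumes "\<And>t. (f has_real_derivative f' t) (at t)" "\<And>t. (g has_real_derivative g' t) (at t)"
    and "f 1 = f 0" "g 1 = g 0" "continuous_on {0..1} f'" "continuous_on {0..1} g'"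
  shows "integral {0..1} (\<lambda>t. f t * g' t) = - integral {0..1} (\<lambda>t. f' t * g t)"
proof -
  have "((\<lambda>t. f t * g' t + f' t * g t) has_integral (f 1 * g 1 - f 0 * g 0)) {0..1}"
  proof (rule fundamental_theorem_of_calculus)
    fix t :: real
    have "((\<lambda>t. f t * g t) has_real_derivative f t * g' t + f' t * g t) (at t within {0..1})"
      using DERIV_mult[OF assms(1)[of t] assms(2)[of t]]
      by (rule has_field_derivative_at_within[OF DERIV_cong]) simp
    then show "((\<lambda>t. f t * g t) has_vector_derivative f t * g' t + f' t * g t) (at t within {0..1})"
      by (simp add: has_real_derivative_iff_has_vector_derivative)
  qed simp
  then have 0: "integral {0..1} (\<lambda>t. f t * g' t + f' t * g t) = 0"
    using assms by (simp add: integral_unique)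
  have cf: "continuous_on {0..1} f" "continuous_on {0..1} g"
    by (rule DERIV_continuous_on[OF has_field_derivative_at_within[OF assms(1)]]
        DERIV_continuous_on[OF has_field_derivative_at_within[OF assms(2)]])+
  have "integral {0..1} (\<lambda>t. f t * g' t + f' t * g t) = integral {0..1} (\<lambda>t. f t * g' t) + integral {0..1} (\<lambda>t. f' t * g t)"
    using cf assms by (intro Henstock_Kurzweil_Integration.integral_add integrableI continuous_intros)
  with 0 show ?thesis by simp
qed

lemma derivative_periodic:
  fixes f f' :: "real \<Rightarrow> real"
  assumes "\<And>t. (f has_real_derivative f' t) (at t)" "\<And>t. f (t + 1) = f t"
  shows "f' (t + 1) = f' t"
proof -
  have "((\<lambda>x. f (x + 1)) has_real_derivative f' (t + 1)) (at t)"
    using DERIV_shift[of f "f' (t+1)" t 1] assms(1)[of "t+1"] by (simp add: add.commute)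
  then show ?thesis using assms DERIV_unique[OF _ assms(1)[of t]] by simp
qed

lemma wt_periodic: "j \<in> J \<Longrightarrow> s \<in> {\<alpha><..<\<beta>} \<Longrightarrow> wt j s (t + 1) = wt j s t"
  using derivative_periodic[OF deriv_w_t periodic] .

lemma integral_w_wtt:
  assumes j: "j \<in> J" and s: "s \<in> {\<alpha><..<\<beta>}"
  shows "integral {0..1} (\<lambda>t. w j s t * wtt j s t) = - integral {0..1} (\<lambda>t. wt j s t * wt j s t)"
  by (rule periodic_integral_by_parts)
    (use periodic[OF j s, of 0] wt_periodic[OF j s, of 0] in \<open>auto intro!: cont_slice j s deriv_w_t deriv_wt_t\<close>)

lemma ws_periodic:
  assumes j: "j \<in> J" and s: "s \<in> {\<alpha><..<\<beta>}" shows "ws j s (t + 1) = ws j s t"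
proof -
  have "((\<lambda>s. w j s (t + 1)) has_real_derivative ws j s t) (at s)"
    by (rule has_field_derivative_transform_within_open[OF deriv_w_s[OF j s, of t], of "{\<alpha><..<\<beta>}"])
      (use s periodic j in auto)
  then show ?thesis using DERIV_unique[OF _ deriv_w_s[OF j s, of "t+1"]] by simp
qed

lemma energy_derivative:
  assumes s: "s \<in> {\<alpha><..<\<beta>}"
  shows "(energy has_real_derivative
    (- 2 * dirichlet s + (\<Sum>j\<in>J. integral {0..1} (\<lambda>t. 2 * w j s t * (ws j s t - wtt j s t))))) (at s)"
proof -
  have "(energy has_real_derivative (\<Sum>j\<in>J. integral {0..1} (\<lambda>t. 2 * w j s t * ws j s t))) (at s)"
    unfolding energy_def[abs_def]
    by (intro derivative_intros Leibniz_square cont_strip cont_derivs deriv_w_s s)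
  moreover have "integral {0..1} (\<lambda>t. 2 * w j s t * ws j s t) =
      - 2 * integral {0..1} (\<lambda>t. (wt j s t)\<^sup>2) + integral {0..1} (\<lambda>t. 2 * w j s t * (ws j s t - wtt j s t))"
    if j: "j \<in> J" for j
  proof -
    have "integral {0..1} (\<lambda>t. 2 * w j s t * ws j s t) =
        integral {0..1} (\<lambda>t. 2 * (w j s t * wtt j s t) + 2 * w j s t * (ws j s t - wtt j s t))"
      by (simp add: algebra_simps)
    also have "\<dots> = integral {0..1} (\<lambda>t. 2 * (w j s t * wtt j s t)) + integral {0..1} (\<lambda>t. 2 * w j s t * (ws j s t - wtt j s t))"
      by (intro Henstock_Kurzweil_Integration.integral_add integrableI continuous_intros cont_slice j s)
    also have "integral {0..1} (\<lambda>t. 2 * (w j s t * wtt j s t)) = 2 * integral {0..1} (\<lambda>t. w j s t * wtt j s t)"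
      by simp
    also have "integral {0..1} (\<lambda>t. w j s t * wtt j s t) = - integral {0..1} (\<lambda>t. wt j s t * wt j s t)"
      by (rule integral_w_wtt[OF j s])
    finally show ?thesis by (simp add: power2_eq_square)
  qed
  ultimately show ?thesis by (simp add: dirichlet_def sum.distrib sum_distrib_left sum_subtractf sum_negf)
qed

lemma dirichlet_derivative:
  assumes s: "s \<in> {\<alpha><..<\<beta>}"
  shows "(dirichlet has_real_derivative (- 2 * (\<Sum>j\<in>J. integral {0..1} (\<lambda>t. wtt j s t * ws j s t)))) (at s)"
proof -
  have "(dirichlet has_real_derivative (\<Sum>j\<in>J. integral {0..1} (\<lambda>t. 2 * wt j s t * wts j s t))) (at s)"
    unfolding dirichlet_def[abs_def]
    by (intro derivative_intros Leibniz_square cont_derivs deriv_wt_s s)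
  moreover have "integral {0..1} (\<lambda>t. 2 * wt j s t * wts j s t) = - 2 * integral {0..1} (\<lambda>t. wtt j s t * ws j s t)"
    if j: "j \<in> J" for j
  proof -
    have "integral {0..1} (\<lambda>t. wt j s t * wts j s t) = - integral {0..1} (\<lambda>t. wtt j s t * ws j s t)"
      by (rule periodic_integral_by_parts)
        (use ws_periodic[OF j s, of 0] wt_periodic[OF j s, of 0] in \<open>auto intro!: cont_slice j s deriv_ws_t deriv_wt_t\<close>)
    then show ?thesis by (simp add: mult.assoc)
  qed
  ultimately show ?thesis by (simp add: sum_distrib_left)
qed

definition forcing_const :: real where
  "forcing_const = 6 * C\<^sup>2 * (real (card J))\<^sup>2"

lemma forcing_const_nonneg: "forcing_const \<ge> 0" by (simp add: forcing_const_def)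

text \<open>The error is square integrable with a bound linear in energy and Dirichlet integral. The number 6
  comes from \<open>(x + y + z)\<^sup>2 \<le> 3 (x\<^sup>2 + y\<^sup>2 + z\<^sup>2)\<close> and from the energy being counted twice, once for the
  functions and once for their \<open>L\<^sup>1\<close> norms; each factor \<open>card J\<close> from Cauchy's inequality or from the sum
  over the components.\<close>

lemma forcing_le:
  assumes s: "s \<in> {\<alpha><..<\<beta>}"
  shows "forcing s \<le> forcing_const * (energy s + dirichlet s)"
proof -
  let ?n = "real (card J)"
  have one: "integral {0..1} (\<lambda>t. (ws j s t - wtt j s t)\<^sup>2) \<le> 6 * C\<^sup>2 * ?n * (energy s + dirichlet s)" if j: "j \<in> J" for j
  proof -
    define m where "m = (\<lambda>k. integral {0..1} (\<lambda>\<tau>. \<bar>w k s \<tau>\<bar>))"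
    have m2: "(m k)\<^sup>2 \<le> integral {0..1} (\<lambda>t. (w k s t)\<^sup>2)" if "k \<in> J" for k
      using square_integral_le_integral_square[of "\<lambda>\<tau>. \<bar>w k s \<tau>\<bar>"] cont_slice(1)[OF that s]
      by (auto simp: m_def intro!: continuous_intros)
    have pt: "(ws j s t - wtt j s t)\<^sup>2 \<le>
        3 * C\<^sup>2 * ?n * (\<Sum>k\<in>J. (w k s t)\<^sup>2 + (wt k s t)\<^sup>2 + (m k)\<^sup>2)" if t: "t \<in> {0..1}" for t
    proof -
      define X Y Z where "X = (\<Sum>k\<in>J. \<bar>w k s t\<bar>)" and "Y = (\<Sum>k\<in>J. \<bar>wt k s t\<bar>)" and "Z = (\<Sum>k\<in>J. m k)"
      have "\<bar>ws j s t - wtt j s t\<bar> \<le> \<bar>C * (X + Y + Z)\<bar>"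
        using ineq[OF j s t] by (simp add: X_def Y_def Z_def m_def)
      then have "(ws j s t - wtt j s t)\<^sup>2 \<le> (C * (X + Y + Z))\<^sup>2" by (simp add: abs_le_square_iff)
      also have "\<dots> = C\<^sup>2 * (X + Y + Z)\<^sup>2" by (simp add: power_mult_distrib)
      also have "\<dots> \<le> C\<^sup>2 * (3 * (?n * (\<Sum>k\<in>J. (w k s t)\<^sup>2) + ?n * (\<Sum>k\<in>J. (wt k s t)\<^sup>2) + ?n * (\<Sum>k\<in>J. (m k)\<^sup>2)))"
      proof (rule mult_left_mono)
        have sq: "(X + Y + Z)\<^sup>2 \<le> 3 * (X\<^sup>2 + Y\<^sup>2 + Z\<^sup>2)"
          using sum_squares_ge_zero[of "X - Y" "Y - Z"] sum_squares_ge_zero[of "X - Z" 0]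
          by (simp add: power2_eq_square algebra_simps)
        have "X\<^sup>2 \<le> ?n * (\<Sum>k\<in>J. (w k s t)\<^sup>2)"
          unfolding X_def using sum_squared_le_sum_of_squares[of "\<lambda>k. \<bar>w k s t\<bar>" J] fin by (simp add: mult.commute)
        moreover have "Y\<^sup>2 \<le> ?n * (\<Sum>k\<in>J. (wt k s t)\<^sup>2)"
          unfolding Y_def using sum_squared_le_sum_of_squares[of "\<lambda>k. \<bar>wt k s t\<bar>" J] fin by (simp add: mult.commute)
        moreover have "Z\<^sup>2 \<le> ?n * (\<Sum>k\<in>J. (m k)\<^sup>2)"
          unfolding Z_def using sum_squared_le_sum_of_squares[of m J] fin by (simp add: mult.commute)
        ultimately have "3 * (X\<^sup>2 + Y\<^sup>2 + Z\<^sup>2) \<le> 3 * (?n * (\<Sum>k\<in>J. (w k s t)\<^sup>2) + ?n * (\<Sum>k\<in>J. (wt k s t)\<^sup>2) + ?n * (\<Sum>k\<in>J. (m k)\<^sup>2))"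
          by (intro mult_left_mono add_mono) auto
        with sq show "(X + Y + Z)\<^sup>2 \<le> 3 * (?n * (\<Sum>k\<in>J. (w k s t)\<^sup>2) + ?n * (\<Sum>k\<in>J. (wt k s t)\<^sup>2) + ?n * (\<Sum>k\<in>J. (m k)\<^sup>2))"
          by (rule order_trans)
      qed simp
      finally show ?thesis by (simp add: sum.distrib algebra_simps)
    qed
    have ci: "continuous_on {0..1} (\<lambda>t. (w k s t)\<^sup>2)" "continuous_on {0..1} (\<lambda>t. (wt k s t)\<^sup>2)" if "k \<in> J" for k
      by (intro continuous_intros cont_slice that s)+
    have "integral {0..1} (\<lambda>t. (ws j s t - wtt j s t)\<^sup>2) \<le>
        integral {0..1} (\<lambda>t. 3 * C\<^sup>2 * ?n * (\<Sum>k\<in>J. (w k s t)\<^sup>2 + (wt k s t)\<^sup>2 + (m k)\<^sup>2))"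
      by (intro integral_le integrableI pt continuous_intros cont_slice j s ci)
    also have "\<dots> = 3 * C\<^sup>2 * ?n * (\<Sum>k\<in>J. integral {0..1} (\<lambda>t. (w k s t)\<^sup>2) + integral {0..1} (\<lambda>t. (wt k s t)\<^sup>2) + (m k)\<^sup>2)"
    proof -
      have "integral {0..1} (\<lambda>t. \<Sum>k\<in>J. (w k s t)\<^sup>2 + (wt k s t)\<^sup>2 + (m k)\<^sup>2) =
          (\<Sum>k\<in>J. integral {0..1} (\<lambda>t. (w k s t)\<^sup>2 + (wt k s t)\<^sup>2 + (m k)\<^sup>2))"
        by (intro Henstock_Kurzweil_Integration.integral_sum fin integrableI continuous_intros ci)
      also have "\<dots> = (\<Sum>k\<in>J. integral {0..1} (\<lambda>t. (w k s t)\<^sup>2) + integral {0..1} (\<lambda>t. (wt k s t)\<^sup>2) + (m k)\<^sup>2)"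
        by (intro sum.cong refl)
          (simp add: Henstock_Kurzweil_Integration.integral_add integrableI ci integrable_add)
      finally show ?thesis by simp
    qed
    also have "\<dots> \<le> 3 * C\<^sup>2 * ?n * (energy s + dirichlet s + energy s)"
      unfolding sum.distrib energy_def dirichlet_def using m2
      by (intro mult_left_mono add_mono sum_mono order_refl) auto
    also have "\<dots> \<le> 3 * C\<^sup>2 * ?n * (2 * (energy s + dirichlet s))"
      using dirichlet_nonneg[of s] by (intro mult_left_mono) auto
    finally show ?thesis by (simp add: algebra_simps)
  qed
  have "forcing s \<le> (\<Sum>j\<in>J. 6 * C\<^sup>2 * ?n * (energy s + dirichlet s))"
    unfolding forcing_def by (rule sum_mono) (rule one)
  then show ?thesis by (simp add: forcing_const_def power2_eq_square algebra_simps)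
qed

text \<open>Young's inequality with a free weight \<open>k\<close>: a large weight absorbs the Dirichlet part of the forcing
  in the forward estimate.\<close>

lemma work_le:
  assumes s: "s \<in> {\<alpha><..<\<beta>}" and "k > 0"
  shows "\<bar>\<Sum>j\<in>J. integral {0..1} (\<lambda>t. 2 * w j s t * (ws j s t - wtt j s t))\<bar> \<le> k * energy s + forcing s / k"
proof -
  have "\<bar>integral {0..1} (\<lambda>t. 2 * w j s t * (ws j s t - wtt j s t))\<bar> \<le>
      k * integral {0..1} (\<lambda>t. (w j s t)\<^sup>2) + integral {0..1} (\<lambda>t. (ws j s t - wtt j s t)\<^sup>2) / k" if j: "j \<in> J" for j
  proof -
    have "\<bar>integral {0..1} (\<lambda>t. 2 * w j s t * (ws j s t - wtt j s t))\<bar> \<le>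
        integral {0..1} (\<lambda>t. k * (w j s t)\<^sup>2 + (ws j s t - wtt j s t)\<^sup>2 / k)"
    proof (rule Henstock_Kurzweil_Integration.integral_norm_bound_integral[where 'n=real and 'a=real, unfolded real_norm_def])
      fix t :: real
      have "0 \<le> (k * \<bar>w j s t\<bar> - \<bar>ws j s t - wtt j s t\<bar>)\<^sup>2" by simp
      then have "2 * \<bar>w j s t\<bar> * \<bar>ws j s t - wtt j s t\<bar> * k \<le> k * (k * (w j s t)\<^sup>2) + (ws j s t - wtt j s t)\<^sup>2"
        by (simp add: power2_diff power_mult_distrib power2_eq_square algebra_simps)
      moreover have "\<bar>2 * w j s t * (ws j s t - wtt j s t)\<bar> = 2 * \<bar>w j s t\<bar> * \<bar>ws j s t - wtt j s t\<bar>"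
        by (simp only: abs_mult)
      ultimately show "\<bar>2 * w j s t * (ws j s t - wtt j s t)\<bar> \<le> k * (w j s t)\<^sup>2 + (ws j s t - wtt j s t)\<^sup>2 / k"
        using \<open>k > 0\<close> by (simp add: divide_simps ac_simps)
    qed (use \<open>k > 0\<close> in \<open>intro integrableI continuous_intros cont_slice j s; simp\<close>)+
    also have "\<dots> = integral {0..1} (\<lambda>t. k * (w j s t)\<^sup>2) + integral {0..1} (\<lambda>t. (ws j s t - wtt j s t)\<^sup>2 / k)"
      by (intro Henstock_Kurzweil_Integration.integral_add integrableI continuous_intros cont_slice j s) (use \<open>k > 0\<close> in auto)
    finally show ?thesis by simp
  qed
  then have "\<bar>\<Sum>j\<in>J. integral {0..1} (\<lambda>t. 2 * w j s t * (ws j s t - wtt j s t))\<bar> \<le>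
     (\<Sum>j\<in>J. k * integral {0..1} (\<lambda>t. (w j s t)\<^sup>2) + integral {0..1} (\<lambda>t. (ws j s t - wtt j s t)\<^sup>2) / k)"
    by (intro order_trans[OF sum_abs] sum_mono)
  then show ?thesis by (simp add: energy_def forcing_def sum.distrib sum_distrib_left sum_divide_distrib)
qed

text \<open>The left hand side is the derivative of the Dirichlet quotient times the squared energy. With
  \<open>l\<close> the quotient itself and \<open>f\<close> the error term, integration by parts turns
  \<open>b' - l * a'\<close> into \<open>- 2 \<parallel>x\<parallel>\<^sup>2 - 2 \<langle>x, f\<rangle>\<close> where \<open>x = wtt + l * w\<close>; this is at most \<open>\<parallel>f\<parallel>\<^sup>2\<close>, because
  \<open>\<parallel>f\<parallel>\<^sup>2 + 2 \<parallel>x\<parallel>\<^sup>2 + 2 \<langle>x, f\<rangle> = \<parallel>f + x\<parallel>\<^sup>2 + \<parallel>x\<parallel>\<^sup>2\<close>.\<close>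

lemma dirichlet_quotient:
  assumes s: "s \<in> {\<alpha><..<\<beta>}" and pos: "energy s > 0"
  shows "(- 2 * (\<Sum>j\<in>J. integral {0..1} (\<lambda>t. wtt j s t * ws j s t))) * energy s
    - dirichlet s * (- 2 * dirichlet s + (\<Sum>j\<in>J. integral {0..1} (\<lambda>t. 2 * w j s t * (ws j s t - wtt j s t))))
    \<le> forcing s * energy s"
proof -
  define l where "l = dirichlet s / energy s"
  have dl: "dirichlet s = l * energy s" using pos by (simp add: l_def)
  have each: "- 2 * integral {0..1} (\<lambda>t. wtt j s t * ws j s t) + 2 * l * integral {0..1} (\<lambda>t. (wt j s t)\<^sup>2)
      - l * integral {0..1} (\<lambda>t. 2 * w j s t * (ws j s t - wtt j s t))
      \<le> integral {0..1} (\<lambda>t. (ws j s t - wtt j s t)\<^sup>2) + 2 * l\<^sup>2 * integral {0..1} (\<lambda>t. (w j s t)\<^sup>2)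
        - 2 * l * integral {0..1} (\<lambda>t. (wt j s t)\<^sup>2)" (is "?L \<le> ?R") if j: "j \<in> J" for j
  proof -
    have ibp: "integral {0..1} (\<lambda>t. w j s t * wtt j s t) = - integral {0..1} (\<lambda>t. wt j s t * wt j s t)"
      by (rule integral_w_wtt[OF j s])
    have "0 \<le> integral {0..1} (\<lambda>t. (ws j s t - wtt j s t)\<^sup>2 + 2 * l\<^sup>2 * (w j s t)\<^sup>2 + 4 * l * (w j s t * wtt j s t)
        + 2 * (wtt j s t * ws j s t) + l * (2 * w j s t * (ws j s t - wtt j s t)))"
    proof (rule integral_nonneg)
      fix t :: real
      let ?f = "ws j s t - wtt j s t" and ?x = "wtt j s t + l * w j s t"
      have "(ws j s t - wtt j s t)\<^sup>2 + 2 * l\<^sup>2 * (w j s t)\<^sup>2 + 4 * l * (w j s t * wtt j s t)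
        + 2 * (wtt j s t * ws j s t) + l * (2 * w j s t * (ws j s t - wtt j s t)) = (?f + ?x)\<^sup>2 + ?x\<^sup>2"
        by (simp add: power2_eq_square algebra_simps)
      then show "0 \<le> (ws j s t - wtt j s t)\<^sup>2 + 2 * l\<^sup>2 * (w j s t)\<^sup>2 + 4 * l * (w j s t * wtt j s t)
        + 2 * (wtt j s t * ws j s t) + l * (2 * w j s t * (ws j s t - wtt j s t))" by simp
    qed (intro integrableI continuous_intros cont_slice j s)
    also have "\<dots> = integral {0..1} (\<lambda>t. (ws j s t - wtt j s t)\<^sup>2) + 2 * l\<^sup>2 * integral {0..1} (\<lambda>t. (w j s t)\<^sup>2)
        + 4 * l * integral {0..1} (\<lambda>t. w j s t * wtt j s t) + 2 * integral {0..1} (\<lambda>t. wtt j s t * ws j s t)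
        + l * integral {0..1} (\<lambda>t. 2 * w j s t * (ws j s t - wtt j s t))"
      by (subst Henstock_Kurzweil_Integration.integral_add, (intro integrableI continuous_intros cont_slice j s)+)+ simp
    finally show ?thesis unfolding ibp by (simp add: power2_eq_square algebra_simps)
  qed
  have "(\<Sum>j\<in>J. - 2 * integral {0..1} (\<lambda>t. wtt j s t * ws j s t) + 2 * l * integral {0..1} (\<lambda>t. (wt j s t)\<^sup>2)
      - l * integral {0..1} (\<lambda>t. 2 * w j s t * (ws j s t - wtt j s t)))
    \<le> (\<Sum>j\<in>J. integral {0..1} (\<lambda>t. (ws j s t - wtt j s t)\<^sup>2) + 2 * l\<^sup>2 * integral {0..1} (\<lambda>t. (w j s t)\<^sup>2)
        - 2 * l * integral {0..1} (\<lambda>t. (wt j s t)\<^sup>2))"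
    by (rule sum_mono) (rule each)
  then have "- 2 * (\<Sum>j\<in>J. integral {0..1} (\<lambda>t. wtt j s t * ws j s t)) + 2 * l * dirichlet s
      - l * (\<Sum>j\<in>J. integral {0..1} (\<lambda>t. 2 * w j s t * (ws j s t - wtt j s t)))
    \<le> forcing s + 2 * l\<^sup>2 * energy s - 2 * l * dirichlet s"
    by (simp add: sum.distrib sum_subtractf sum_distrib_left[symmetric] energy_def dirichlet_def forcing_def
        sum_negf)
  also have "\<dots> = forcing s" by (simp add: dl power2_eq_square)
  finally have "(- 2 * (\<Sum>j\<in>J. integral {0..1} (\<lambda>t. wtt j s t * ws j s t)) + 2 * l * dirichlet s
      - l * (\<Sum>j\<in>J. integral {0..1} (\<lambda>t. 2 * w j s t * (ws j s t - wtt j s t)))) * energy s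
    \<le> forcing s * energy s" using pos by (intro mult_right_mono) auto
  then show ?thesis by (simp add: dl algebra_simps)
qed

text \<open>The weight in Young's inequality is chosen so large that the dissipation \<open>- 2 * dirichlet\<close> absorbs
  the part of the forcing that involves derivatives.\<close>

lemma forward_uniqueness:
  assumes "energy \<alpha> = 0" "s \<in> {\<alpha>..\<beta>}" shows "energy s = 0"
proof -
  \<comment> \<open>positive even when \<open>forcing_const\<close> is zero, so that it can serve as a weight\<close>
  define k where "k = forcing_const + 1"
  have k: "k > 0" using forcing_const_nonneg by (simp add: k_def)
  have "energy s \<le> energy \<alpha> * exp ((k + 1) * (s - \<alpha>))"
  proof (rule gronwall_forward[OF energy_continuous energy_derivative _ assms(2)])
    fix s assume s: "s \<in> {\<alpha><..<\<beta>}"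
    have "forcing s \<le> k * (energy s + dirichlet s)"
      using forcing_le[OF s] energy_nonneg[of s] dirichlet_nonneg[of s] by (simp add: k_def algebra_simps)
    then have "forcing s / k \<le> energy s + dirichlet s" using k by (simp add: field_simps)
    then show "- 2 * dirichlet s + (\<Sum>j\<in>J. integral {0..1} (\<lambda>t. 2 * w j s t * (ws j s t - wtt j s t))) \<le> (k + 1) * energy s"
      using work_le[OF s k] dirichlet_nonneg[of s] by (simp add: algebra_simps)
  qed
  then show ?thesis using assms energy_nonneg[of s] by simp
qed

text \<open>Dissipation has the wrong sign backwards in time; it is controlled through the Dirichlet quotient.\<close>

lemma backward_uniqueness:
  assumes "energy \<beta> = 0" "s \<in> {\<alpha>..\<beta>}" shows "energy s = 0"
proof (rule log_convexity_backward[OF energy_continuous energy_nonneg dirichlet_nonneg energy_derivative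
      dirichlet_derivative _ _ _ assms \<alpha>\<beta>, where K="forcing_const + 2"])
  fix s assume s: "s \<in> {\<alpha><..<\<beta>}"
  show "- (forcing_const + 2) * (energy s + dirichlet s)
      \<le> - 2 * dirichlet s + (\<Sum>j\<in>J. integral {0..1} (\<lambda>t. 2 * w j s t * (ws j s t - wtt j s t)))"
    using work_le[OF s, of 1] forcing_le[OF s] energy_nonneg[of s] by (simp add: algebra_simps)
  assume pos: "0 < energy s"
  have "forcing s * energy s \<le> (forcing_const + 2) * (energy s + dirichlet s) * energy s"
    using forcing_le[OF s] energy_nonneg[of s] dirichlet_nonneg[of s]
    by (intro mult_right_mono) (auto simp: algebra_simps)
  then show "- 2 * (\<Sum>j\<in>J. integral {0..1} (\<lambda>t. wtt j s t * ws j s t)) * energy s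
      - dirichlet s * (- 2 * dirichlet s + (\<Sum>j\<in>J. integral {0..1} (\<lambda>t. 2 * w j s t * (ws j s t - wtt j s t))))
     \<le> (forcing_const + 2) * (energy s + dirichlet s) * energy s"
    using dirichlet_quotient[OF s pos] by linarith
qed (use forcing_const_nonneg in auto)

lemma zero_energy:
  assumes "energy s = 0" "s \<in> {\<alpha>..\<beta>}" "j \<in> J" "t \<in> {0..1}" shows "w j s t = 0"
proof -
  have c: "continuous_on {0..1} (w k s)" if "k \<in> J" for k
    by (rule continuous_on_compose2[OF cont_w[OF that] continuous_on_Pair[OF continuous_on_const[of "{0..1}" s] continuous_on_id], simplified])
      (use assms(2) in auto)
  have "integral {0..1} (\<lambda>t. (w j s t)\<^sup>2) = 0"
    using assms(1,3) unfolding energy_def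
    by (subst (asm) sum_nonneg_eq_0_iff[OF fin]) (auto intro!: integral_nonneg integrableI continuous_intros c)
  then have "\<forall>t\<in>{0..1}. (w j s t)\<^sup>2 = 0"
    by (subst (asm) integral_eq_0_iff) (use c[OF assms(3)] in \<open>auto intro!: continuous_intros\<close>)
  then show ?thesis using assms(4) by auto
qed

end

section \<open>Derivatives of families of multilinear maps\<close>

text \<open>The product rule for the evaluation of a point-dependent linear map, obtained by expanding the
  argument over the basis. Linearity is only available on \<open>S\<close>, so the expansion is valid near \<open>y\<close>.\<close>

lemma linear_family_has_derivative:
  fixes f :: "'a::euclidean_space \<Rightarrow> 'c::euclidean_space \<Rightarrow> 'b::euclidean_space"
    and h :: "'d::euclidean_space \<Rightarrow> 'a"
  assumes f: "\<And>v. smooth_on S (\<lambda>x. f x v)" and lin: "\<And>x. x \<in> S \<Longrightarrow> linear (f x)" and S: "open S"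
    and h: "(h has_derivative h') (at y)" "h y \<in> S" and a: "(a has_derivative a') (at y)"
  shows "((\<lambda>y. f (h y) (a y)) has_derivative
    (\<lambda>z. frechet_derivative (\<lambda>x. f x (a y)) (at (h y)) (h' z) + f (h y) (a' z))) (at y)"
proof -
  have fh: "((\<lambda>y. f (h y) v) has_derivative (\<lambda>z. frechet_derivative (\<lambda>x. f x v) (at (h y)) (h' z))) (at y)" for v
    using has_derivative_compose[OF h(1) smooth_on_has_derivative_open[OF f S h(2)]] .
  have "((\<lambda>y. \<Sum>i\<in>Basis. (a y \<bullet> i) *\<^sub>R f (h y) i) has_derivative
      (\<lambda>z. \<Sum>i\<in>Basis. (a y \<bullet> i) *\<^sub>R frechet_derivative (\<lambda>x. f x i) (at (h y)) (h' z) + (a' z \<bullet> i) *\<^sub>R f (h y) i)) (at y)"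
    by (intro has_derivative_sum has_derivative_scaleR has_derivative_inner_left a fh)
  moreover have "((\<lambda>x. \<Sum>i\<in>Basis. (a y \<bullet> i) *\<^sub>R f x i) has_derivative
      (\<lambda>z. \<Sum>i\<in>Basis. (a y \<bullet> i) *\<^sub>R frechet_derivative (\<lambda>x. f x i) (at (h y)) z)) (at (h y))"
    by (intro has_derivative_sum has_derivative_scaleR_right smooth_on_has_derivative_open[OF f S h(2)])
  then have "((\<lambda>x. f x (a y)) has_derivative
      (\<lambda>z. \<Sum>i\<in>Basis. (a y \<bullet> i) *\<^sub>R frechet_derivative (\<lambda>x. f x i) (at (h y)) z)) (at (h y))"
    by (rule has_derivative_transform_within_open[OF _ S h(2)]) (metis lin linear_Basis_expand)
  then have "frechet_derivative (\<lambda>x. f x (a y)) (at (h y)) =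
      (\<lambda>z. \<Sum>i\<in>Basis. (a y \<bullet> i) *\<^sub>R frechet_derivative (\<lambda>x. f x i) (at (h y)) z)"
    by (rule frechet_derivative_at[symmetric])
  moreover have "f (h y) (a' z) = (\<Sum>i\<in>Basis. (a' z \<bullet> i) *\<^sub>R f (h y) i)" for z
    using lin[OF h(2)] by (rule linear_Basis_expand)
  ultimately have d: "((\<lambda>y. \<Sum>i\<in>Basis. (a y \<bullet> i) *\<^sub>R f (h y) i) has_derivative
    (\<lambda>z. frechet_derivative (\<lambda>x. f x (a y)) (at (h y)) (h' z) + f (h y) (a' z))) (at y)"
    by (simp add: sum.distrib)
  have "eventually (\<lambda>y. h y \<in> S) (at y)"
    using topological_tendstoD[OF _ S h(2)] has_derivative_continuous[OF h(1)] by (simp add: continuous_at)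
  then have "eventually (\<lambda>y. (\<Sum>i\<in>Basis. (a y \<bullet> i) *\<^sub>R f (h y) i) = f (h y) (a y)) (at y)"
    by eventually_elim (simp add: linear_Basis_expand[OF lin, symmetric])
  with d show ?thesis
    by (rule has_derivative_transform_eventually) (simp_all add: linear_Basis_expand[OF lin[OF h(2)], symmetric])
qed

lemma bilinear_family_has_derivative:
  fixes f :: "'a::euclidean_space \<Rightarrow> 'c::euclidean_space \<Rightarrow> 'e::euclidean_space \<Rightarrow> 'b::euclidean_space"
    and h :: "'d::euclidean_space \<Rightarrow> 'a"
  assumes f: "\<And>v w. smooth_on S (\<lambda>x. f x v w)" and bil: "\<And>x. x \<in> S \<Longrightarrow> bilinear (f x)" and S: "open S"
    and h: "(h has_derivative h') (at y)" "h y \<in> S"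
    and a: "(a has_derivative a') (at y)" and b: "(b has_derivative b') (at y)"
  shows "((\<lambda>y. f (h y) (a y) (b y)) has_derivative
    (\<lambda>z. frechet_derivative (\<lambda>x. f x (a y) (b y)) (at (h y)) (h' z) + f (h y) (a' z) (b y) + f (h y) (a y) (b' z))) (at y)"
proof -
  have l1: "linear (\<lambda>v. f x v w)" and l2: "linear (f x v)" if "x \<in> S" for x v w
    using bil[OF that] by (auto simp: bilinear_def)
  have fa: "((\<lambda>y. f (h y) (a y) w) has_derivative
     (\<lambda>z. frechet_derivative (\<lambda>x. f x (a y) w) (at (h y)) (h' z) + f (h y) (a' z) w)) (at y)" for w
    by (rule linear_family_has_derivative[OF f l1 S h a])
  have "((\<lambda>y. \<Sum>i\<in>Basis. (b y \<bullet> i) *\<^sub>R f (h y) (a y) i) has_derivative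
      (\<lambda>z. \<Sum>i\<in>Basis. (b y \<bullet> i) *\<^sub>R (frechet_derivative (\<lambda>x. f x (a y) i) (at (h y)) (h' z) + f (h y) (a' z) i)
         + (b' z \<bullet> i) *\<^sub>R f (h y) (a y) i)) (at y)"
    by (intro has_derivative_sum has_derivative_scaleR has_derivative_inner_left b fa)
  moreover have "((\<lambda>x. \<Sum>i\<in>Basis. (b y \<bullet> i) *\<^sub>R f x (a y) i) has_derivative
      (\<lambda>z. \<Sum>i\<in>Basis. (b y \<bullet> i) *\<^sub>R frechet_derivative (\<lambda>x. f x (a y) i) (at (h y)) z)) (at (h y))"
    by (intro has_derivative_sum has_derivative_scaleR_right smooth_on_has_derivative_open[OF f S h(2)])
  then have "((\<lambda>x. f x (a y) (b y)) has_derivative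
      (\<lambda>z. \<Sum>i\<in>Basis. (b y \<bullet> i) *\<^sub>R frechet_derivative (\<lambda>x. f x (a y) i) (at (h y)) z)) (at (h y))"
    by (rule has_derivative_transform_within_open[OF _ S h(2)]) (metis l2 linear_Basis_expand)
  then have "frechet_derivative (\<lambda>x. f x (a y) (b y)) (at (h y)) =
      (\<lambda>z. \<Sum>i\<in>Basis. (b y \<bullet> i) *\<^sub>R frechet_derivative (\<lambda>x. f x (a y) i) (at (h y)) z)"
    by (rule frechet_derivative_at[symmetric])
  moreover have "f (h y) (a' z) (b y) = (\<Sum>i\<in>Basis. (b y \<bullet> i) *\<^sub>R f (h y) (a' z) i)"
     "f (h y) (a y) (b' z) = (\<Sum>i\<in>Basis. (b' z \<bullet> i) *\<^sub>R f (h y) (a y) i)" for z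
    by (rule linear_Basis_expand[OF l2[OF h(2)]])+
  ultimately have d: "((\<lambda>y. \<Sum>i\<in>Basis. (b y \<bullet> i) *\<^sub>R f (h y) (a y) i) has_derivative
    (\<lambda>z. frechet_derivative (\<lambda>x. f x (a y) (b y)) (at (h y)) (h' z) + f (h y) (a' z) (b y) + f (h y) (a y) (b' z))) (at y)"
    by (simp add: sum.distrib scaleR_add_right)
  have "eventually (\<lambda>y. h y \<in> S) (at y)"
    using topological_tendstoD[OF _ S h(2)] has_derivative_continuous[OF h(1)] by (simp add: continuous_at)
  then have "eventually (\<lambda>y. (\<Sum>i\<in>Basis. (b y \<bullet> i) *\<^sub>R f (h y) (a y) i) = f (h y) (a y) (b y)) (at y)"
    by eventually_elim (simp add: linear_Basis_expand[OF l2, symmetric])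
  with d show ?thesis
    by (rule has_derivative_transform_eventually) (simp_all add: linear_Basis_expand[OF l2[OF h(2)], symmetric])
qed

lemma derivative_of_linear_family:
  fixes f :: "'a::euclidean_space \<Rightarrow> 'c::euclidean_space \<Rightarrow> 'b::euclidean_space"
  assumes f: "\<And>v. smooth_on S (\<lambda>x. f x v)" and lin: "\<And>x. x \<in> S \<Longrightarrow> linear (f x)" and S: "open S" "x \<in> S"
  shows "linear (\<lambda>v. frechet_derivative (\<lambda>y. f y v) (at x) z)"
proof -
  have "frechet_derivative (\<lambda>y. f y v) (at x) z = (\<Sum>i\<in>Basis. (v \<bullet> i) *\<^sub>R frechet_derivative (\<lambda>y. f y i) (at x) z)" for v
  proof -
    have "((\<lambda>y. \<Sum>i\<in>Basis. (v \<bullet> i) *\<^sub>R f y i) has_derivative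
        (\<lambda>z. \<Sum>i\<in>Basis. (v \<bullet> i) *\<^sub>R frechet_derivative (\<lambda>y. f y i) (at x) z)) (at x)"
      by (intro has_derivative_sum has_derivative_scaleR_right smooth_on_has_derivative_open[OF f S])
    then have "((\<lambda>y. f y v) has_derivative
        (\<lambda>z. \<Sum>i\<in>Basis. (v \<bullet> i) *\<^sub>R frechet_derivative (\<lambda>y. f y i) (at x) z)) (at x)"
      by (rule has_derivative_transform_within_open[OF _ S]) (metis lin linear_Basis_expand)
    then have "(\<lambda>z. \<Sum>i\<in>Basis. (v \<bullet> i) *\<^sub>R frechet_derivative (\<lambda>y. f y i) (at x) z) = frechet_derivative (\<lambda>y. f y v) (at x)"
      by (rule frechet_derivative_at)
    then show ?thesis by (rule fun_cong[OF sym])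
  qed
  then have eq: "(\<lambda>v. frechet_derivative (\<lambda>y. f y v) (at x) z) =
      (\<lambda>v. \<Sum>i\<in>Basis. (v \<bullet> i) *\<^sub>R frechet_derivative (\<lambda>y. f y i) (at x) z)" by (rule ext)
  have "linear (\<lambda>v. \<Sum>i\<in>Basis. (v \<bullet> i) *\<^sub>R K i)" for K :: "'c \<Rightarrow> 'b"
    by (auto intro!: linearI simp: inner_add_left sum.distrib scaleR_add_left scaleR_sum_right)
  then show ?thesis unfolding eq .
qed

lemma derivative_of_bilinear_family:
  fixes f :: "'a::euclidean_space \<Rightarrow> 'c::euclidean_space \<Rightarrow> 'e::euclidean_space \<Rightarrow> 'b::euclidean_space"
  assumes f: "\<And>v w. smooth_on S (\<lambda>x. f x v w)" and bil: "\<And>x. x \<in> S \<Longrightarrow> bilinear (f x)" and S: "open S" "x \<in> S"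
  shows "bilinear (\<lambda>v w. frechet_derivative (\<lambda>y. f y v w) (at x) z)"
  unfolding bilinear_def
  by (intro conjI allI derivative_of_linear_family[where f="\<lambda>y. f y _", OF f _ S]
      derivative_of_linear_family[where f="\<lambda>y v. f y v _", OF f _ S])
    (use bil in \<open>auto simp: bilinear_def\<close>)

section \<open>Tangent vectors and the Levi-Civita connection in charts\<close>

text \<open>An inner product represents linear functionals: the operator with matrix \<open>G\<close> is injective, hence
  surjective in finite dimension.\<close>

lemma nondegenerate_representation:
  fixes G :: "'e::euclidean_space \<Rightarrow> 'e \<Rightarrow> real"
  assumes G: "bilinear G" and pos: "\<And>v. v \<noteq> 0 \<Longrightarrow> G v v > 0" and k: "linear k"
  shows "\<exists>\<xi>. \<forall>w. G \<xi> w = k w"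
proof -
  define M where "M = (\<lambda>\<xi>. \<Sum>b\<in>Basis. G \<xi> b *\<^sub>R b)"
  have linM: "linear M"
    unfolding M_def using G
    by (auto intro!: linearI simp: bilinear_ladd bilinear_lmul scaleR_add_left sum.distrib scaleR_sum_right)
  have MG: "M \<xi> \<bullet> w = G \<xi> w" for \<xi> w
  proof -
    have "linear (G \<xi>)" using G by (simp add: bilinear_def)
    then have "G \<xi> w = (\<Sum>b\<in>Basis. (w \<bullet> b) *\<^sub>R G \<xi> b)" by (rule linear_Basis_expand)
    then show ?thesis by (simp add: M_def inner_sum_left inner_commute[of w] mult.commute)
  qed
  have "inj M"
    unfolding linear_injective_0[OF linM]
  proof (intro allI impI)
    fix \<xi> assume "M \<xi> = 0"
    then have "G \<xi> \<xi> = 0" using MG[of \<xi> \<xi>] by simp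
    then show "\<xi> = 0" using pos[of \<xi>] by auto
  qed
  then have "surj M" by (rule linear_inj_imp_surj[OF linM])
  then obtain \<xi> where \<xi>: "M \<xi> = (\<Sum>b\<in>Basis. k b *\<^sub>R b)" by (metis surjD)
  have "G \<xi> w = k w" for w
  proof -
    have "G \<xi> w = (\<Sum>b\<in>Basis. k b *\<^sub>R b) \<bullet> w" using MG \<xi> by metis
    also have "\<dots> = (\<Sum>b\<in>Basis. (w \<bullet> b) *\<^sub>R k b)" by (simp add: inner_sum_left inner_commute[of w] mult.commute)
    also have "\<dots> = k w" by (rule linear_Basis_expand[OF k, symmetric])
    finally show ?thesis .
  qed
  then show ?thesis by blast
qed

locale closed_riemannian =
  fixes A :: "('m::t2_space, 'e::euclidean_space) chart set" and g :: "('m, 'e) metric"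
  assumes manifold: "closed_manifold A" and metric: "riemannian_metric A g"
begin

abbreviation "G \<equiv> metric_coeff A g"
abbreviation "\<Gamma> \<equiv> christoffel A g"

definition overlap :: "('m, 'e) chart \<Rightarrow> ('m, 'e) chart \<Rightarrow> 'e set" where
  "overlap c c' = app_chart c ` (dom_chart c \<inter> dom_chart c')"

definition dtrans :: "('m, 'e) chart \<Rightarrow> ('m, 'e) chart \<Rightarrow> 'e \<Rightarrow> 'e \<Rightarrow> 'e" where
  "dtrans c c' x = frechet_derivative (transition c c') (at x)"

lemma chart_facts:
  assumes "c \<in> A"
  shows "open (dom_chart c)" "open (img_chart c)"
    "homeomorphism (dom_chart c) (img_chart c) (app_chart c) (inv_chart c)"
  using manifold assms by (auto simp: closed_manifold_def smooth_atlas_def)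

lemma compact_UNIV: "compact (UNIV :: 'm set)"
  using manifold by (simp add: closed_manifold_def)

lemma charts_cover: "\<exists>c\<in>A. p \<in> dom_chart c"
proof -
  have "p \<in> (\<Union>c\<in>A. dom_chart c)" using manifold by (simp add: closed_manifold_def smooth_atlas_def)
  then show ?thesis by auto
qed

lemma inv_app: "c \<in> A \<Longrightarrow> p \<in> dom_chart c \<Longrightarrow> inv_chart c (app_chart c p) = p"
  using chart_facts(3) homeomorphism_apply1 by blast

lemma app_inv: "c \<in> A \<Longrightarrow> x \<in> img_chart c \<Longrightarrow> app_chart c (inv_chart c x) = x"
  using chart_facts(3) homeomorphism_apply2 by blast

lemma inv_in_dom: "c \<in> A \<Longrightarrow> x \<in> img_chart c \<Longrightarrow> inv_chart c x \<in> dom_chart c"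
  using chart_facts(3) homeomorphism_image2 by blast

lemma app_in_img: "p \<in> dom_chart c \<Longrightarrow> app_chart c p \<in> img_chart c"
  by (simp add: img_chart_def)

lemma app_continuous: "c \<in> A \<Longrightarrow> continuous_on (dom_chart c) (app_chart c)"
  using chart_facts(3) homeomorphism_cont1 by blast

lemma inv_continuous: "c \<in> A \<Longrightarrow> continuous_on (img_chart c) (inv_chart c)"
  using chart_facts(3) homeomorphism_cont2 by blast

lemma open_app_image:
  assumes "c \<in> A" "open U" "U \<subseteq> dom_chart c" shows "open (app_chart c ` U)"
proof -
  have "openin (top_of_set (img_chart c)) (app_chart c ` U)"
    using assms by (intro homeomorphism_imp_open_map[OF chart_facts(3)]) (auto simp: openin_open)
  then show ?thesis using chart_facts(2)[OF assms(1)] by (simp add: openin_open_eq)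
qed

lemma overlap_open: "c \<in> A \<Longrightarrow> c' \<in> A \<Longrightarrow> open (overlap c c')"
  unfolding overlap_def by (rule open_app_image) (auto intro!: open_Int chart_facts)

lemma transition_smooth: "c \<in> A \<Longrightarrow> c' \<in> A \<Longrightarrow> smooth_on (overlap c c') (transition c c')"
  using manifold by (auto simp: closed_manifold_def smooth_atlas_def overlap_def)

lemma overlapI: "p \<in> dom_chart c \<Longrightarrow> p \<in> dom_chart c' \<Longrightarrow> app_chart c p \<in> overlap c c'"
  by (auto simp: overlap_def)

lemma overlapE:
  assumes "c \<in> A" "x \<in> overlap c c'"
  obtains p where "p \<in> dom_chart c" "p \<in> dom_chart c'" "x = app_chart c p"
  using assms by (auto simp: overlap_def)

lemma transition_app: "c \<in> A \<Longrightarrow> p \<in> dom_chart c \<Longrightarrow> transition c c' (app_chart c p) = app_chart c' p"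
  by (simp add: transition_def inv_app)

lemma transition_has_derivative:
  "c \<in> A \<Longrightarrow> c' \<in> A \<Longrightarrow> x \<in> overlap c c' \<Longrightarrow> (transition c c' has_derivative dtrans c c' x) (at x)"
  unfolding dtrans_def by (rule smooth_on_has_derivative_open[OF transition_smooth overlap_open])

lemma dtrans_linear: "c \<in> A \<Longrightarrow> c' \<in> A \<Longrightarrow> x \<in> overlap c c' \<Longrightarrow> linear (dtrans c c' x)"
  using transition_has_derivative has_derivative_linear by blast

lemma dtrans_smooth: "c \<in> A \<Longrightarrow> c' \<in> A \<Longrightarrow> smooth_on (overlap c c') (\<lambda>x. dtrans c c' x v)"
  unfolding dtrans_def by (rule smooth_on_derivative_open[OF transition_smooth overlap_open])

lemma dtrans_chain:
  assumes "c \<in> A" "c' \<in> A" "c'' \<in> A" "p \<in> dom_chart c" "p \<in> dom_chart c'" "p \<in> dom_chart c''"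
  shows "dtrans c' c'' (app_chart c' p) (dtrans c c' (app_chart c p) v) = dtrans c c'' (app_chart c p) v"
proof -
  let ?U = "app_chart c ` (dom_chart c \<inter> (dom_chart c' \<inter> dom_chart c''))"
  have U: "open ?U" by (rule open_app_image) (auto intro!: open_Int chart_facts assms)
  have pU: "app_chart c p \<in> ?U" using assms by auto
  have "((\<lambda>x. transition c' c'' (transition c c' x)) has_derivative
      (\<lambda>v. dtrans c' c'' (transition c c' (app_chart c p)) (dtrans c c' (app_chart c p) v))) (at (app_chart c p))"
    by (rule has_derivative_compose) (use assms in \<open>auto intro!: transition_has_derivative overlapI simp: transition_app\<close>)
  then have "((\<lambda>x. transition c c'' x) has_derivative
      (\<lambda>v. dtrans c' c'' (transition c c' (app_chart c p)) (dtrans c c' (app_chart c p) v))) (at (app_chart c p))"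
    by (rule has_derivative_transform_within_open[OF _ U pU]) (use assms in \<open>auto simp: transition_app\<close>)
  then have "(\<lambda>v. dtrans c' c'' (transition c c' (app_chart c p)) (dtrans c c' (app_chart c p) v)) = dtrans c c'' (app_chart c p)"
    by (rule has_derivative_unique) (use assms in \<open>auto intro!: transition_has_derivative overlapI\<close>)
  then show ?thesis using assms by (metis transition_app)
qed

lemma dtrans_self:
  assumes "c \<in> A" "p \<in> dom_chart c" shows "dtrans c c (app_chart c p) v = v"
proof -
  have "((\<lambda>x. x) has_derivative (\<lambda>v. v)) (at (app_chart c p))" by (rule has_derivative_ident)
  then have "(transition c c has_derivative (\<lambda>v. v)) (at (app_chart c p))"
    by (rule has_derivative_transform_within_open[OF _ overlap_open[OF assms(1) assms(1)] overlapI])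
      (use assms in \<open>auto simp: overlap_def transition_app\<close>)
  then have "(\<lambda>v. v) = dtrans c c (app_chart c p)"
    by (rule has_derivative_unique) (use assms in \<open>auto intro!: transition_has_derivative overlapI\<close>)
  then show ?thesis by metis
qed

lemma dtrans_inverse:
  assumes "c \<in> A" "c' \<in> A" "p \<in> dom_chart c" "p \<in> dom_chart c'"
  shows "dtrans c' c (app_chart c' p) (dtrans c c' (app_chart c p) v) = v"
  using assms by (simp add: dtrans_chain dtrans_self)

text \<open>Coordinate representatives related by the derivative of a transition map define the same tangent
  vector. Through this the metric coefficients in different charts determine each other.\<close>

lemma tvec_of_change:
  assumes "c \<in> A" "c' \<in> A" "p \<in> dom_chart c" "p \<in> dom_chart c'"
  shows "tvec_of A c' p (dtrans c c' (app_chart c p) v) = tvec_of A c p v"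
  unfolding tvec_of_def dtrans_def[symmetric]
  using assms by (auto simp: fun_eq_iff charts_at_def dtrans_chain)

lemma metric_coeff_change:
  assumes "c \<in> A" "c' \<in> A" "p \<in> dom_chart c" "p \<in> dom_chart c'"
  shows "G c' (app_chart c' p) (dtrans c c' (app_chart c p) v) (dtrans c c' (app_chart c p) w) = G c (app_chart c p) v w"
  using assms by (simp add: metric_coeff_def inv_app tvec_of_change)

lemma tangent_spaceI:
  assumes "\<And>c c'. c \<in> A \<Longrightarrow> c' \<in> A \<Longrightarrow> p \<in> dom_chart c \<Longrightarrow> p \<in> dom_chart c' \<Longrightarrow> \<xi> c' = dtrans c c' (app_chart c p) (\<xi> c)"
    "\<And>c. c \<notin> charts_at A p \<Longrightarrow> \<xi> c = 0"
  shows "\<xi> \<in> tangent_space A p"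
  using assms unfolding tangent_space_def dtrans_def by (auto simp: charts_at_def)

lemma tangent_spaceD:
  assumes "\<xi> \<in> tangent_space A p" "c \<in> A" "c' \<in> A" "p \<in> dom_chart c" "p \<in> dom_chart c'"
  shows "\<xi> c' = dtrans c c' (app_chart c p) (\<xi> c)"
  using assms unfolding tangent_space_def dtrans_def charts_at_def by blast

text \<open>A genuine tangent vector is recovered from any one of its representatives, so its norm can be
  computed in any chart. For families of vectors that are not compatible under transition maps the
  value of \<open>g\<close> has no meaning.\<close>

lemma tnorm_chart:
  assumes "\<xi> \<in> tangent_space A p" "c \<in> A" "p \<in> dom_chart c"
  shows "tnorm g p \<xi> = sqrt (G c (app_chart c p) (\<xi> c) (\<xi> c))"
proof -
  have "tvec_of A c p (\<xi> c) c' = \<xi> c'" for c'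
  proof (cases "c' \<in> charts_at A p")
    case True
    then show ?thesis using tangent_spaceD[OF assms(1,2) _ assms(3), of c'] by (simp add: tvec_of_def dtrans_def charts_at_def)
  next
    case False
    then have "\<xi> c' = 0" using assms(1) unfolding tangent_space_def by blast
    with False show ?thesis by (simp add: tvec_of_def)
  qed
  then have "tvec_of A c p (\<xi> c) = \<xi>" by blast
  then show ?thesis by (simp add: tnorm_def metric_coeff_def inv_app assms)
qed

lemma metric_bilinear: "c \<in> A \<Longrightarrow> x \<in> img_chart c \<Longrightarrow> bilinear (G c x)"
  and metric_sym: "c \<in> A \<Longrightarrow> x \<in> img_chart c \<Longrightarrow> G c x v w = G c x w v"
  and metric_pos: "c \<in> A \<Longrightarrow> x \<in> img_chart c \<Longrightarrow> v \<noteq> 0 \<Longrightarrow> G c x v v > 0"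
  and metric_smooth: "c \<in> A \<Longrightarrow> smooth_on (img_chart c) (\<lambda>x. G c x v w)"
  using metric unfolding riemannian_metric_def by blast+

definition dG :: "('m, 'e) chart \<Rightarrow> 'e \<Rightarrow> 'e \<Rightarrow> 'e \<Rightarrow> 'e \<Rightarrow> real" where
  "dG c x z v w = frechet_derivative (\<lambda>y. G c y v w) (at x) z"

lemma dG_smooth: "c \<in> A \<Longrightarrow> smooth_on (img_chart c) (\<lambda>x. dG c x z v w)"
  unfolding dG_def by (rule smooth_on_derivative_open[OF metric_smooth chart_facts(2)])

lemma dG_linear: "c \<in> A \<Longrightarrow> x \<in> img_chart c \<Longrightarrow> linear (\<lambda>z. dG c x z v w)"
  unfolding dG_def
  by (rule has_derivative_linear[OF smooth_on_has_derivative_open[OF metric_smooth chart_facts(2)]])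

lemma dG_bilinear: "c \<in> A \<Longrightarrow> x \<in> img_chart c \<Longrightarrow> bilinear (dG c x z)"
  using derivative_of_bilinear_family[of "img_chart c" "G c" x z] metric_smooth metric_bilinear chart_facts(2)
  by (simp add: dG_def[abs_def])

lemma dG_sym:
  assumes c: "c \<in> A" and x: "x \<in> img_chart c" shows "dG c x z v w = dG c x z w v"
proof -
  have "((\<lambda>y. G c y v w) has_derivative (\<lambda>z. dG c x z v w)) (at x)"
    unfolding dG_def by (rule smooth_on_has_derivative_open[OF metric_smooth[OF c] chart_facts(2)[OF c] x])
  then have "((\<lambda>y. G c y w v) has_derivative (\<lambda>z. dG c x z v w)) (at x)"
    by (rule has_derivative_transform_within_open[OF _ chart_facts(2)[OF c] x]) (rule metric_sym[OF c])
  then have "(\<lambda>z. dG c x z v w) = frechet_derivative (\<lambda>y. G c y w v) (at x)" by (rule frechet_derivative_at)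
  then show ?thesis unfolding dG_def[of _ _ _ w v] by (rule fun_cong)
qed

text \<open>The right hand side of the Koszul formula in a chart.\<close>

definition koszul :: "('m, 'e) chart \<Rightarrow> 'e \<Rightarrow> 'e \<Rightarrow> 'e \<Rightarrow> 'e \<Rightarrow> real" where
  "koszul c x z v w = (dG c x z v w + dG c x v z w - dG c x w z v) / 2"

definition levi_civita :: "('m, 'e) chart \<Rightarrow> 'e \<Rightarrow> ('e \<Rightarrow> 'e \<Rightarrow> 'e) \<Rightarrow> bool" where
  "levi_civita c x C \<longleftrightarrow> bilinear C \<and> (\<forall>v w. C v w = C w v) \<and>
     (\<forall>z v w. dG c x z v w = G c x (C z v) w + G c x v (C z w))"

lemma nondegenerate:
  assumes "c \<in> A" "x \<in> img_chart c" "\<And>w. G c x v w = G c x v' w" shows "v = v'"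
proof (rule ccontr)
  assume "v \<noteq> v'"
  then have "G c x (v - v') (v - v') > 0" using metric_pos assms by auto
  moreover have "G c x (v - v') w = 0" for w
    using assms bilinear_lsub[OF metric_bilinear[OF assms(1,2)]] by simp
  ultimately show False by simp
qed

text \<open>Adding the metric compatibility equations for \<open>(z, v, w)\<close> and \<open>(v, z, w)\<close> and subtracting the one
  for \<open>(w, z, v)\<close> cancels all terms but one, by symmetry. Hence there is at most one solution, and the
  Koszul formula defines it.\<close>

lemma levi_civita_koszul:
  assumes "c \<in> A" "x \<in> img_chart c" "levi_civita c x \<Gamma>'"
  shows "G c x (\<Gamma>' z v) w = koszul c x z v w"
proof -
  have s: "\<Gamma>' a b = \<Gamma>' b a" for a b using assms by (simp add: levi_civita_def)
  have d: "dG c x a b d = G c x (\<Gamma>' a b) d + G c x b (\<Gamma>' a d)" for a b d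
    using assms unfolding levi_civita_def by blast
  have "2 * koszul c x z v w = 2 * G c x (\<Gamma>' z v) w"
    unfolding koszul_def d using s[of v z] s[of w z] s[of w v] metric_sym[OF assms(1,2)] by simp
  then show ?thesis by simp
qed

lemma levi_civita_unique:
  assumes "c \<in> A" "x \<in> img_chart c" "levi_civita c x \<Gamma>1" "levi_civita c x \<Gamma>2" shows "\<Gamma>1 = \<Gamma>2"
  by (intro ext nondegenerate[OF assms(1,2)]) (simp add: levi_civita_koszul assms)

lemma koszul_linear:
  assumes "c \<in> A" "x \<in> img_chart c"
  shows "linear (\<lambda>z. koszul c x z v w)" "linear (\<lambda>v. koszul c x z v w)" "linear (koszul c x z v)"
  unfolding koszul_def[abs_def]
  by (auto intro!: linearI simp: linear_add[OF dG_linear[OF assms]] linear_cmul[OF dG_linear[OF assms]]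
      bilinear_ladd[OF dG_bilinear[OF assms]] bilinear_lmul[OF dG_bilinear[OF assms]]
      bilinear_radd[OF dG_bilinear[OF assms]] bilinear_rmul[OF dG_bilinear[OF assms]]
      add_divide_distrib diff_divide_distrib algebra_simps)

lemma levi_civita_exists:
  assumes c: "c \<in> A" and x: "x \<in> img_chart c" shows "\<exists>\<Gamma>'. levi_civita c x \<Gamma>'"
proof -
  have "\<forall>z v. \<exists>\<xi>. \<forall>w. G c x \<xi> w = koszul c x z v w"
    using nondegenerate_representation[OF metric_bilinear[OF c x] metric_pos[OF c x] koszul_linear(3)[OF c x]] by blast
  then obtain \<Gamma>' where G': "\<And>z v w. G c x (\<Gamma>' z v) w = koszul c x z v w" by metis
  note nd = nondegenerate[OF c x] and bl = metric_bilinear[OF c x]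
  have "bilinear \<Gamma>'"
    unfolding bilinear_def
    by (auto intro!: linearI nd simp: G' bilinear_ladd[OF bl] bilinear_lmul[OF bl]
       linear_add[OF koszul_linear(1)[OF c x]] linear_cmul[OF koszul_linear(1)[OF c x]]
       linear_add[OF koszul_linear(2)[OF c x]] linear_cmul[OF koszul_linear(2)[OF c x]])
  moreover have "\<Gamma>' v w = \<Gamma>' w v" for v w
    by (rule nd) (simp add: G' koszul_def dG_sym[OF c x])
  moreover have "dG c x z v w = G c x (\<Gamma>' z v) w + G c x v (\<Gamma>' z w)" for z v w
    unfolding metric_sym[OF c x, of v] G' by (simp add: koszul_def dG_sym[OF c x, of _ w] field_simps)
  ultimately show ?thesis unfolding levi_civita_def by blast
qed

lemma christoffel_levi_civita:
  assumes "c \<in> A" "x \<in> img_chart c" shows "levi_civita c x (\<Gamma> c x)"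
proof -
  have "\<Gamma> c x = (THE \<Gamma>'. levi_civita c x \<Gamma>')"
    unfolding christoffel_def levi_civita_def dG_def ..
  then show ?thesis
    using theI'[of "levi_civita c x"] levi_civita_exists[OF assms] levi_civita_unique[OF assms] by metis
qed

lemma christoffel_bilinear: "c \<in> A \<Longrightarrow> x \<in> img_chart c \<Longrightarrow> bilinear (\<Gamma> c x)"
  using christoffel_levi_civita by (simp add: levi_civita_def)

text \<open>Pull back the Christoffel symbol of \<open>c'\<close> and add the second derivative of the transition map. The
  result is symmetric because second derivatives are, and it is compatible with the metric by
  differentiating \<open>metric_coeff_change\<close>. So it is the Christoffel symbol of \<open>c\<close>.\<close>

lemma christoffel_transformation:
  assumes c: "c \<in> A" "c' \<in> A" and p: "p \<in> dom_chart c" "p \<in> dom_chart c'"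
  defines "x \<equiv> app_chart c p" and "x' \<equiv> app_chart c' p"
  shows "dtrans c c' x (\<Gamma> c x v w) =
    \<Gamma> c' x' (dtrans c c' x v) (dtrans c c' x w) + frechet_derivative (\<lambda>y. dtrans c c' y w) (at x) v"
proof -
  define D where "D = dtrans c c' x"
  define E where "E = dtrans c' c x'"
  define D2 where "D2 = (\<lambda>v w. frechet_derivative (\<lambda>y. dtrans c c' y w) (at x) v)"
  define \<Gamma>' where "\<Gamma>' = (\<lambda>v w. E (\<Gamma> c' x' (D v) (D w) + D2 v w))"
  have xi: "x \<in> img_chart c" "x' \<in> img_chart c'" using p by (auto simp: x_def x'_def app_in_img)
  have xo: "x \<in> overlap c c'" "x' \<in> overlap c' c" using p by (auto simp: x_def x'_def overlapI)
  have ED: "E (D v) = v" for v using dtrans_inverse[OF c p] by (simp add: E_def D_def x_def x'_def)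
  have DE: "D (E v) = v" for v using dtrans_inverse[OF c(2,1) p(2,1)] by (simp add: E_def D_def x_def x'_def)
  have lD: "linear D" and lE: "linear E" using dtrans_linear c xo by (auto simp: D_def E_def)
  have lc: "levi_civita c' x' (\<Gamma> c' x')" by (rule christoffel_levi_civita[OF c(2) xi(2)])
  have G_D: "G c' x' (D v) (D w) = G c x v w" for v w
    using metric_coeff_change[OF c p] by (simp add: D_def x_def x'_def)
  have D2_deriv: "((\<lambda>y. dtrans c c' y w) has_derivative (\<lambda>v. D2 v w)) (at x)" for w
    unfolding D2_def by (rule smooth_on_has_derivative_open[OF dtrans_smooth[OF c] overlap_open[OF c] xo(1)])
  have bD2: "bilinear D2"
    unfolding bilinear_def D2_def
  proof (intro conjI allI)
    show "linear (\<lambda>w. frechet_derivative (\<lambda>y. dtrans c c' y w) (at x) v)" for v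
      by (rule derivative_of_linear_family[OF dtrans_smooth[OF c] dtrans_linear[OF c] overlap_open[OF c] xo(1)])
    show "linear (\<lambda>v. frechet_derivative (\<lambda>y. dtrans c c' y w) (at x) v)" for w
      using has_derivative_linear[OF D2_deriv[of w]] by (simp add: D2_def)
  qed
  have D2_sym: "D2 v w = D2 w v" for v w
    unfolding D2_def dtrans_def
    by (rule smooth_second_derivative_symmetric[OF transition_smooth[OF c] overlap_open[OF c] xo(1)])
  have "levi_civita c x \<Gamma>'"
    unfolding levi_civita_def
  proof (intro conjI allI)
    have bG: "bilinear (\<Gamma> c' x')" using lc by (simp add: levi_civita_def)
    show "bilinear \<Gamma>'"
      unfolding bilinear_def \<Gamma>'_def
      by (auto intro!: linearI simp: bilinear_ladd[OF bG] bilinear_radd[OF bG] bilinear_lmul[OF bG] bilinear_rmul[OF bG]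
          bilinear_ladd[OF bD2] bilinear_radd[OF bD2] bilinear_lmul[OF bD2] bilinear_rmul[OF bD2]
          linear_add[OF lD] linear_add[OF lE] linear_cmul[OF lD] linear_cmul[OF lE] scaleR_add_right[symmetric])
    show "\<Gamma>' v w = \<Gamma>' w v" for v w
      using lc D2_sym[of v w] by (simp add: \<Gamma>'_def levi_civita_def)
    fix z v w
    have "((\<lambda>y. G c' (transition c c' y) (dtrans c c' y v) (dtrans c c' y w)) has_derivative
       (\<lambda>z. frechet_derivative (\<lambda>y'. G c' y' (dtrans c c' x v) (dtrans c c' x w)) (at (transition c c' x)) (D z)
         + G c' (transition c c' x) (D2 z v) (dtrans c c' x w) + G c' (transition c c' x) (dtrans c c' x v) (D2 z w))) (at x)"
    proof (rule bilinear_family_has_derivative[OF metric_smooth[OF c(2)] metric_bilinear[OF c(2)] chart_facts(2)[OF c(2)] _ _ D2_deriv D2_deriv])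
      show "(transition c c' has_derivative D) (at x)" unfolding D_def by (rule transition_has_derivative[OF c xo(1)])
      show "transition c c' x \<in> img_chart c'" using xi c p by (simp add: x_def x'_def transition_app)
    qed
    moreover have "transition c c' x = x'" using c p by (simp add: x_def x'_def transition_app)
    ultimately have *: "((\<lambda>y. G c' (transition c c' y) (dtrans c c' y v) (dtrans c c' y w)) has_derivative
       (\<lambda>z. dG c' x' (D z) (D v) (D w) + G c' x' (D2 z v) (D w) + G c' x' (D v) (D2 z w))) (at x)"
      unfolding dG_def D_def by (simp only:)
    have pull: "G c' (transition c c' y) (dtrans c c' y v) (dtrans c c' y w) = G c y v w" if y: "y \<in> overlap c c'" for y
    proof -
      obtain q where "q \<in> dom_chart c" "q \<in> dom_chart c'" "y = app_chart c q" using overlapE[OF c(1) y] .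
      then show ?thesis using c by (simp add: transition_app metric_coeff_change)
    qed
    have "((\<lambda>y. G c y v w) has_derivative
       (\<lambda>z. dG c' x' (D z) (D v) (D w) + G c' x' (D2 z v) (D w) + G c' x' (D v) (D2 z w))) (at x)"
      by (rule has_derivative_transform_within_open[OF * overlap_open[OF c] xo(1) pull])
    from fun_cong[OF frechet_derivative_at[OF this, symmetric], of z]
    have "dG c x z v w = dG c' x' (D z) (D v) (D w) + G c' x' (D2 z v) (D w) + G c' x' (D v) (D2 z w)"
      unfolding dG_def[of c] .
    also have "\<dots> = G c' x' (\<Gamma> c' x' (D z) (D v) + D2 z v) (D w) + G c' x' (D v) (\<Gamma> c' x' (D z) (D w) + D2 z w)"
      using lc bilinear_ladd[OF metric_bilinear[OF c(2) xi(2)]] bilinear_radd[OF metric_bilinear[OF c(2) xi(2)]]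
      by (simp add: levi_civita_def)
    also have "\<dots> = G c' x' (D (\<Gamma>' z v)) (D w) + G c' x' (D v) (D (\<Gamma>' z w))"
      by (simp add: \<Gamma>'_def DE)
    finally show "dG c x z v w = G c x (\<Gamma>' z v) w + G c x v (\<Gamma>' z w)" by (simp add: G_D)
  qed
  then have "\<Gamma> c x = \<Gamma>'"
    by (rule levi_civita_unique[OF c(1) xi(1) christoffel_levi_civita[OF c(1) xi(1)]])
  then have "D (\<Gamma> c x v w) = \<Gamma> c' x' (D v) (D w) + D2 v w" by (simp add: \<Gamma>'_def DE)
  then show ?thesis by (simp add: D_def D2_def)
qed

end

section \<open>Covariant derivatives along curves and bounds on compact sets\<close>

context closed_riemannian
begin

lemma eventually_in_chart:
  assumes "c \<in> A" "\<gamma> t \<in> dom_chart c" "continuous (at t) \<gamma>"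
  shows "eventually (\<lambda>r. \<gamma> r \<in> dom_chart c) (at t)"
  using topological_tendstoD[OF _ chart_facts(1)[OF assms(1)] assms(2)] assms(3) by (simp add: continuous_at)

lemma curve_chart_change:
  fixes \<gamma> :: "real \<Rightarrow> 'm"
  assumes c: "c \<in> A" "c' \<in> A" and t: "\<gamma> t \<in> dom_chart c" "\<gamma> t \<in> dom_chart c'" and cont: "continuous (at t) \<gamma>"
    and d: "((\<lambda>r. app_chart c (\<gamma> r)) has_vector_derivative v) (at t)"
  shows "((\<lambda>r. app_chart c' (\<gamma> r)) has_vector_derivative dtrans c c' (app_chart c (\<gamma> t)) v) (at t)"
proof -
  have "((\<lambda>r. transition c c' (app_chart c (\<gamma> r))) has_vector_derivative dtrans c c' (app_chart c (\<gamma> t)) v) (at t)"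
    using vector_derivative_diff_chain_within[OF d has_derivative_at_withinI[OF transition_has_derivative[OF c overlapI[OF t]]]]
    by (simp add: o_def)
  moreover have "eventually (\<lambda>r. transition c c' (app_chart c (\<gamma> r)) = app_chart c' (\<gamma> r)) (at t)"
    using eventually_in_chart[OF c(1) t(1) cont] by eventually_elim (simp add: transition_app c)
  ultimately show ?thesis
    unfolding has_vector_derivative_def
    by (rule has_derivative_transform_eventually) (simp_all add: transition_app c t)
qed

lemma velocity_tangent:
  fixes \<gamma> :: "real \<Rightarrow> 'm"
  assumes cont: "continuous (at t) \<gamma>"
    and d: "\<And>c. c \<in> A \<Longrightarrow> \<gamma> t \<in> dom_chart c \<Longrightarrow> (\<lambda>r. app_chart c (\<gamma> r)) differentiable (at t)"
  shows "velocity A UNIV \<gamma> t \<in> tangent_space A (\<gamma> t)"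
proof (rule tangent_spaceI)
  fix c c' assume c: "c \<in> A" "c' \<in> A" "\<gamma> t \<in> dom_chart c" "\<gamma> t \<in> dom_chart c'"
  have "((\<lambda>r. app_chart c (\<gamma> r)) has_vector_derivative vector_derivative (\<lambda>r. app_chart c (\<gamma> r)) (at t)) (at t)"
    using d[OF c(1,3)] by (simp add: vector_derivative_works[symmetric])
  from vector_derivative_at[OF curve_chart_change[OF c cont this]] c
  show "velocity A UNIV \<gamma> t c' = dtrans c c' (app_chart c (\<gamma> t)) (velocity A UNIV \<gamma> t c)"
    by (simp add: velocity_def charts_at_def)
qed (simp add: velocity_def)

text \<open>The bounds on covariant derivatives concern a norm that carries information only on tangent
  vectors. The derivative of the coordinates of \<open>X\<close> transforms with an additional second derivative
  of the transition map, and this is exactly what the transformation law of the Christoffel symbols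
  compensates.\<close>

lemma cov_deriv_tangent:
  fixes \<gamma> :: "real \<Rightarrow> 'm"
  assumes cont: "continuous (at t) \<gamma>"
    and d: "\<And>c. c \<in> A \<Longrightarrow> \<gamma> t \<in> dom_chart c \<Longrightarrow> (\<lambda>r. app_chart c (\<gamma> r)) differentiable (at t)"
    and X: "\<And>r. X r \<in> tangent_space A (\<gamma> r)" and dX: "cov_differentiable A UNIV \<gamma> X t"
  shows "cov_deriv A g UNIV \<gamma> X t \<in> tangent_space A (\<gamma> t)"
proof (rule tangent_spaceI)
  fix c c' assume c: "c \<in> A" "c' \<in> A" "\<gamma> t \<in> dom_chart c" "\<gamma> t \<in> dom_chart c'"
  define x where "x = app_chart c (\<gamma> t)"
  define v where "v = vector_derivative (\<lambda>r. app_chart c (\<gamma> r)) (at t)"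
  define w where "w = vector_derivative (\<lambda>r. X r c) (at t)"
  have dv: "((\<lambda>r. app_chart c (\<gamma> r)) has_vector_derivative v) (at t)"
    using d[OF c(1,3)] by (simp add: v_def vector_derivative_works[symmetric])
  have dw: "((\<lambda>r. X r c) has_vector_derivative w) (at t)"
    using dX c unfolding cov_differentiable_def charts_at_def w_def vector_derivative_works[symmetric] by blast
  note fam = linear_family_has_derivative[OF dtrans_smooth[OF c(1,2)] dtrans_linear[OF c(1,2)] overlap_open[OF c(1,2)]
      dv[unfolded has_vector_derivative_def] overlapI[OF c(3,4)] dw[unfolded has_vector_derivative_def]]
  have lin: "linear (\<lambda>z. frechet_derivative (\<lambda>y. dtrans c c' y (X t c)) (at x) z)" "linear (dtrans c c' x)"
    using has_derivative_linear[OF smooth_on_has_derivative_open[OF dtrans_smooth[OF c(1,2)] overlap_open[OF c(1,2)] overlapI[OF c(3,4)]]]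
      dtrans_linear[OF c(1,2) overlapI[OF c(3,4)]] by (simp_all add: x_def)
  have "((\<lambda>r. dtrans c c' (app_chart c (\<gamma> r)) (X r c)) has_vector_derivative
      frechet_derivative (\<lambda>y. dtrans c c' y (X t c)) (at x) v + dtrans c c' x w) (at t)"
    using fam linear_cmul[OF lin(1)] linear_cmul[OF lin(2)]
    by (simp add: has_vector_derivative_def x_def scaleR_add_right)
  moreover have "eventually (\<lambda>r. dtrans c c' (app_chart c (\<gamma> r)) (X r c) = X r c') (at t)"
    using eventually_in_chart[OF c(1,3) cont] eventually_in_chart[OF c(2,4) cont]
    by eventually_elim (simp add: tangent_spaceD[OF X c(1,2)])
  ultimately have "((\<lambda>r. X r c') has_vector_derivative
      frechet_derivative (\<lambda>y. dtrans c c' y (X t c)) (at x) v + dtrans c c' x w) (at t)"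
    unfolding has_vector_derivative_def
    by (rule has_derivative_transform_eventually) (simp_all add: tangent_spaceD[OF X c])
  then have "vector_derivative (\<lambda>r. X r c') (at t) = frechet_derivative (\<lambda>y. dtrans c c' y (X t c)) (at x) v + dtrans c c' x w"
    by (rule vector_derivative_at)
  moreover have "vector_derivative (\<lambda>r. app_chart c' (\<gamma> r)) (at t) = dtrans c c' x v"
    unfolding x_def by (rule vector_derivative_at[OF curve_chart_change[OF c cont dv]])
  moreover have "X t c' = dtrans c c' x (X t c)" unfolding x_def by (rule tangent_spaceD[OF X c])
  ultimately show "cov_deriv A g UNIV \<gamma> X t c' = dtrans c c' (app_chart c (\<gamma> t)) (cov_deriv A g UNIV \<gamma> X t c)"
    using c christoffel_transformation[OF c, of v "X t c"]
    by (simp add: cov_deriv_def velocity_def charts_at_def x_def[symmetric] v_def[symmetric] w_def[symmetric] linear_add[OF lin(2)])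
qed (simp add: cov_deriv_def)

lemma zero_tangent: "(\<lambda>_. 0) \<in> tangent_space A p"
proof (rule tangent_spaceI)
  fix c c' assume c: "c \<in> A" "c' \<in> A" "p \<in> dom_chart c" "p \<in> dom_chart c'"
  show "0 = dtrans c c' (app_chart c p) 0"
    using linear_0[OF dtrans_linear[OF c(1,2) overlapI[OF c(3,4)]]] by simp
qed simp

lemma tnorm_zero: "tnorm g p (\<lambda>_. 0) = 0"
proof -
  obtain c where c: "c \<in> A" "p \<in> dom_chart c" using charts_cover by blast
  show ?thesis
    using tnorm_chart[OF zero_tangent c] bilinear_lzero[OF metric_bilinear[OF c(1) app_in_img[OF c(2)]]] by simp
qed

text \<open>The metric coefficient attains a positive minimum on the compact set of pairs of a point of \<open>K\<close> and
  a unit vector.\<close>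

lemma metric_coeff_comparable:
  assumes c: "c \<in> A" and K: "compact K" "convex K" "K \<subseteq> img_chart c"
  shows "\<exists>C\<ge>1. \<forall>x\<in>K. \<forall>v. norm v \<le> C * sqrt (G c x v v) \<and> sqrt (G c x v v) \<le> C * norm v"
proof (cases "K = {}")
  case False
  have bil: "bilinear (G c x)" if "x \<in> K" for x using metric_bilinear[OF c] K that by blast
  obtain B where B: "B \<ge> 0" "\<And>x v w. x \<in> K \<Longrightarrow> norm (G c x v w) \<le> B * norm v * norm w"
    using smooth_bilinear_family_Lipschitz[OF metric_smooth[OF c] bil chart_facts(2)[OF c] K] by blast
  have expand: "G c x v v = (\<Sum>i\<in>Basis. \<Sum>j\<in>Basis. (v \<bullet> i) * ((v \<bullet> j) * G c x i j))" if "x \<in> K" for x v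
  proof -
    have l: "linear (\<lambda>v. G c x v w)" "linear (G c x u)" for u w using bil[OF that] by (auto simp: bilinear_def)
    have "G c x v v = (\<Sum>i\<in>Basis. (v \<bullet> i) *\<^sub>R G c x i v)" by (rule linear_Basis_expand[OF l(1)])
    moreover have "G c x i v = (\<Sum>j\<in>Basis. (v \<bullet> j) *\<^sub>R G c x i j)" for i by (rule linear_Basis_expand[OF l(2)])
    ultimately show ?thesis by (simp only: real_scaleR_def sum_distrib_left)
  qed
  have "continuous_on (K \<times> sphere 0 1) (\<lambda>z. \<Sum>i\<in>Basis. \<Sum>j\<in>Basis. (snd z \<bullet> i) * ((snd z \<bullet> j) * G c (fst z) i j))"
    by (intro continuous_intros continuous_on_compose2[OF smooth_on_imp_continuous_on[OF metric_smooth[OF c]]]) (use K in auto)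
  then have "continuous_on (K \<times> sphere 0 1) (\<lambda>z. G c (fst z) (snd z) (snd z))"
    by (rule continuous_on_eq) (auto simp: expand)
  moreover obtain b :: 'e where "b \<in> Basis" using nonempty_Basis by blast
  then have "K \<times> sphere (0::'e) 1 \<noteq> {}" using False by auto
  ultimately obtain z where z: "z \<in> K \<times> sphere 0 1"
    "\<And>y. y \<in> K \<times> sphere 0 1 \<Longrightarrow> G c (fst z) (snd z) (snd z) \<le> G c (fst y) (snd y) (snd y)"
    using continuous_attains_inf[of "K \<times> sphere 0 1" "\<lambda>z. G c (fst z) (snd z) (snd z)"] compact_Times[OF K(1) compact_sphere[of 0 1]] by blast
  define \<mu> where "\<mu> = G c (fst z) (snd z) (snd z)"
  have "snd z \<noteq> 0" using z(1) by auto
  then have \<mu>: "\<mu> > 0" using z(1) K c by (auto simp: \<mu>_def intro!: metric_pos)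
  have low: "\<mu> * (norm v)\<^sup>2 \<le> G c x v v" if x: "x \<in> K" for x v
  proof (cases "v = 0")
    case True then show ?thesis using bilinear_lzero[OF bil[OF x]] by simp
  next
    case False
    define e where "e = v /\<^sub>R norm v"
    have ve: "v = norm v *\<^sub>R e" using False by (simp add: e_def)
    have "G c x v v = (norm v)\<^sup>2 * G c x e e"
      by (subst (1 2) ve) (simp add: bilinear_lmul[OF bil[OF x]] bilinear_rmul[OF bil[OF x]] power2_eq_square)
    moreover have "\<mu> \<le> G c x e e" using z(2)[of "(x, e)"] x False by (simp add: \<mu>_def e_def)
    ultimately show ?thesis by (simp add: mult_left_mono mult.commute[of \<mu>])
  qed
  define C where "C = 1 + 1 / sqrt \<mu> + sqrt B"
  have C: "1 / sqrt \<mu> \<le> C" "sqrt B \<le> C" "1 \<le> C" using \<mu> B(1) by (auto simp: C_def)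
  have "norm v \<le> C * sqrt (G c x v v)" "sqrt (G c x v v) \<le> C * norm v" if x: "x \<in> K" for x v
  proof -
    have "sqrt \<mu> * norm v \<le> sqrt (G c x v v)"
      using real_sqrt_le_mono[OF low[OF x, of v]] by (simp add: real_sqrt_mult)
    then have "norm v \<le> 1 / sqrt \<mu> * sqrt (G c x v v)" using \<mu> by (simp add: field_simps)
    also have "\<dots> \<le> C * sqrt (G c x v v)"
      using C order_trans[OF _ low[OF x, of v]] \<mu> by (intro mult_right_mono) auto
    finally show "norm v \<le> C * sqrt (G c x v v)" .
    have "sqrt (G c x v v) \<le> sqrt (B * (norm v)\<^sup>2)"
      using B(2)[OF x, of v v] by (intro real_sqrt_le_mono) (simp add: power2_eq_square mult.assoc)
    also have "\<dots> = sqrt B * norm v" by (simp add: real_sqrt_mult)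
    also have "\<dots> \<le> C * norm v" using C by (intro mult_right_mono) auto
    finally show "sqrt (G c x v v) \<le> C * norm v" .
  qed
  then show ?thesis using C by blast
qed auto

text \<open>Insert the difference \<open>u\<close> of the two Christoffel symbols into the Koszul formula at \<open>x\<close>, tested with
  \<open>u\<close> itself. The right hand side is a difference of values at \<open>x\<close> and \<open>y\<close> of smooth objects, and by
  positivity the left hand side controls the square of \<open>u\<close>.\<close>

lemma christoffel_Lipschitz:
  assumes c: "c \<in> A" and K: "compact K" "convex K" "K \<subseteq> img_chart c"
  shows "\<exists>C\<ge>0. \<forall>x\<in>K. \<forall>v w. norm (\<Gamma> c x v w) \<le> C * norm v * norm w \<and>
    (\<forall>y\<in>K. norm (\<Gamma> c x v w - \<Gamma> c y v w) \<le> C * norm (x - y) * norm v * norm w)"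
proof -
  have inI: "x \<in> img_chart c" if "x \<in> K" for x using K that by blast
  have bil: "bilinear (G c x)" if "x \<in> K" for x using metric_bilinear[OF c inI[OF that]] .
  obtain B where B: "B \<ge> 0" "\<And>x y v w. x \<in> K \<Longrightarrow> y \<in> K \<Longrightarrow> norm (G c x v w - G c y v w) \<le> B * norm (x - y) * norm v * norm w"
    using smooth_bilinear_family_Lipschitz[OF metric_smooth[OF c] bil chart_facts(2)[OF c] K] by blast
  obtain M where M: "M \<ge> 1" "\<And>x v. x \<in> K \<Longrightarrow> norm v \<le> M * sqrt (G c x v v)"
    using metric_coeff_comparable[OF c K] by blast
  have "\<exists>C\<ge>0. \<forall>x\<in>K. \<forall>z v. norm (koszul c x z v b) \<le> C * norm z * norm v \<and>
      (\<forall>y\<in>K. norm (koszul c x z v b - koszul c y z v b) \<le> C * norm (x - y) * norm z * norm v)" for b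
  proof (rule smooth_bilinear_family_Lipschitz[OF _ _ chart_facts(2)[OF c] K])
    fix z v
    have "smooth_on (img_chart c) (\<lambda>x. (1/2) * ((dG c x z v b + dG c x v z b) - dG c x b z v))"
      by (intro smooth_on_bounded_linear[OF bounded_linear_mult_right] smooth_on_diff smooth_on_add dG_smooth c fat_open chart_facts)
    then show "smooth_on (img_chart c) (\<lambda>x. koszul c x z v b)" by (simp add: koszul_def)
  next
    fix x assume "x \<in> K"
    then show "bilinear (\<lambda>z v. koszul c x z v b)" using koszul_linear[OF c inI] by (auto simp: bilinear_def)
  qed
  then obtain Q where Q: "\<And>b. Q b \<ge> 0" "\<And>b x z v. x \<in> K \<Longrightarrow> norm (koszul c x z v b) \<le> Q b * norm z * norm v"
    "\<And>b x y z v. x \<in> K \<Longrightarrow> y \<in> K \<Longrightarrow> norm (koszul c x z v b - koszul c y z v b) \<le> Q b * norm (x - y) * norm z * norm v"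
    by metis
  define S where "S = (\<Sum>b\<in>Basis. Q b)"
  have S0: "S \<ge> 0" unfolding S_def by (rule sum_nonneg) (use Q in auto)
  have k1: "\<bar>koszul c x z v w\<bar> \<le> S * norm z * norm v * norm w" if "x \<in> K" for x z v w
    using norm_linear_le_Basis[of "koszul c x z v" "\<lambda>b. Q b * norm z * norm v" w] koszul_linear(3)[OF c inI[OF that]] Q(2)[OF that]
    by (simp add: S_def sum_distrib_right)
  have k2: "\<bar>koszul c x z v w - koszul c y z v w\<bar> \<le> S * norm (x - y) * norm z * norm v * norm w" if "x \<in> K" "y \<in> K" for x y z v w
    using norm_linear_le_Basis[of "\<lambda>w. koszul c x z v w - koszul c y z v w" "\<lambda>b. Q b * norm (x - y) * norm z * norm v" w]
      linear_compose_sub[OF koszul_linear(3)[OF c inI[OF that(1)]] koszul_linear(3)[OF c inI[OF that(2)]]] Q(3)[OF that]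
    by (simp add: S_def sum_distrib_right)
  have lc: "G c x (\<Gamma> c x z v) w = koszul c x z v w" if "x \<in> K" for x z v w
    by (rule levi_civita_koszul[OF c inI[OF that] christoffel_levi_civita[OF c inI[OF that]]])
  have root: "norm u \<le> M\<^sup>2 * E" if x: "x \<in> K" and E: "G c x u u \<le> E * norm u" "E \<ge> 0" for x u E
  proof (cases "u = 0")
    case False
    have "G c x u u > 0" using metric_pos[OF c inI[OF x] False] .
    then have "(norm u)\<^sup>2 \<le> (M * sqrt (G c x u u))\<^sup>2" using M(2)[OF x, of u] by (intro power_mono) auto
    also have "\<dots> = M\<^sup>2 * G c x u u" using \<open>G c x u u > 0\<close> by (simp add: power_mult_distrib)
    also have "\<dots> \<le> M\<^sup>2 * (E * norm u)" using E by (intro mult_left_mono) auto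
    finally have "norm u * norm u \<le> (M\<^sup>2 * E) * norm u" by (simp add: power2_eq_square mult.assoc)
    then show ?thesis using False by (meson mult_right_le_imp_le zero_less_norm_iff)
  qed (use E in simp)
  have bound: "norm (\<Gamma> c x z v) \<le> M\<^sup>2 * S * norm z * norm v" if x: "x \<in> K" for x z v
    using root[OF x, of "\<Gamma> c x z v" "S * norm z * norm v"] k1[OF x, of z v "\<Gamma> c x z v"] S0
    by (simp add: lc[OF x] mult.assoc abs_le_iff)
  have lip: "norm (\<Gamma> c x z v - \<Gamma> c y z v) \<le> M\<^sup>2 * (S + B * (M\<^sup>2 * S)) * norm (x - y) * norm z * norm v"
    if x: "x \<in> K" and y: "y \<in> K" for x y z v
  proof -
    let ?u = "\<Gamma> c x z v - \<Gamma> c y z v"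
    have "G c x ?u ?u = koszul c x z v ?u - G c x (\<Gamma> c y z v) ?u"
      by (simp add: bilinear_lsub[OF bil[OF x]] lc[OF x])
    also have "\<dots> = (koszul c x z v ?u - koszul c y z v ?u) + (G c y (\<Gamma> c y z v) ?u - G c x (\<Gamma> c y z v) ?u)"
      by (simp add: lc[OF y])
    also have "\<dots> \<le> S * norm (x - y) * norm z * norm v * norm ?u + B * norm (x - y) * norm (\<Gamma> c y z v) * norm ?u"
      using k2[OF x y, of z v ?u] B(2)[OF y x, of "\<Gamma> c y z v" ?u] by (intro add_mono) (auto simp: norm_minus_commute)
    also have "\<dots> \<le> S * norm (x - y) * norm z * norm v * norm ?u + B * norm (x - y) * (M\<^sup>2 * S * norm z * norm v) * norm ?u"
      using bound[OF y, of z v] B(1) by (intro add_left_mono mult_right_mono mult_left_mono) auto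
    also have "\<dots> = ((S + B * (M\<^sup>2 * S)) * norm (x - y) * norm z * norm v) * norm ?u"
      by (simp add: algebra_simps)
    finally have "G c x ?u ?u \<le> ((S + B * (M\<^sup>2 * S)) * norm (x - y) * norm z * norm v) * norm ?u" .
    then have "norm ?u \<le> M\<^sup>2 * ((S + B * (M\<^sup>2 * S)) * norm (x - y) * norm z * norm v)"
      by (rule root[OF x]) (use S0 B in auto)
    then show ?thesis by (simp add: mult.assoc)
  qed
  define C where "C = M\<^sup>2 * S + M\<^sup>2 * (S + B * (M\<^sup>2 * S))"
  have C: "M\<^sup>2 * S \<le> C" "M\<^sup>2 * (S + B * (M\<^sup>2 * S)) \<le> C" "0 \<le> C" using S0 B by (auto simp: C_def)
  have "norm (\<Gamma> c x z v) \<le> C * norm z * norm v" if "x \<in> K" for x z v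
    by (rule order_trans[OF bound[OF that]]) (intro mult_right_mono C norm_ge_zero)
  moreover have "norm (\<Gamma> c x z v - \<Gamma> c y z v) \<le> C * norm (x - y) * norm z * norm v" if "x \<in> K" "y \<in> K" for x y z v
    by (rule order_trans[OF lip[OF that]]) (intro mult_right_mono C norm_ge_zero)
  ultimately show ?thesis using C(3) by blast
qed

end

section \<open>Smooth functions and maps\<close>

definition smooth_function :: "('m::topological_space, 'e::euclidean_space) chart set \<Rightarrow> ('m \<Rightarrow> real) \<Rightarrow> bool" where
  "smooth_function A f \<longleftrightarrow> (\<forall>c\<in>A. smooth_on (img_chart c) (\<lambda>x. f (inv_chart c x)))"

text \<open>Finitely many monotone conditions on a constant can be met simultaneously. All constants of the
  geometry are made uniform over a finite cover in this way.\<close>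

lemma finite_uniform_bound:
  fixes P :: "'i \<Rightarrow> real \<Rightarrow> bool"
  assumes "finite I" "\<And>i. i \<in> I \<Longrightarrow> \<exists>C. P i C" "\<And>i C C'. i \<in> I \<Longrightarrow> P i C \<Longrightarrow> C \<le> C' \<Longrightarrow> P i C'"
  shows "\<exists>C\<ge>1. \<forall>i\<in>I. P i C"
  using assms
proof (induction I rule: finite_induct)
  case (insert i I)
  have "\<exists>C\<ge>1. \<forall>i\<in>I. P i C"
  proof (rule insert.IH)
    show "\<exists>C. P j C" if "j \<in> I" for j using insert.prems(1)[of j] that by blast
    show "P j C'" if "j \<in> I" "P j C" "C \<le> C'" for j C C' using insert.prems(2)[of j C C'] that by blast
  qed
  then obtain C where C: "C \<ge> 1" "\<forall>i\<in>I. P i C" by blast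
  obtain C' where C': "P i C'" using insert.prems(1)[of i] by blast
  have "P j (max C C')" if "j \<in> insert i I" for j
    using that C C' insert.prems(2)[of j C "max C C'"] insert.prems(2)[of j C' "max C C'"] by auto
  then show ?case using C(1) by (intro exI[of _ "max C C'"]) auto
qed auto

context closed_riemannian
begin

text \<open>Concentric balls of radii up to four times the one used for covering fit into the charts. The
  intermediate radii leave room for two kinds of cutoff functions and for nearby points.\<close>

lemma finite_ball_cover:
  "\<exists>(I :: 'm set) ch ctr rad. finite I \<and> (\<forall>i\<in>I. ch i \<in> A \<and> rad i > 0 \<and> cball (ctr i) (4 * rad i) \<subseteq> img_chart (ch i)) \<and>
     (\<forall>p. \<exists>i\<in>I. p \<in> dom_chart (ch i) \<and> dist (ctr i) (app_chart (ch i) p) < rad i)"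
proof -
  obtain ch where ch: "\<And>p. ch p \<in> A" "\<And>p. p \<in> dom_chart (ch p)" using charts_cover by metis
  have "\<exists>r>0. cball (app_chart (ch p) p) (4 * r) \<subseteq> img_chart (ch p)" for p
  proof -
    obtain r where "r > 0" "cball (app_chart (ch p) p) r \<subseteq> img_chart (ch p)"
      using open_contains_cball chart_facts(2)[OF ch(1)] app_in_img[OF ch(2)] by metis
    then show ?thesis by (intro exI[of _ "r / 4"]) auto
  qed
  then obtain rad where rad: "\<And>p. rad p > 0" "\<And>p. cball (app_chart (ch p) p) (4 * rad p) \<subseteq> img_chart (ch p)" by metis
  define U where "U = (\<lambda>i. {p \<in> dom_chart (ch i). dist (app_chart (ch i) i) (app_chart (ch i) p) < rad i})"
  have "open (U i)" for i
  proof -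
    have "U i = dom_chart (ch i) \<inter> app_chart (ch i) -` ball (app_chart (ch i) i) (rad i)" by (auto simp: U_def)
    then show ?thesis
      using continuous_open_preimage[OF app_continuous[OF ch(1)[of i]] chart_facts(1)[OF ch(1)[of i]] open_ball] by simp
  qed
  moreover have "UNIV \<subseteq> (\<Union>i\<in>UNIV. U i)" using ch rad by (force simp: U_def)
  ultimately obtain I where "finite I" "UNIV \<subseteq> (\<Union>i\<in>I. U i)"
    by (metis compactE_image[OF compact_UNIV, of UNIV U])
  then show ?thesis
    using ch rad by (intro exI[of _ I] exI[of _ ch] exI[of _ "\<lambda>i. app_chart (ch i) i"] exI[of _ rad]) (auto simp: U_def)
qed

lemma smooth_function_along:
  fixes u :: "'a::euclidean_space \<Rightarrow> 'm"
  assumes f: "smooth_function A f" and u: "smooth_map A S u" and S: "fat S"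
  shows "smooth_on S (\<lambda>z. f (u z))"
proof (rule smooth_on_local)
  fix z assume z: "z \<in> S"
  obtain c where c: "c \<in> A" "u z \<in> dom_chart c" using charts_cover by blast
  have "openin (top_of_set S) (S \<inter> u -` dom_chart c)"
    using u chart_facts(1)[OF c(1)] by (intro continuous_openin_preimage_gen) (auto simp: smooth_map_def)
  then obtain U where U: "open U" "S \<inter> u -` dom_chart c = S \<inter> U" by (auto simp: openin_open)
  have "smooth_on (S \<inter> U) (\<lambda>z. f (inv_chart c (app_chart c (u z))))"
  proof (rule smooth_on_compose[OF fat_Int_open[OF S U(1)], where f="\<lambda>z. app_chart c (u z)" and g="\<lambda>x. f (inv_chart c x)"])
    have "smooth_on (S \<inter> u -` dom_chart c) (app_chart c \<circ> u)" using u c by (simp add: smooth_map_def)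
    then show "smooth_on (S \<inter> U) (\<lambda>z. app_chart c (u z))" unfolding U(2) comp_def .
    show "smooth_on (img_chart c) (\<lambda>x. f (inv_chart c x))" using f c by (simp add: smooth_function_def)
    show "(\<lambda>z. app_chart c (u z)) ` (S \<inter> U) \<subseteq> img_chart c"
      unfolding U(2)[symmetric] by (auto simp: app_in_img)
  qed
  moreover have inv: "inv_chart c (app_chart c (u z)) = u z" if "z \<in> S \<inter> U" for z
    using that c inv_app unfolding U(2)[symmetric] by blast
  have "smooth_on (S \<inter> U) (\<lambda>z. f (inv_chart c (app_chart c (u z)))) \<longleftrightarrow> smooth_on (S \<inter> U) (\<lambda>z. f (u z))"
    by (rule smooth_on_cong) (simp add: inv)
  ultimately have "smooth_on (S \<inter> U) (\<lambda>z. f (u z))" by blast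
  then show "\<exists>U. open U \<and> z \<in> U \<and> smooth_on (S \<inter> U) (\<lambda>z. f (u z))" using U z c by blast
qed

lemma smooth_map_local:
  assumes "\<And>z. z \<in> S \<Longrightarrow> \<exists>U. open U \<and> z \<in> U \<and> smooth_map A (S \<inter> U) f"
  shows "smooth_map A S f"
  unfolding smooth_map_def
proof (intro conjI ballI)
  show "continuous_on S f"
    unfolding continuous_on_eq_continuous_within
  proof
    fix z assume z: "z \<in> S"
    obtain U where U: "open U" "z \<in> U" "continuous_on (S \<inter> U) f" using assms[OF z] by (auto simp: smooth_map_def)
    then have "continuous (at z within S \<inter> U) f" using z by (simp add: continuous_on_eq_continuous_within)
    then show "continuous (at z within S) f" using U at_within_Int_open_eq by metis
  qed
  fix c assume c: "c \<in> A"
  show "smooth_on (S \<inter> f -` dom_chart c) (app_chart c \<circ> f)"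
  proof (rule smooth_on_local)
    fix z assume "z \<in> S \<inter> f -` dom_chart c"
    then obtain U where U: "open U" "z \<in> U" "smooth_on (S \<inter> U \<inter> f -` dom_chart c) (app_chart c \<circ> f)"
      using assms[of z] c by (auto simp: smooth_map_def)
    then show "\<exists>U. open U \<and> z \<in> U \<and> smooth_on (S \<inter> f -` dom_chart c \<inter> U) (app_chart c \<circ> f)"
      by (metis Int_assoc Int_commute)
  qed
qed

lemma smooth_map_cong: "(\<And>z. z \<in> S \<Longrightarrow> f z = h z) \<Longrightarrow> smooth_map A S f \<Longrightarrow> smooth_map A S h"
proof -
  assume eq: "\<And>z. z \<in> S \<Longrightarrow> f z = h z" and f: "smooth_map A S f"
  have "S \<inter> h -` dom_chart c = S \<inter> f -` dom_chart c" for c using eq by auto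
  moreover have "smooth_on (S \<inter> f -` dom_chart c) (app_chart c \<circ> f) \<longleftrightarrow> smooth_on (S \<inter> f -` dom_chart c) (app_chart c \<circ> h)" for c
    by (rule smooth_on_cong) (simp add: eq)
  ultimately show ?thesis using f eq unfolding smooth_map_def by (metis continuous_on_cong)
qed

lemma preimage_open:
  assumes "continuous_on S (u :: 'a::euclidean_space \<Rightarrow> 'm)" "open S" "open T" shows "open (S \<inter> u -` T)"
  using continuous_open_preimage[OF assms] .

lemma smooth_map_inv_chart:
  fixes q :: "'a::euclidean_space \<Rightarrow> 'e"
  assumes c: "c \<in> A" and q: "smooth_on S q" "q ` S \<subseteq> img_chart c" and S: "open S"
  shows "smooth_map A S (\<lambda>z. inv_chart c (q z))"
  unfolding smooth_map_def
proof (intro conjI ballI)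
  show cont: "continuous_on S (\<lambda>z. inv_chart c (q z))"
    by (rule continuous_on_compose2[OF inv_continuous[OF c] smooth_on_imp_continuous_on[OF q(1)] q(2)])
  fix c' assume c': "c' \<in> A"
  let ?S = "S \<inter> (\<lambda>z. inv_chart c (q z)) -` dom_chart c'"
  have o: "open ((\<lambda>z. inv_chart c (q z)) -` dom_chart c' \<inter> S)"
    using preimage_open[OF cont S chart_facts(1)[OF c']] by (simp add: Int_commute)
  have "smooth_on (S \<inter> ((\<lambda>z. inv_chart c (q z)) -` dom_chart c' \<inter> S)) q" by (rule smooth_on_Int_open[OF q(1) o])
  then have "smooth_on ?S q" by (simp add: Int_commute Int_assoc[symmetric])
  moreover have "q ` ?S \<subseteq> overlap c c'"
  proof
    fix x assume "x \<in> q ` ?S"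
    then obtain z where z: "z \<in> ?S" "x = q z" by blast
    then have "x \<in> img_chart c" "inv_chart c x \<in> dom_chart c'" using q by auto
    then show "x \<in> overlap c c'" using c app_inv inv_in_dom overlapI by metis
  qed
  ultimately have "smooth_on ?S (\<lambda>z. transition c c' (q z))"
    using o by (intro smooth_on_compose[OF _ _ transition_smooth[OF c c']] fat_open) (auto simp: Int_commute)
  then show "smooth_on ?S (app_chart c' \<circ> (\<lambda>z. inv_chart c (q z)))" by (simp add: transition_def o_def)
qed

lemma smooth_map_compose:
  fixes q :: "'a::euclidean_space \<Rightarrow> 'b::euclidean_space"
  assumes f: "smooth_map A S f" and q: "smooth_on UNIV q" "range q \<subseteq> S"
  shows "smooth_map A UNIV (\<lambda>z. f (q z))"
  unfolding smooth_map_def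
proof (intro conjI ballI)
  show cont: "continuous_on UNIV (\<lambda>z. f (q z))"
    using f by (intro continuous_on_compose2[OF _ smooth_on_imp_continuous_on[OF q(1)] q(2)]) (simp add: smooth_map_def)
  fix c assume c: "c \<in> A"
  let ?U = "UNIV \<inter> (\<lambda>z. f (q z)) -` dom_chart c"
  have U: "open ?U" by (rule preimage_open[OF cont open_UNIV chart_facts(1)[OF c]])
  have "smooth_on (UNIV \<inter> ?U) q" by (rule smooth_on_Int_open[OF q(1) U])
  then have qU: "smooth_on ?U q" by simp
  have "smooth_on (S \<inter> f -` dom_chart c) (app_chart c \<circ> f)" using f c by (simp add: smooth_map_def)
  then have "smooth_on ?U (\<lambda>z. (app_chart c \<circ> f) (q z))"
    by (rule smooth_on_compose[OF fat_open[OF U] qU]) (use q(2) in auto)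
  then show "smooth_on ?U (app_chart c \<circ> (\<lambda>z. f (q z)))" by (simp add: o_def)
qed

lemma smooth_map_slices:
  assumes u: "smooth_map A (T \<times> UNIV) (\<lambda>(s, t). u (s::real) (t::real))"
  shows "s \<in> T \<Longrightarrow> smooth_map A UNIV (u s)" and "T = UNIV \<Longrightarrow> smooth_map A UNIV (\<lambda>s. u s t)"
proof -
  have S: "fat (UNIV :: real set)" by (rule fat_open) auto
  note q = smooth_on_pair[OF S smooth_on_const[OF S] smooth_on_ident[OF S]]
    smooth_on_pair[OF S smooth_on_ident[OF S] smooth_on_const[OF S]]
  show "s \<in> T \<Longrightarrow> smooth_map A UNIV (u s)" using smooth_map_compose[OF u q(1), of s] by auto
  show "T = UNIV \<Longrightarrow> smooth_map A UNIV (\<lambda>s. u s t)" using smooth_map_compose[OF u q(2), of t] by auto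
qed

lemma smooth_map_snd:
  assumes "smooth_map A UNIV x" shows "smooth_map A UNIV (\<lambda>z::real \<times> real. x (snd z))"
  using smooth_map_compose[OF assms smooth_on_bounded_linear[OF bounded_linear_snd fat_open smooth_on_ident[OF fat_open]]] by auto

lemma loop_of_cylinder:
  assumes "smooth_cylinder A T u" "s \<in> T" shows "u s \<in> loop_space A"
  using assms smooth_map_slices(1)[of T u s] by (simp add: smooth_cylinder_def loop_space_def)

end

section \<open>An embedding from a finite cover by balls\<close>

text \<open>\<open>I\<close> is the finite set of centres, used only as an index set; the coordinates of the centre are \<open>ctr\<close>.\<close>

locale ball_cover = closed_riemannian A g
  for A :: "('m::t2_space, 'e::euclidean_space) chart set" and g :: "('m, 'e) metric" +
  fixes I :: "'m set" and ch :: "'m \<Rightarrow> ('m, 'e) chart" and ctr :: "'m \<Rightarrow> 'e" and rad :: "'m \<Rightarrow> real"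
  assumes finite_I: "finite I"
    and ch: "\<And>i. i \<in> I \<Longrightarrow> ch i \<in> A" and rad: "\<And>i. i \<in> I \<Longrightarrow> rad i > 0"
    and balls: "\<And>i. i \<in> I \<Longrightarrow> cball (ctr i) (4 * rad i) \<subseteq> img_chart (ch i)"
    and cover: "\<And>p. \<exists>i\<in>I. p \<in> dom_chart (ch i) \<and> dist (ctr i) (app_chart (ch i) p) < rad i"
begin

abbreviation \<phi> :: "'m \<Rightarrow> 'm \<Rightarrow> 'e" where "\<phi> i \<equiv> app_chart (ch i)"

definition cball_region :: "'m \<Rightarrow> real \<Rightarrow> 'm set" where
  "cball_region i k = {p \<in> dom_chart (ch i). dist (ctr i) (\<phi> i p) \<le> k * rad i}"

definition ball_region :: "'m \<Rightarrow> real \<Rightarrow> 'm set" where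
  "ball_region i k = {p \<in> dom_chart (ch i). dist (ctr i) (\<phi> i p) < k * rad i}"

text \<open>Equal to one for \<open>dist (ctr i) x \<le> k * rad i\<close> and to zero beyond \<open>(k + 1) * rad i\<close>. The cutoffs with
  \<open>k = 3\<close> define the embedding, those with \<open>k = 1\<close> localise the deformation of loops.\<close>

definition bump :: "nat \<Rightarrow> 'm \<Rightarrow> 'e \<Rightarrow> real" where
  "bump k i x = smooth_step (((real k + 1)\<^sup>2 * (rad i)\<^sup>2 - (x - ctr i) \<bullet> (x - ctr i)) / ((2 * real k + 1) * (rad i)\<^sup>2))"

definition cut :: "nat \<Rightarrow> 'm \<Rightarrow> 'm \<Rightarrow> real" where
  "cut k i p = (if p \<in> dom_chart (ch i) then bump k i (\<phi> i p) else 0)"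

lemma region_cover: "\<exists>i\<in>I. p \<in> ball_region i 1"
  using cover by (auto simp: ball_region_def)

lemma cball_region_closed:
  assumes i: "i \<in> I" and k: "k \<le> 4" shows "closed (cball_region i k)"
proof -
  have sub: "cball (ctr i) (k * rad i) \<subseteq> img_chart (ch i)"
    using balls[OF i] mult_right_mono[OF k less_imp_le[OF rad[OF i]]] by (meson order_trans subset_cball)
  have "cball_region i k = inv_chart (ch i) ` cball (ctr i) (k * rad i)"
  proof (intro equalityI subsetI)
    fix p assume "p \<in> cball_region i k"
    then show "p \<in> inv_chart (ch i) ` cball (ctr i) (k * rad i)"
      using inv_app[OF ch[OF i]] by (intro image_eqI[of _ _ "\<phi> i p"]) (auto simp: cball_region_def)
  next
    fix p assume "p \<in> inv_chart (ch i) ` cball (ctr i) (k * rad i)"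
    then show "p \<in> cball_region i k"
      using sub app_inv[OF ch[OF i]] inv_in_dom[OF ch[OF i]] by (auto simp: cball_region_def subset_iff)
  qed
  then show ?thesis
    using compact_continuous_image[OF continuous_on_subset[OF inv_continuous[OF ch[OF i]] sub]] compact_imp_closed by auto
qed

lemma ball_region_open:
  assumes i: "i \<in> I" shows "open (ball_region i k)"
proof -
  have "ball_region i k = dom_chart (ch i) \<inter> \<phi> i -` ball (ctr i) (k * rad i)" by (auto simp: ball_region_def)
  then show ?thesis
    using continuous_open_preimage[OF app_continuous[OF ch[OF i]] chart_facts(1)[OF ch[OF i]] open_ball] by simp
qed

lemma bump_one: "i \<in> I \<Longrightarrow> dist (ctr i) x \<le> real k * rad i \<Longrightarrow> bump k i x = 1"
  unfolding bump_def
proof (rule smooth_step_simps(2))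
  assume i: "i \<in> I" and d: "dist (ctr i) x \<le> real k * rad i"
  have "(x - ctr i) \<bullet> (x - ctr i) \<le> (real k * rad i)\<^sup>2"
    using power_mono[OF d, of 2] by (simp add: dist_norm norm_minus_commute power2_norm_eq_inner[symmetric])
  then show "1 \<le> ((real k + 1)\<^sup>2 * (rad i)\<^sup>2 - (x - ctr i) \<bullet> (x - ctr i)) / ((2 * real k + 1) * (rad i)\<^sup>2)"
    by (subst pos_le_divide_eq[OF mult_pos_pos[OF add_nonneg_pos zero_less_power[OF rad[OF i]]]])
      (auto simp: power2_eq_square algebra_simps)
qed

lemma bump_zero: "i \<in> I \<Longrightarrow> dist (ctr i) x \<ge> (real k + 1) * rad i \<Longrightarrow> bump k i x = 0"
  unfolding bump_def
proof (rule smooth_step_simps(1))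
  assume i: "i \<in> I" and d: "dist (ctr i) x \<ge> (real k + 1) * rad i"
  have "(x - ctr i) \<bullet> (x - ctr i) \<ge> ((real k + 1) * rad i)\<^sup>2"
    using power_mono[OF d, of 2] rad[OF i] by (simp add: dist_norm norm_minus_commute power2_norm_eq_inner[symmetric])
  then show "((real k + 1)\<^sup>2 * (rad i)\<^sup>2 - (x - ctr i) \<bullet> (x - ctr i)) / ((2 * real k + 1) * (rad i)\<^sup>2) \<le> 0"
    using rad[OF i] by (intro divide_nonpos_nonneg) (auto simp: power_mult_distrib)
qed

lemma bump_smooth: "smooth_on UNIV (bump k i)"
proof -
  have S: "fat (UNIV :: 'e set)" by (rule fat_open) auto
  have id: "smooth_on UNIV (\<lambda>x. x - ctr i)" by (intro smooth_on_diff smooth_on_ident smooth_on_const S)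
  have "smooth_on UNIV (\<lambda>x. ((real k + 1)\<^sup>2 * (rad i)\<^sup>2 - (x - ctr i) \<bullet> (x - ctr i)) * inverse ((2 * real k + 1) * (rad i)\<^sup>2))"
    by (intro smooth_on_bounded_linear[OF bounded_linear_mult_left] smooth_on_diff smooth_on_const S
        smooth_on_bounded_bilinear[OF bounded_bilinear_inner] id)
  then show ?thesis
    unfolding bump_def[abs_def] divide_inverse
    by (rule smooth_on_compose[OF S _ smooth_on_smooth_step]) auto
qed

lemma cut_bounds: "0 \<le> cut k i p" "cut k i p \<le> 1"
  by (auto simp: cut_def bump_def smooth_step_bounds)

lemma cut_one: "i \<in> I \<Longrightarrow> p \<in> cball_region i (real k) \<Longrightarrow> cut k i p = 1"
  by (simp add: cut_def cball_region_def bump_one)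

lemma cut_zero: "i \<in> I \<Longrightarrow> p \<notin> ball_region i (real k + 1) \<Longrightarrow> cut k i p = 0"
  by (auto simp: cut_def ball_region_def bump_zero)

text \<open>Near points outside the chart domain the function vanishes, since the support of the cutoff is the
  preimage of a closed ball: compact in a Hausdorff space, hence closed.\<close>

lemma cut_smooth:
  assumes i: "i \<in> I" and k: "k \<le> 3" and h: "smooth_on UNIV h"
  shows "smooth_function A (\<lambda>p. cut k i p * h (\<phi> i p))"
  unfolding smooth_function_def
proof
  fix c assume c: "c \<in> A"
  show "smooth_on (img_chart c) (\<lambda>x. cut k i (inv_chart c x) * h (\<phi> i (inv_chart c x)))"
  proof (rule smooth_on_local)
    fix x assume x: "x \<in> img_chart c"
    show "\<exists>U. open U \<and> x \<in> U \<and> smooth_on (img_chart c \<inter> U) (\<lambda>x. cut k i (inv_chart c x) * h (\<phi> i (inv_chart c x)))"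
    proof (cases "inv_chart c x \<in> dom_chart (ch i)")
      case True
      let ?U = "overlap c (ch i)"
      have o: "open ?U" by (rule overlap_open[OF c ch[OF i]])
      have xU: "x \<in> ?U" using overlapI[OF inv_in_dom[OF c x] True] app_inv[OF c x] by simp
      have "smooth_on ?U (\<lambda>x. bump k i (transition c (ch i) x) * h (transition c (ch i) x))"
        by (intro smooth_on_bounded_bilinear[OF bounded_bilinear_mult fat_open[OF o]]
            smooth_on_compose[OF fat_open[OF o] transition_smooth[OF c ch[OF i]] bump_smooth]
            smooth_on_compose[OF fat_open[OF o] transition_smooth[OF c ch[OF i]] h]) auto
      moreover have "bump k i (transition c (ch i) x) * h (transition c (ch i) x) = cut k i (inv_chart c x) * h (\<phi> i (inv_chart c x))"
        if x': "x \<in> ?U" for x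
      proof -
        obtain p where "p \<in> dom_chart c" "p \<in> dom_chart (ch i)" "x = app_chart c p" using overlapE[OF c x'] .
        then show ?thesis by (simp add: inv_app[OF c] transition_app[OF c] cut_def)
      qed
      ultimately have "smooth_on ?U (\<lambda>x. cut k i (inv_chart c x) * h (\<phi> i (inv_chart c x)))"
        by (subst (asm) smooth_on_cong) auto
      moreover have "img_chart c \<inter> ?U = ?U" by (auto simp: overlap_def img_chart_def)
      ultimately show ?thesis using o xU by (intro exI[of _ ?U]) simp
    next
      case False
      have o1: "open (img_chart c \<inter> inv_chart c -` (- cball_region i (real k + 1)))"
        by (rule continuous_open_preimage[OF inv_continuous[OF c] chart_facts(2)[OF c]])
          (use cball_region_closed[OF i, of "real k + 1"] k in \<open>auto simp: open_Compl\<close>)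
      have "x \<in> img_chart c \<inter> inv_chart c -` (- cball_region i (real k + 1))"
        using x False by (auto simp: cball_region_def)
      moreover have "smooth_on (img_chart c \<inter> (img_chart c \<inter> inv_chart c -` (- cball_region i (real k + 1))))
          (\<lambda>x. cut k i (inv_chart c x) * h (\<phi> i (inv_chart c x)))"
      proof (subst smooth_on_cong)
        fix x assume "x \<in> img_chart c \<inter> (img_chart c \<inter> inv_chart c -` (- cball_region i (real k + 1)))"
        then have "cut k i (inv_chart c x) = 0" by (intro cut_zero[OF i]) (auto simp: ball_region_def cball_region_def)
        then show "cut k i (inv_chart c x) * h (\<phi> i (inv_chart c x)) = 0" by simp
      next
        show "smooth_on (img_chart c \<inter> (img_chart c \<inter> inv_chart c -` (- cball_region i (real k + 1)))) (\<lambda>x. 0::real)"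
          by (rule smooth_on_const[OF fat_Int_open[OF fat_open[OF chart_facts(2)[OF c]] o1]])
      qed
      ultimately show ?thesis using o1 by blast
    qed
  qed
qed

text \<open>Whitney's embedding: for every ball the cutoff (index vector \<open>0\<close>) and the cutoff times each
  coordinate function (index vector in the basis). Taking scalar components makes all estimates
  statements about finitely many real functions.\<close>

definition J :: "('m \<times> 'e) set" where
  "J = I \<times> insert 0 Basis"

definition emb :: "'m \<times> 'e \<Rightarrow> 'm \<Rightarrow> real" where
  "emb j p = cut 3 (fst j) p * (if snd j = 0 then 1 else \<phi> (fst j) p \<bullet> snd j)"

text \<open>The distance in the ambient space of the embedding. It replaces the Riemannian distance.\<close>

definition D :: "'m \<Rightarrow> 'm \<Rightarrow> real" where
  "D p q = (\<Sum>j\<in>J. \<bar>emb j p - emb j q\<bar>)"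

lemma finite_J: "finite J" using finite_I by (simp add: J_def)

lemma emb_smooth:
  assumes "j \<in> J" shows "smooth_function A (emb j)"
proof -
  have S: "fat (UNIV :: 'e set)" by (rule fat_open) auto
  have "smooth_on UNIV (\<lambda>x. if snd j = 0 then 1 else x \<bullet> snd j :: real)"
    by (cases "snd j = 0")
      (auto intro!: smooth_on_const S smooth_on_bounded_linear[OF bounded_linear_inner_left] smooth_on_ident)
  from cut_smooth[OF _ _ this, of "fst j" 3] assms show ?thesis
    unfolding emb_def[abs_def] by (auto simp: J_def)
qed

lemma D_nonneg: "0 \<le> D p q" unfolding D_def by (rule sum_nonneg) auto

lemma D_self: "D p p = 0" by (simp add: D_def)

lemma D_ge: "j \<in> J \<Longrightarrow> \<bar>emb j p - emb j q\<bar> \<le> D p q"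
  unfolding D_def using member_le_sum[of j J "\<lambda>j. \<bar>emb j p - emb j q\<bar>"] finite_J by auto

lemma norm_emb_le:
  assumes i: "i \<in> I" shows "norm (cut 3 i p *\<^sub>R \<phi> i p - cut 3 i q *\<^sub>R \<phi> i q) \<le> D p q"
proof -
  have "norm (cut 3 i p *\<^sub>R \<phi> i p - cut 3 i q *\<^sub>R \<phi> i q) \<le> (\<Sum>b\<in>Basis. \<bar>(cut 3 i p *\<^sub>R \<phi> i p - cut 3 i q *\<^sub>R \<phi> i q) \<bullet> b\<bar>)"
    by (rule norm_le_l1)
  also have "\<dots> = (\<Sum>j\<in>Pair i ` Basis. \<bar>emb j p - emb j q\<bar>)"
    by (subst sum.reindex) (auto simp: inj_on_def emb_def inner_diff_left nonzero_Basis intro!: sum.cong)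
  also have "\<dots> \<le> D p q"
    unfolding D_def by (rule sum_mono2) (use finite_J i in \<open>auto simp: J_def\<close>)
  finally show ?thesis .
qed

text \<open>Chosen so that points at distance less than \<open>\<delta>\<close> have embedding coordinates so close that both lie in
  the same chart; see \<open>adjacent\<close>.\<close>

definition \<delta> :: real where
  "\<delta> = Min ((\<lambda>i. min (1/2) (rad i / (2 * (1 + norm (ctr i) + 4 * rad i)))) ` I)"

lemma I_nonempty: "I \<noteq> {}" using region_cover by blast

lemma \<delta>_pos: "0 < \<delta>"
  unfolding \<delta>_def using finite_I I_nonempty rad
  by (subst Min_gr_iff) (auto intro!: divide_pos_pos mult_pos_pos add_pos_nonneg simp: less_imp_le)

lemma \<delta>_le:
  assumes "i \<in> I" shows "\<delta> \<le> 1/2" "\<delta> * (1 + norm (ctr i) + 4 * rad i) \<le> rad i / 2"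
proof -
  have *: "\<delta> \<le> min (1/2) (rad i / (2 * (1 + norm (ctr i) + 4 * rad i)))"
    unfolding \<delta>_def using assms finite_I by (intro Min_le) auto
  then show "\<delta> \<le> 1/2" by simp
  have "1 + norm (ctr i) + 4 * rad i > 0" using rad[OF assms] by (simp add: add_pos_nonneg)
  with * show "\<delta> * (1 + norm (ctr i) + 4 * rad i) \<le> rad i / 2" by (simp add: field_simps)
qed

text \<open>If \<open>q\<close> is in the region where the cutoff is one and \<open>p\<close> is close to \<open>q\<close>, the cutoff of \<open>p\<close> is nonzero,
  so \<open>p\<close> has coordinates in the same chart. They differ little from those of \<open>q\<close>, hence the cutoff
  equals one at \<open>p\<close> as well and the embedding coordinates are the chart coordinates.\<close>

lemma adjacent:
  assumes i: "i \<in> I" and q: "q \<in> cball_region i (5/2)" and d: "D p q < \<delta>"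
  shows "p \<in> ball_region i 3" "norm (\<phi> i p - \<phi> i q) \<le> D p q"
proof -
  have r: "rad i > 0" by (rule rad[OF i])
  have cq: "cut 3 i q = 1" using q r by (intro cut_one[OF i]) (auto simp: cball_region_def)
  have "\<bar>emb (i, 0) p - emb (i, 0) q\<bar> < \<delta>" by (rule order.strict_trans1[OF D_ge d]) (use i in \<open>auto simp: J_def\<close>)
  then have cp: "\<bar>cut 3 i p - 1\<bar> < \<delta>" by (simp add: emb_def cq)
  then have "cut 3 i p \<noteq> 0" using \<delta>_le(1)[OF i] by auto
  then have p4: "p \<in> ball_region i 4" using cut_zero[OF i, of p 3] by auto
  have np: "norm (\<phi> i p) \<le> norm (ctr i) + 4 * rad i"
    using p4 norm_triangle_ineq2[of "\<phi> i p" "ctr i"] by (auto simp: ball_region_def dist_norm norm_minus_commute)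
  have "norm (\<phi> i p - \<phi> i q) = norm ((cut 3 i p *\<^sub>R \<phi> i p - cut 3 i q *\<^sub>R \<phi> i q) + (1 - cut 3 i p) *\<^sub>R \<phi> i p)"
    by (simp add: cq algebra_simps)
  also have "\<dots> \<le> D p q + \<bar>1 - cut 3 i p\<bar> * norm (\<phi> i p)"
    by (rule order_trans[OF norm_triangle_ineq]) (use norm_emb_le[OF i, of p q] in simp)
  also have "\<dots> < \<delta> + \<delta> * (norm (ctr i) + 4 * rad i)"
    using d cp np by (intro add_less_le_mono mult_mono) auto
  also have "\<dots> \<le> rad i / 2" using \<delta>_le(2)[OF i] by (simp add: algebra_simps)
  finally have close: "norm (\<phi> i p - \<phi> i q) < rad i / 2" .
  have "dist (ctr i) (\<phi> i p) \<le> dist (ctr i) (\<phi> i q) + dist (\<phi> i q) (\<phi> i p)" by (rule dist_triangle)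
  then show p3: "p \<in> ball_region i 3"
    using close q p4 by (auto simp: ball_region_def cball_region_def dist_norm norm_minus_commute)
  then have "cut 3 i p = 1" by (intro cut_one[OF i]) (auto simp: ball_region_def cball_region_def)
  then show "norm (\<phi> i p - \<phi> i q) \<le> D p q" using norm_emb_le[OF i, of p q] cq by simp
qed

lemma D_eq_0_imp_eq:
  assumes "D p q = 0" shows "p = q"
proof -
  obtain i where i: "i \<in> I" "q \<in> ball_region i 1" using region_cover by blast
  have q: "q \<in> cball_region i (5/2)" using i rad[OF i(1)] by (auto simp: ball_region_def cball_region_def)
  have "p \<in> dom_chart (ch i)" "\<phi> i p = \<phi> i q"
    using adjacent[OF i(1) q, of p] assms \<delta>_pos by (auto simp: ball_region_def)
  then show ?thesis using inv_app[OF ch[OF i(1)]] i(2) by (metis (no_types, lifting) ball_region_def mem_Collect_eq)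
qed

lemma cball3_sub: "i \<in> I \<Longrightarrow> cball (ctr i) (3 * rad i) \<subseteq> img_chart (ch i)"
  by (rule order_trans[OF subset_cball balls]) (use rad[of i] in auto)

text \<open>The converse of \<open>adjacent\<close>: chart distances control the embedding distance.\<close>

lemma D_Lipschitz:
  "\<exists>L\<ge>1. \<forall>i\<in>I. \<forall>x\<in>cball (ctr i) (3 * rad i). \<forall>y\<in>cball (ctr i) (3 * rad i).
     D (inv_chart (ch i) x) (inv_chart (ch i) y) \<le> L * norm (x - y)"
proof (rule finite_uniform_bound[OF finite_I])
  fix i assume i: "i \<in> I"
  let ?K = "cball (ctr i) (3 * rad i)"
  have "\<exists>C\<ge>1. \<forall>j\<in>J. \<forall>x\<in>?K. \<forall>y\<in>?K. \<bar>emb j (inv_chart (ch i) x) - emb j (inv_chart (ch i) y)\<bar> \<le> C * norm (x - y)"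
  proof (rule finite_uniform_bound[OF finite_J])
    fix j assume "j \<in> J"
    then have "smooth_on (img_chart (ch i)) (\<lambda>x. emb j (inv_chart (ch i) x))"
      using emb_smooth ch[OF i] by (auto simp: smooth_function_def)
    from smooth_on_bounded_Lipschitz[OF this chart_facts(2)[OF ch[OF i]] compact_cball convex_cball cball3_sub[OF i]]
    show "\<exists>C. \<forall>x\<in>?K. \<forall>y\<in>?K. \<bar>emb j (inv_chart (ch i) x) - emb j (inv_chart (ch i) y)\<bar> \<le> C * norm (x - y)" by auto
  qed (meson mult_right_mono norm_ge_zero order_trans)
  then obtain C where C: "\<And>j x y. j \<in> J \<Longrightarrow> x \<in> ?K \<Longrightarrow> y \<in> ?K \<Longrightarrow>
      \<bar>emb j (inv_chart (ch i) x) - emb j (inv_chart (ch i) y)\<bar> \<le> C * norm (x - y)" by blast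
  have "D (inv_chart (ch i) x) (inv_chart (ch i) y) \<le> (real (card J) * C) * norm (x - y)" if "x \<in> ?K" "y \<in> ?K" for x y
    unfolding D_def using sum_bounded_above[of J _ "C * norm (x - y)"] C that by (simp add: mult.assoc)
  then show "\<exists>L. \<forall>x\<in>?K. \<forall>y\<in>?K. D (inv_chart (ch i) x) (inv_chart (ch i) y) \<le> L * norm (x - y)" by blast
qed (meson mult_right_mono norm_ge_zero order_trans)

end

section \<open>Short paths between nearby loops\<close>

lemma smooth_step_derivative:
  "(smooth_step has_real_derivative frechet_derivative smooth_step (at r) 1) (at r)"
proof -
  have d: "(smooth_step has_derivative frechet_derivative smooth_step (at r)) (at r)"
    by (rule smooth_on_has_derivative_open[OF smooth_on_smooth_step]) auto
  have "frechet_derivative smooth_step (at r) v = frechet_derivative smooth_step (at r) 1 * v" for v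
    using linear_cmul[OF has_derivative_linear[OF d], of v 1] by (simp add: mult.commute)
  then have "frechet_derivative smooth_step (at r) = (*) (frechet_derivative smooth_step (at r) 1)" by (rule ext)
  with d show ?thesis by (simp add: has_field_derivative_def)
qed

lemma smooth_step_derivative_bounded:
  "\<exists>B\<ge>0. \<forall>r\<in>{0..1}. \<bar>frechet_derivative smooth_step (at r) 1\<bar> \<le> B"
proof -
  have "continuous_on {0..1} (\<lambda>r. frechet_derivative smooth_step (at r) 1)"
    using smooth_on_imp_continuous_on[OF smooth_on_derivative_open[OF smooth_on_smooth_step open_UNIV, of 1]]
    by (rule continuous_on_subset) auto
  then have "bounded ((\<lambda>r. frechet_derivative smooth_step (at r) 1) ` {0..1})"
    by (intro compact_imp_bounded compact_continuous_image) auto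
  then obtain B where "\<forall>r\<in>{0..1}. \<bar>frechet_derivative smooth_step (at r) 1\<bar> \<le> B" unfolding bounded_iff by auto
  then show ?thesis by (intro exI[of _ "max B 0"]) (auto simp: le_max_iff_disj)
qed

context closed_riemannian
begin

lemma smooth_map_Int_open:
  assumes f: "smooth_map A S f" and U: "open U" shows "smooth_map A (S \<inter> U) f"
  unfolding smooth_map_def
proof (intro conjI ballI)
  show "continuous_on (S \<inter> U) f" using f continuous_on_subset[of S f "S \<inter> U"] by (auto simp: smooth_map_def)
  fix c assume "c \<in> A"
  then have "smooth_on ((S \<inter> f -` dom_chart c) \<inter> U) (app_chart c \<circ> f)"
    using f by (intro smooth_on_Int_open[OF _ U]) (simp add: smooth_map_def)
  moreover have "(S \<inter> f -` dom_chart c) \<inter> U = S \<inter> U \<inter> f -` dom_chart c" by blast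
  ultimately show "smooth_on (S \<inter> U \<inter> f -` dom_chart c) (app_chart c \<circ> f)" by simp
qed

lemma smooth_curve:
  assumes "smooth_map A UNIV (\<gamma> :: real \<Rightarrow> 'm)"
  shows "continuous (at t) \<gamma>"
    and "c \<in> A \<Longrightarrow> \<gamma> t \<in> dom_chart c \<Longrightarrow> (\<lambda>r. app_chart c (\<gamma> r)) differentiable (at t)"
proof -
  have cont: "continuous_on UNIV \<gamma>" using assms by (simp add: smooth_map_def)
  then show "continuous (at t) \<gamma>" by (simp add: continuous_on_eq_continuous_at)
  assume c: "c \<in> A" "\<gamma> t \<in> dom_chart c"
  have "smooth_on (UNIV \<inter> \<gamma> -` dom_chart c) (app_chart c \<circ> \<gamma>)" using assms c by (simp add: smooth_map_def)
  from smooth_on_has_derivative_open[OF this preimage_open[OF cont open_UNIV chart_facts(1)[OF c(1)]], of t] c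
  show "(\<lambda>r. app_chart c (\<gamma> r)) differentiable (at t)" by (auto simp: o_def differentiable_def)
qed

lemma loop_smooth: "x \<in> loop_space A \<Longrightarrow> smooth_map A UNIV x"
  by (simp add: loop_space_def)

end

context ball_cover
begin

lemma emb_loop_continuous:
  assumes "x \<in> loop_space A" "j \<in> J" shows "continuous_on T (\<lambda>t. emb j (x t))"
  using smooth_on_imp_continuous_on[OF smooth_function_along[OF emb_smooth[OF assms(2)] loop_smooth[OF assms(1)] fat_open[OF open_UNIV]]]
  by (rule continuous_on_subset) auto

lemma D_loop_continuous:
  assumes "x \<in> loop_space A" "y \<in> loop_space A" shows "continuous_on T (\<lambda>t. D (x t) (y t))"
  unfolding D_def by (intro continuous_intros emb_loop_continuous assms)

text \<open>Fixed once for the whole cover, since the iteration below refers to its powers.\<close>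

definition L :: real where
  "L = (SOME L. L \<ge> 1 \<and> (\<forall>i\<in>I. \<forall>x\<in>cball (ctr i) (3 * rad i). \<forall>y\<in>cball (ctr i) (3 * rad i).
     D (inv_chart (ch i) x) (inv_chart (ch i) y) \<le> L * norm (x - y)))"

lemma L: "L \<ge> 1" "\<And>i x y. i \<in> I \<Longrightarrow> x \<in> cball (ctr i) (3 * rad i) \<Longrightarrow> y \<in> cball (ctr i) (3 * rad i) \<Longrightarrow>
     D (inv_chart (ch i) x) (inv_chart (ch i) y) \<le> L * norm (x - y)"
  using someI_ex[OF D_Lipschitz] unfolding L_def[symmetric] by auto

definition mid :: "'m \<Rightarrow> real \<Rightarrow> 'm \<Rightarrow> 'm \<Rightarrow> 'e" where
  "mid i \<rho> p q = \<phi> i p + (\<rho> * cut 1 i q) *\<^sub>R (\<phi> i q - \<phi> i p)"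

text \<open>Move \<open>p\<close> towards \<open>q\<close> along a segment in the chart of the ball \<open>i\<close>, for the fraction of the way given by
  \<open>\<rho>\<close> and a cutoff evaluated at \<open>q\<close>. Because the cutoff depends on the target, a point whose target is
  in the ball of radius one arrives, and a point that has arrived is not moved by later steps.\<close>

definition step :: "'m \<Rightarrow> real \<Rightarrow> 'm \<Rightarrow> 'm \<Rightarrow> 'm" where
  "step i \<rho> p q = (if cut 1 i q = 0 then p else inv_chart (ch i) (mid i \<rho> p q))"

lemma cut1_support:
  assumes "i \<in> I" "cut 1 i q \<noteq> 0" shows "q \<in> cball_region i (5/2)"
proof -
  have "q \<in> ball_region i (real 1 + 1)" using cut_zero[OF assms(1), of q 1] assms(2) by blast
  then show ?thesis using rad[OF assms(1)] by (auto simp: ball_region_def cball_region_def)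
qed

lemma step_in_chart:
  assumes i: "i \<in> I" and q: "q \<in> cball_region i (5/2)" and d: "D p q < \<delta>" and \<rho>: "\<rho> \<in> {0..1}"
  shows "mid i \<rho> p q \<in> cball (ctr i) (3 * rad i)" "step i \<rho> p q = inv_chart (ch i) (mid i \<rho> p q)"
    "norm (mid i \<rho> p q - \<phi> i q) \<le> D p q" "step i \<rho> p q \<in> dom_chart (ch i)" "\<phi> i (step i \<rho> p q) = mid i \<rho> p q"
proof -
  define \<sigma> where "\<sigma> = \<rho> * cut 1 i q"
  have \<sigma>: "0 \<le> \<sigma>" "\<sigma> \<le> 1" using \<rho> cut_bounds[of 1 i q] by (auto simp: \<sigma>_def mult_le_one)
  note adj = adjacent[OF i q d]
  have pq: "\<phi> i p \<in> cball (ctr i) (3 * rad i)" "\<phi> i q \<in> cball (ctr i) (3 * rad i)"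
    using adj(1) q rad[OF i] by (auto simp: ball_region_def cball_region_def)
  have m: "mid i \<rho> p q = (1 - \<sigma>) *\<^sub>R \<phi> i p + \<sigma> *\<^sub>R \<phi> i q" by (simp add: mid_def \<sigma>_def algebra_simps)
  show mem: "mid i \<rho> p q \<in> cball (ctr i) (3 * rad i)"
    unfolding m by (rule convexD[OF convex_cball pq]) (use \<sigma> in auto)
  have "mid i \<rho> p q - \<phi> i q = (1 - \<sigma>) *\<^sub>R (\<phi> i p - \<phi> i q)" unfolding m by (simp add: algebra_simps)
  then have "norm (mid i \<rho> p q - \<phi> i q) = (1 - \<sigma>) * norm (\<phi> i p - \<phi> i q)" using \<sigma> by simp
  also have "\<dots> \<le> 1 * D p q" using \<sigma> adj(2) by (intro mult_mono) auto
  finally show "norm (mid i \<rho> p q - \<phi> i q) \<le> D p q" by simp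
  show st: "step i \<rho> p q = inv_chart (ch i) (mid i \<rho> p q)"
    using adj(1) by (auto simp: step_def mid_def ball_region_def inv_app[OF ch[OF i]])
  have img: "mid i \<rho> p q \<in> img_chart (ch i)" using mem cball3_sub[OF i] by auto
  show "step i \<rho> p q \<in> dom_chart (ch i)" "\<phi> i (step i \<rho> p q) = mid i \<rho> p q"
    unfolding st using inv_in_dom[OF ch[OF i] img] app_inv[OF ch[OF i] img] by auto
qed

lemma step_trivial: "cut 1 i q = 0 \<Longrightarrow> step i \<rho> p q = p"
  by (simp add: step_def)

lemma step_D_le:
  assumes i: "i \<in> I" and d: "D p q < \<delta>" and \<rho>: "\<rho> \<in> {0..1}"
  shows "D (step i \<rho> p q) q \<le> L * D p q"
proof (cases "cut 1 i q = 0")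
  case True
  then show ?thesis using mult_right_mono[OF L(1) D_nonneg[of p q]] by (simp add: step_trivial)
next
  case False
  have q: "q \<in> cball_region i (5/2)" by (rule cut1_support[OF i False])
  note s = step_in_chart[OF i q d \<rho>]
  have qd: "q \<in> dom_chart (ch i)" "\<phi> i q \<in> cball (ctr i) (3 * rad i)"
    using q rad[OF i] by (auto simp: cball_region_def)
  have "D (step i \<rho> p q) q \<le> L * norm (mid i \<rho> p q - \<phi> i q)"
    using L(2)[OF i s(1) qd(2)] s(2) inv_app[OF ch[OF i] qd(1)] by simp
  also have "\<dots> \<le> L * D p q" using s(3) L(1) by (intro mult_left_mono) auto
  finally show ?thesis .
qed

lemma step_reaches:
  assumes i: "i \<in> I" and q: "q \<in> ball_region i 1" shows "step i 1 p q = q"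
proof -
  have "cut 1 i q = 1" using q by (intro cut_one[OF i]) (auto simp: ball_region_def cball_region_def)
  then show ?thesis using q inv_app[OF ch[OF i]] by (auto simp: step_def mid_def ball_region_def)
qed

lemma step_self:
  assumes i: "i \<in> I" shows "step i \<rho> q q = q"
  using cut1_support[OF i, of q] inv_app[OF ch[OF i], of q] by (auto simp: step_def mid_def cball_region_def)

lemma step_zero:
  assumes i: "i \<in> I" and d: "D p q < \<delta>" shows "step i 0 p q = p"
proof (cases "cut 1 i q = 0")
  case False
  note a = adjacent(1)[OF i cut1_support[OF i False] d]
  then show ?thesis using inv_app[OF ch[OF i], of p] by (auto simp: step_def mid_def ball_region_def)
qed (simp add: step_trivial)

text \<open>The smooth step function reparametrises the segment so that the path of loops is defined for all
  real parameters, with parameter values zero and one at its ends.\<close>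

definition bridge :: "'m \<Rightarrow> (real \<Rightarrow> 'm) \<Rightarrow> (real \<Rightarrow> 'm) \<Rightarrow> real \<Rightarrow> real \<Rightarrow> 'm" where
  "bridge i x y r t = step i (smooth_step r) (x t) (y t)"

text \<open>Where the target loop is in the larger ball, the construction happens within one chart and is a
  composition of smooth maps; outside the support of the cutoff nothing moves. These two regions are
  open and overlap.\<close>

lemma bridge_cylinder:
  assumes i: "i \<in> I" and x: "x \<in> loop_space A" and y: "y \<in> loop_space A" and d: "\<And>t. D (x t) (y t) < \<delta>"
  shows "smooth_cylinder A UNIV (bridge i x y)"
  unfolding smooth_cylinder_def
proof (intro conjI ballI allI)
  show "bridge i x y s (t + 1) = bridge i x y s t" for s t using x y by (simp add: bridge_def loop_space_def)
  have sx: "smooth_map A UNIV x" and sy: "smooth_map A UNIV y" using x y loop_smooth by auto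
  have cy: "continuous_on UNIV y" and cx: "continuous_on UNIV x" using sx sy by (auto simp: smooth_map_def)
  have "smooth_map A UNIV (\<lambda>z. bridge i x y (fst z) (snd z))"
  proof (rule smooth_map_local)
    fix z :: "real \<times> real"
    show "\<exists>U. open U \<and> z \<in> U \<and> smooth_map A (UNIV \<inter> U) (\<lambda>z. bridge i x y (fst z) (snd z))"
    \<comment> \<open>the radius \<open>5/2\<close> lies between that of the support of the cutoff, \<open>2\<close>, and that of the chart region, \<open>3\<close>\<close>
    proof (cases "y (snd z) \<in> ball_region i (5/2)")
      case True
      define V where "V = y -` ball_region i (5/2)"
      have V: "open V" unfolding V_def using preimage_open[OF cy open_UNIV ball_region_open[OF i]] by simp
      define U where "U = (UNIV :: real set) \<times> V"
      have U: "open U" "fat U" unfolding U_def by (auto intro!: open_Times V fat_open)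
      have yV: "y t \<in> cball_region i (5/2)" if "t \<in> V" for t
        using that by (auto simp: V_def ball_region_def cball_region_def)
      have yd: "y t \<in> dom_chart (ch i)" and xd: "x t \<in> dom_chart (ch i)" if "t \<in> V" for t
        using yV[OF that] adjacent(1)[OF i yV[OF that] d] by (auto simp: cball_region_def ball_region_def)
      have chart_smooth: "smooth_on V (\<lambda>t. \<phi> i (w t))" if w: "smooth_map A UNIV w" and wd: "\<And>t. t \<in> V \<Longrightarrow> w t \<in> dom_chart (ch i)" for w
      proof -
        have "smooth_on (UNIV \<inter> w -` dom_chart (ch i)) (\<phi> i \<circ> w)"
          using w ch[OF i] by (simp add: smooth_map_def)
        then have "smooth_on ((UNIV \<inter> w -` dom_chart (ch i)) \<inter> V) (\<phi> i \<circ> w)"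
          using V by (rule smooth_on_Int_open)
        moreover have "(UNIV \<inter> w -` dom_chart (ch i)) \<inter> V = V" using wd by auto
        ultimately show ?thesis by (simp add: comp_def)
      qed
      have fV: "fat V" by (rule fat_open[OF V])
      have sV: "smooth_on V (\<lambda>t. \<phi> i (x t))" "smooth_on V (\<lambda>t. \<phi> i (y t))"
        by (rule chart_smooth[OF sx xd], assumption) (rule chart_smooth[OF sy yd], assumption)
      have cutV: "smooth_on V (\<lambda>t. cut 1 i (y t))"
      proof -
        have "smooth_on V (\<lambda>t. bump 1 i (\<phi> i (y t)))"
          by (rule smooth_on_compose[OF fV sV(2) bump_smooth]) auto
        moreover have "smooth_on V (\<lambda>t. bump 1 i (\<phi> i (y t))) \<longleftrightarrow> smooth_on V (\<lambda>t. cut 1 i (y t))"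
          by (rule smooth_on_cong) (simp add: cut_def yd)
        ultimately show ?thesis by blast
      qed
      have lift: "smooth_on U (\<lambda>z. f (snd z))" if "smooth_on V f" for f :: "real \<Rightarrow> 'x::real_normed_vector"
        by (rule smooth_on_compose[OF U(2) smooth_on_bounded_linear[OF bounded_linear_snd U(2) smooth_on_ident[OF U(2)]] that])
          (auto simp: U_def)
      have rho: "smooth_on U (\<lambda>z. smooth_step (fst z))"
        by (rule smooth_on_compose[OF U(2) smooth_on_bounded_linear[OF bounded_linear_fst U(2) smooth_on_ident[OF U(2)]] smooth_on_smooth_step]) auto
      have "smooth_on U (\<lambda>z. mid i (smooth_step (fst z)) (x (snd z)) (y (snd z)))"
        unfolding mid_def
        by (intro smooth_on_add smooth_on_bounded_bilinear[OF bounded_bilinear_scaleR] smooth_on_bounded_bilinear[OF bounded_bilinear_mult]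
            smooth_on_diff U(2) rho lift[OF sV(1)] lift[OF sV(2)] lift[OF cutV])
      moreover have "(\<lambda>z. mid i (smooth_step (fst z)) (x (snd z)) (y (snd z))) ` U \<subseteq> img_chart (ch i)"
        using step_in_chart(1)[OF i yV d] smooth_step_bounds cball3_sub[OF i] by (fastforce simp: U_def)
      ultimately have "smooth_map A U (\<lambda>z. inv_chart (ch i) (mid i (smooth_step (fst z)) (x (snd z)) (y (snd z))))"
        by (rule smooth_map_inv_chart[OF ch[OF i] _ _ U(1)])
      then have "smooth_map A U (\<lambda>z. bridge i x y (fst z) (snd z))"
        by (rule smooth_map_cong[rotated])
          (use step_in_chart(2)[OF i yV d] smooth_step_bounds in \<open>auto simp: U_def bridge_def\<close>)
      then show ?thesis using U True by (intro exI[of _ U]) (auto simp: U_def V_def mem_Times_iff)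
    next
      case False
      define U where "U = (UNIV :: real set) \<times> (y -` (- cball_region i 2))"
      have "open (- cball_region i 2)" using cball_region_closed[OF i, of 2] by (simp add: open_Compl)
      then have U: "open U"
        unfolding U_def using preimage_open[OF cy open_UNIV] by (intro open_Times) auto
      have zU: "z \<in> U"
        using False rad[OF i] by (auto simp: U_def mem_Times_iff ball_region_def cball_region_def)
      have tr: "bridge i x y (fst z) (snd z) = x (snd z)" if "z \<in> U" for z
        unfolding bridge_def
        by (rule step_trivial, rule cut_zero[OF i]) (use that in \<open>auto simp: U_def ball_region_def cball_region_def\<close>)
      have "smooth_map A (UNIV \<inter> U) (\<lambda>z. x (snd z))"
        by (rule smooth_map_Int_open[OF smooth_map_snd[OF sx] U])
      then have "smooth_map A (UNIV \<inter> U) (\<lambda>z. bridge i x y (fst z) (snd z))"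
        by (rule smooth_map_cong[rotated]) (simp add: tr)
      then show ?thesis using U zU by blast
    qed
  qed
  then show "smooth_map A (UNIV \<times> UNIV) (\<lambda>(s, t). bridge i x y s t)" by (simp add: case_prod_beta')
qed

lemma tnorm_comparable:
  "\<exists>C\<ge>1. \<forall>i\<in>I. \<forall>p\<in>cball_region i 3. \<forall>\<xi>\<in>tangent_space A p.
     norm (\<xi> (ch i)) \<le> C * tnorm g p \<xi> \<and> tnorm g p \<xi> \<le> C * norm (\<xi> (ch i))"
proof -
  have "\<exists>C\<ge>1. \<forall>i\<in>I. \<forall>x\<in>cball (ctr i) (3 * rad i). \<forall>v.
      norm v \<le> C * sqrt (G (ch i) x v v) \<and> sqrt (G (ch i) x v v) \<le> C * norm v"
  proof (rule finite_uniform_bound[OF finite_I])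
    fix i assume i: "i \<in> I"
    show "\<exists>C. \<forall>x\<in>cball (ctr i) (3 * rad i). \<forall>v. norm v \<le> C * sqrt (G (ch i) x v v) \<and> sqrt (G (ch i) x v v) \<le> C * norm v"
      using metric_coeff_comparable[OF ch[OF i] compact_cball convex_cball cball3_sub[OF i]] by blast
    fix C C' :: real
    assume C: "\<forall>x\<in>cball (ctr i) (3 * rad i). \<forall>v. norm v \<le> C * sqrt (G (ch i) x v v) \<and> sqrt (G (ch i) x v v) \<le> C * norm v" "C \<le> C'"
    show "\<forall>x\<in>cball (ctr i) (3 * rad i). \<forall>v. norm v \<le> C' * sqrt (G (ch i) x v v) \<and> sqrt (G (ch i) x v v) \<le> C' * norm v"
    proof (intro ballI allI conjI)
      fix x v assume x: "x \<in> cball (ctr i) (3 * rad i)"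
      have "x \<in> img_chart (ch i)" using x cball3_sub[OF i] by auto
      then have "0 \<le> G (ch i) x v v"
        using metric_pos[OF ch[OF i], of x v] bilinear_lzero[OF metric_bilinear[OF ch[OF i], of x]] by (cases "v = 0") (auto simp: less_imp_le)
      then show "norm v \<le> C' * sqrt (G (ch i) x v v)"
        using C x by (meson mult_right_mono order_trans real_sqrt_ge_zero)
      show "sqrt (G (ch i) x v v) \<le> C' * norm v"
        using C x by (meson mult_right_mono order_trans norm_ge_zero)
    qed
  qed
  then obtain C where C: "C \<ge> 1" "\<And>i x v. i \<in> I \<Longrightarrow> x \<in> cball (ctr i) (3 * rad i) \<Longrightarrow>
      norm v \<le> C * sqrt (G (ch i) x v v) \<and> sqrt (G (ch i) x v v) \<le> C * norm v" by blast
  have "norm (\<xi> (ch i)) \<le> C * tnorm g p \<xi> \<and> tnorm g p \<xi> \<le> C * norm (\<xi> (ch i))"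
    if "i \<in> I" "p \<in> cball_region i 3" "\<xi> \<in> tangent_space A p" for i p \<xi>
    using C(2)[OF that(1), of "\<phi> i p" "\<xi> (ch i)"] tnorm_chart[OF that(3) ch[OF that(1)]] that by (auto simp: cball_region_def)
  then show ?thesis using C(1) by blast
qed

lemma christoffel_bounded:
  "\<exists>C\<ge>1. \<forall>i\<in>I. \<forall>x\<in>cball (ctr i) (3 * rad i). \<forall>v w. norm (\<Gamma> (ch i) x v w) \<le> C * norm v * norm w"
proof (rule finite_uniform_bound[OF finite_I])
  fix i assume i: "i \<in> I"
  show "\<exists>C. \<forall>x\<in>cball (ctr i) (3 * rad i). \<forall>v w. norm (\<Gamma> (ch i) x v w) \<le> C * norm v * norm w"
    using christoffel_Lipschitz[OF ch[OF i] compact_cball convex_cball cball3_sub[OF i]] by blast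
qed (meson mult_right_mono norm_ge_zero order_trans)

lemma bridge_curve:
  assumes "i \<in> I" "x \<in> loop_space A" "y \<in> loop_space A" "\<And>t. D (x t) (y t) < \<delta>"
  shows "smooth_map A UNIV (\<lambda>r. bridge i x y r t)"
    "velocity A UNIV (\<lambda>r. bridge i x y r t) s \<in> tangent_space A (bridge i x y s t)"
proof -
  show c: "smooth_map A UNIV (\<lambda>r. bridge i x y r t)"
    using bridge_cylinder[OF assms] smooth_map_slices(2)[of UNIV "bridge i x y" t] by (simp add: smooth_cylinder_def)
  show "velocity A UNIV (\<lambda>r. bridge i x y r t) s \<in> tangent_space A (bridge i x y s t)"
    using velocity_tangent[OF smooth_curve[OF c]] by blast
qed

text \<open>In the chart of the moving ball the velocity is a bounded multiple of the coordinate difference of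
  the two points, and where the cutoff vanishes it is zero.\<close>

lemma bridge_speed:
  "\<exists>C\<ge>0. \<forall>i\<in>I. \<forall>x\<in>loop_space A. \<forall>y\<in>loop_space A. (\<forall>t. D (x t) (y t) < \<delta>) \<longrightarrow>
     (\<forall>r\<in>{0..1}. \<forall>t. tnorm g (bridge i x y r t) (d_s A UNIV (bridge i x y) r t) \<le> C * D (x t) (y t))"
proof -
  obtain B where B: "B \<ge> 0" "\<And>r. r \<in> {0..1} \<Longrightarrow> \<bar>frechet_derivative smooth_step (at r) 1\<bar> \<le> B"
    using smooth_step_derivative_bounded by blast
  obtain C where C: "C \<ge> 1" "\<And>i p \<xi>. i \<in> I \<Longrightarrow> p \<in> cball_region i 3 \<Longrightarrow> \<xi> \<in> tangent_space A p \<Longrightarrow> tnorm g p \<xi> \<le> C * norm (\<xi> (ch i))"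
    using tnorm_comparable by blast
  have "tnorm g (bridge i x y r t) (d_s A UNIV (bridge i x y) r t) \<le> (C * B) * D (x t) (y t)"
    if i: "i \<in> I" and x: "x \<in> loop_space A" and y: "y \<in> loop_space A" and d: "\<And>t. D (x t) (y t) < \<delta>" and r: "r \<in> {0..1}" for i x y r t
  proof (cases "cut 1 i (y t) = 0")
    case True
    then have "(\<lambda>r. bridge i x y r t) = (\<lambda>r. x t)" by (simp add: bridge_def step_trivial)
    then have "d_s A UNIV (bridge i x y) r t = (\<lambda>_. 0)" by (simp add: velocity_def fun_eq_iff)
    then show ?thesis using D_nonneg B C by (simp add: tnorm_zero)
  next
    case False
    note yq = cut1_support[OF i False]
    have \<rho>: "smooth_step r \<in> {0..1}" for r using smooth_step_bounds by simp
    note s = step_in_chart[OF i yq d \<rho>, folded bridge_def]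
    define b where "b = frechet_derivative smooth_step (at r) 1"
    have "((\<lambda>r. mid i (smooth_step r) (x t) (y t)) has_vector_derivative (b * cut 1 i (y t)) *\<^sub>R (\<phi> i (y t) - \<phi> i (x t))) (at r)"
      using smooth_step_derivative[of r] unfolding mid_def b_def[symmetric]
      by (auto intro!: derivative_eq_intros simp: has_real_derivative_iff_has_vector_derivative)
    then have "vector_derivative (\<lambda>r. \<phi> i (bridge i x y r t)) (at r) = (b * cut 1 i (y t)) *\<^sub>R (\<phi> i (y t) - \<phi> i (x t))"
      unfolding s(5) by (rule vector_derivative_at)
    moreover have inat: "ch i \<in> charts_at A (bridge i x y r t)" using s(4) ch[OF i] by (simp add: charts_at_def)
    ultimately have v: "d_s A UNIV (bridge i x y) r t (ch i) = (b * cut 1 i (y t)) *\<^sub>R (\<phi> i (y t) - \<phi> i (x t))"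
      by (simp add: velocity_def)
    have "bridge i x y r t \<in> cball_region i 3" using s(1,4,5)[of r] by (simp add: cball_region_def)
    then have "tnorm g (bridge i x y r t) (d_s A UNIV (bridge i x y) r t) \<le> C * norm (d_s A UNIV (bridge i x y) r t (ch i))"
      by (intro C(2)[OF i _ bridge_curve(2)[OF i x y d]])
    also have "norm (d_s A UNIV (bridge i x y) r t (ch i)) = \<bar>b\<bar> * cut 1 i (y t) * norm (\<phi> i (x t) - \<phi> i (y t))"
      unfolding v using cut_bounds[of 1 i "y t"] by (simp add: abs_mult norm_minus_commute)
    also have "C * \<dots> \<le> C * (B * 1 * D (x t) (y t))"
      using C(1) B(2)[OF r] B(1) cut_bounds[of 1 i "y t"] adjacent(2)[OF i yq d]
      by (intro mult_left_mono mult_mono) (auto simp: b_def)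
    finally show ?thesis by simp
  qed
  then show ?thesis using B(1) C(1) by (intro exI[of _ "C * B"]) auto
qed

end

section \<open>Lipschitz continuity of the gradient\<close>

locale perturbed = ball_cover A g I ch ctr rad
  for A :: "('m::t2_space, 'e::euclidean_space) chart set" and g I ch ctr rad +
  fixes V :: "(real \<Rightarrow> 'm) \<Rightarrow> real" and grad :: "(real \<Rightarrow> 'm) \<Rightarrow> real \<Rightarrow> ('m, 'e) tvec"
  assumes gradient: "is_L2_gradient A g V grad" and V0: "axiom_V0 A g V grad" and V1: "axiom_V1 A g grad"
begin

lemma grad_tangent: "x \<in> loop_space A \<Longrightarrow> grad x t \<in> tangent_space A (x t)"
  using gradient by (auto simp: is_L2_gradient_def smooth_field_along_def)

lemma grad_bounded: "\<exists>C\<ge>0. \<forall>x\<in>loop_space A. \<forall>t. tnorm g (x t) (grad x t) \<le> C"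
proof -
  obtain C where C: "\<And>x y t. x \<in> loop_space A \<Longrightarrow> y \<in> loop_space A \<Longrightarrow> \<bar>V x\<bar> + tnorm g (y t) (grad y t) \<le> C"
    using V0 unfolding axiom_V0_def by blast
  have "tnorm g (x t) (grad x t) \<le> max C 0" if "x \<in> loop_space A" for x t
    using C[OF that that, of t] abs_ge_zero[of "V x"] by linarith
  then show ?thesis by (intro exI[of _ "max C 0"]) auto
qed

lemma grad_chart_bounded:
  "\<exists>C\<ge>0. \<forall>x\<in>loop_space A. \<forall>i\<in>I. \<forall>t. x t \<in> cball_region i 3 \<longrightarrow> norm (grad x t (ch i)) \<le> C"
proof -
  obtain C where C: "C \<ge> 0" "\<And>x t. x \<in> loop_space A \<Longrightarrow> tnorm g (x t) (grad x t) \<le> C" using grad_bounded by blast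
  obtain M where M: "M \<ge> 1" "\<And>i p \<xi>. i \<in> I \<Longrightarrow> p \<in> cball_region i 3 \<Longrightarrow> \<xi> \<in> tangent_space A p \<Longrightarrow> norm (\<xi> (ch i)) \<le> M * tnorm g p \<xi>"
    using tnorm_comparable by blast
  have "norm (grad x t (ch i)) \<le> M * C" if "x \<in> loop_space A" "i \<in> I" "x t \<in> cball_region i 3" for x i t
    using M(2)[OF that(2,3) grad_tangent[OF that(1)]] mult_left_mono[OF C(2)[OF that(1), of t], of M] M(1) by linarith
  then show ?thesis using C(1) M(1) by (intro exI[of _ "M * C"]) auto
qed

text \<open>Along the path of loops from \<open>x\<close> to its displaced copy, the bound on the covariant derivative of the
  gradient controls the ordinary derivative of its coordinates: the two differ by a Christoffel term
  that is bounded by the speed, since the gradient itself is bounded. The speed is at most a multiple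
  of the distance of the loops, pointwise and in \<open>L\<^sup>1\<close>; integrating over the unit parameter interval
  gives the estimate. The coordinates are taken in an arbitrary ball \<open>l\<close> near the target point, which
  the whole path stays close to.\<close>

lemma gradient_step:
  "\<exists>C\<ge>0. \<forall>i\<in>I. \<forall>x\<in>loop_space A. \<forall>y\<in>loop_space A. (\<forall>t. L * D (x t) (y t) < \<delta>) \<longrightarrow>
     (\<forall>l\<in>I. \<forall>t. y t \<in> cball_region l 2 \<longrightarrow>
       norm (grad (\<lambda>t. step i 1 (x t) (y t)) t (ch l) - grad x t (ch l))
         \<le> C * (D (x t) (y t) + integral {0..1} (\<lambda>\<tau>. D (x \<tau>) (y \<tau>))))"
proof -
  obtain CV where CV: "\<And>u s t. smooth_cylinder A UNIV u \<Longrightarrow>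
        cov_differentiable A UNIV (\<lambda>r. u r t) (\<lambda>r. grad (u r) t) s"
      "\<And>u s t. smooth_cylinder A UNIV u \<Longrightarrow>
        tnorm g (u s t) (cov_deriv A g UNIV (\<lambda>r. u r t) (\<lambda>r. grad (u r) t) s)
          \<le> CV * (tnorm g (u s t) (d_s A UNIV u s t)
                 + integral {0..1} (\<lambda>\<tau>. tnorm g (u s \<tau>) (d_s A UNIV u s \<tau>)))"
    using V1 unfolding axiom_V1_def by blast
  obtain S where S: "S \<ge> 0" "\<And>i x y r t. i \<in> I \<Longrightarrow> x \<in> loop_space A \<Longrightarrow> y \<in> loop_space A \<Longrightarrow> (\<And>t. D (x t) (y t) < \<delta>) \<Longrightarrow>
     r \<in> {0..1} \<Longrightarrow> tnorm g (bridge i x y r t) (d_s A UNIV (bridge i x y) r t) \<le> S * D (x t) (y t)"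
    using bridge_speed by blast
  obtain M where M: "M \<ge> 1" "\<And>i p \<xi>. i \<in> I \<Longrightarrow> p \<in> cball_region i 3 \<Longrightarrow> \<xi> \<in> tangent_space A p \<Longrightarrow>
      norm (\<xi> (ch i)) \<le> M * tnorm g p \<xi> \<and> tnorm g p \<xi> \<le> M * norm (\<xi> (ch i))"
    using tnorm_comparable by blast
  obtain K where K: "K \<ge> 1" "\<And>i x v w. i \<in> I \<Longrightarrow> x \<in> cball (ctr i) (3 * rad i) \<Longrightarrow> norm (\<Gamma> (ch i) x v w) \<le> K * norm v * norm w"
    using christoffel_bounded by blast
  obtain N where N: "N \<ge> 0" "\<And>x i t. x \<in> loop_space A \<Longrightarrow> i \<in> I \<Longrightarrow> x t \<in> cball_region i 3 \<Longrightarrow> norm (grad x t (ch i)) \<le> N"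
    using grad_chart_bounded by blast
  \<comment> \<open>the covariant derivative and the Christoffel term, each proportional to the speed bound \<open>S\<close>\<close>
  define CT where "CT = M * \<bar>CV\<bar> * S + K * M * S * N"
  have CT0: "CT \<ge> 0" using M(1) S(1) K(1) N(1) by (simp add: CT_def)
  have "norm (grad (\<lambda>t. step i 1 (x t) (y t)) t (ch l) - grad x t (ch l))
         \<le> CT * (D (x t) (y t) + integral {0..1} (\<lambda>\<tau>. D (x \<tau>) (y \<tau>)))"
    if i: "i \<in> I" and x: "x \<in> loop_space A" and y: "y \<in> loop_space A" and Ld: "\<And>t. L * D (x t) (y t) < \<delta>"
      and l: "l \<in> I" and yl: "y t \<in> cball_region l 2" for i x y l t
  proof -
    let ?P = "bridge i x y"
    define W where "W = D (x t) (y t) + integral {0..1} (\<lambda>\<tau>. D (x \<tau>) (y \<tau>))"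
    have iD: "(\<lambda>\<tau>. D (x \<tau>) (y \<tau>)) integrable_on {0..1}"
      by (intro integrable_continuous_real D_loop_continuous x y)
    have iD0: "0 \<le> integral {0..1} (\<lambda>\<tau>. D (x \<tau>) (y \<tau>))" by (rule integral_nonneg[OF iD]) (rule D_nonneg)
    have W: "D (x t) (y t) \<le> W" "0 \<le> W" using iD0 D_nonneg by (auto simp: W_def)
    have d: "D (x t) (y t) < \<delta>" for t
      using Ld[of t] mult_right_mono[OF L(1) D_nonneg[of "x t" "y t"]] by linarith
    have cyl: "smooth_cylinder A UNIV ?P" by (rule bridge_cylinder[OF i x y d])
    have loop: "?P r \<in> loop_space A" for r using loop_of_cylinder[OF cyl] by simp
    have \<rho>: "smooth_step r \<in> {0..1}" for r using smooth_step_bounds by simp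
    have near: "?P r t \<in> cball_region l 3" for r
    proof -
      have "D (?P r t) (y t) < \<delta>"
        unfolding bridge_def using step_D_le[OF i d \<rho>, of r t] Ld[of t] by linarith
      then have "?P r t \<in> ball_region l 3"
        by (rule adjacent(1)[OF l, rotated]) (use yl rad[OF l] in \<open>auto simp: cball_region_def\<close>)
      then show ?thesis by (auto simp: ball_region_def cball_region_def)
    qed
    then have ld: "?P r t \<in> dom_chart (ch l)" and lb: "\<phi> l (?P r t) \<in> cball (ctr l) (3 * rad l)"
      and lat: "ch l \<in> charts_at A (?P r t)" for r
      using ch[OF l] by (auto simp: cball_region_def charts_at_def)
    note crv = bridge_curve[OF i x y d]
    define h where "h = (\<lambda>r. grad (?P r) t (ch l))"
    define h' where "h' = (\<lambda>r. vector_derivative h (at r))"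
    have hd: "(h has_vector_derivative h' r) (at r)" for r
      using CV(1)[OF cyl, of t r] lat[of r] unfolding h'_def h_def vector_derivative_works[symmetric] cov_differentiable_def by blast
    have bound: "norm (h' r) \<le> CT * W" if r: "r \<in> {0..1}" for r
    proof -
      let ?v = "d_s A UNIV ?P r t" and ?Y = "cov_deriv A g UNIV (\<lambda>r. ?P r t) (\<lambda>r. grad (?P r) t) r"
      have spd: "tnorm g (?P r \<tau>) (d_s A UNIV ?P r \<tau>) \<le> S * D (x \<tau>) (y \<tau>)" for \<tau> by (rule S(2)[OF i x y d r])
      have "integral {0..1} (\<lambda>\<tau>. tnorm g (?P r \<tau>) (d_s A UNIV ?P r \<tau>)) \<le> S * integral {0..1} (\<lambda>\<tau>. D (x \<tau>) (y \<tau>))"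
      proof (cases "(\<lambda>\<tau>. tnorm g (?P r \<tau>) (d_s A UNIV ?P r \<tau>)) integrable_on {0..1}")
        case True
        have "integral {0..1} (\<lambda>\<tau>. tnorm g (?P r \<tau>) (d_s A UNIV ?P r \<tau>)) \<le> integral {0..1} (\<lambda>\<tau>. S * D (x \<tau>) (y \<tau>))"
          by (rule integral_le[OF True integrable_on_mult_right[OF iD] spd])
        then show ?thesis by simp
      next
        case False
        then show ?thesis using S(1) iD0 by (simp add: not_integrable_integral)
      qed
      then have "tnorm g (?P r t) ?v + integral {0..1} (\<lambda>\<tau>. tnorm g (?P r \<tau>) (d_s A UNIV ?P r \<tau>)) \<le> S * W"
        using spd[of t] by (simp add: W_def distrib_left)
      moreover have "0 \<le> tnorm g (?P r t) ?v" "\<And>\<tau>. 0 \<le> tnorm g (?P r \<tau>) (d_s A UNIV ?P r \<tau>)"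
      proof -
        have "0 \<le> tnorm g (?P r \<tau>) (d_s A UNIV ?P r \<tau>)" for \<tau>
        proof -
          obtain k where k: "k \<in> I" "?P r \<tau> \<in> ball_region k 1" using region_cover by blast
          then have "?P r \<tau> \<in> cball_region k 3" using rad[OF k(1)] by (auto simp: ball_region_def cball_region_def)
          then have "0 \<le> M * tnorm g (?P r \<tau>) (d_s A UNIV ?P r \<tau>)"
            using M(2)[OF k(1) _ crv(2)] order_trans[OF norm_ge_zero] by blast
          then show ?thesis using M(1) by (simp add: zero_le_mult_iff)
        qed
        then show "0 \<le> tnorm g (?P r t) ?v" "\<And>\<tau>. 0 \<le> tnorm g (?P r \<tau>) (d_s A UNIV ?P r \<tau>)" by auto
      qed
      moreover then have "0 \<le> integral {0..1} (\<lambda>\<tau>. tnorm g (?P r \<tau>) (d_s A UNIV ?P r \<tau>))"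
        by (cases "(\<lambda>\<tau>. tnorm g (?P r \<tau>) (d_s A UNIV ?P r \<tau>)) integrable_on {0..1}")
          (auto intro: integral_nonneg simp: not_integrable_integral)
      ultimately have "CV * (tnorm g (?P r t) ?v + integral {0..1} (\<lambda>\<tau>. tnorm g (?P r \<tau>) (d_s A UNIV ?P r \<tau>))) \<le> \<bar>CV\<bar> * (S * W)"
        by (intro mult_mono) auto
      then have Y1: "tnorm g (?P r t) ?Y \<le> \<bar>CV\<bar> * (S * W)"
        using CV(2)[OF cyl, of r t] by linarith
      have Ytan: "?Y \<in> tangent_space A (?P r t)"
        by (rule cov_deriv_tangent[OF smooth_curve[OF crv(1)] grad_tangent[OF loop] CV(1)[OF cyl]])
      have Y2: "norm (?Y (ch l)) \<le> M * (\<bar>CV\<bar> * (S * W))"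
        using M(2)[OF l near Ytan] mult_left_mono[OF Y1, of M] M(1) by linarith
      have "norm (?v (ch l)) \<le> M * tnorm g (?P r t) ?v" using M(2)[OF l near crv(2)] by blast
      also have "\<dots> \<le> M * (S * D (x t) (y t))" using spd[of t] M(1) by (intro mult_left_mono) auto
      also have "\<dots> \<le> M * (S * W)" using W S(1) M(1) by (intro mult_left_mono) auto
      finally have v2: "norm (?v (ch l)) \<le> M * (S * W)" .
      have "?Y (ch l) = h' r + \<Gamma> (ch l) (\<phi> l (?P r t)) (?v (ch l)) (h r)"
        using lat[of r] by (simp add: cov_deriv_def h'_def h_def)
      then have "norm (h' r) \<le> norm (?Y (ch l)) + norm (\<Gamma> (ch l) (\<phi> l (?P r t)) (?v (ch l)) (h r))"
        by (metis add_diff_cancel_right' norm_triangle_ineq4)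
      also have "\<dots> \<le> M * (\<bar>CV\<bar> * (S * W)) + K * (M * (S * W)) * N"
        using K(1) N(2)[OF loop l near] v2 W S(1) M(1)
        by (intro add_mono Y2 order_trans[OF K(2)[OF l lb]] mult_mono) (auto simp: h_def)
      also have "\<dots> = CT * W" by (simp add: CT_def algebra_simps)
      finally show ?thesis .
    qed
    have "norm (h 1 - h 0) \<le> CT * W * 1 - CT * W * 0"
    proof (rule differentiable_bound_general[of 0 1 h "\<lambda>r. CT * W * r" h' "\<lambda>_. CT * W"])
      show "continuous_on {0..1} h"
        by (rule continuous_on_vector_derivative[OF has_vector_derivative_at_within[OF hd]])
      show "((\<lambda>r. CT * W * r) has_vector_derivative CT * W) (at r)" for r
        unfolding has_vector_derivative_def by (auto intro!: derivative_eq_intros)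
      show "continuous_on {0..1} (\<lambda>r. CT * W * r)" by (intro continuous_intros)
      show "norm (h' r) \<le> CT * W" if "0 < r" "r < 1" for r using bound[of r] that by simp
    qed (use hd in auto)
    moreover have "?P 1 = (\<lambda>t. step i 1 (x t) (y t))" "?P 0 = x"
      using step_zero[OF i d] by (auto simp: bridge_def smooth_step_simps fun_eq_iff)
    ultimately show ?thesis by (simp add: h_def W_def)
  qed
  then show ?thesis using CT0 by blast
qed

primrec walk :: "'m list \<Rightarrow> 'm \<Rightarrow> 'm \<Rightarrow> 'm" where
  "walk [] p q = p"
| "walk (i # is) p q = walk is (step i 1 p q) q"

lemma walk_self: "set is \<subseteq> I \<Longrightarrow> walk is q q = q"
  by (induction "is") (auto simp: step_self)

lemma walk_reaches:
  assumes "set is \<subseteq> I" "i \<in> set is" "q \<in> ball_region i 1" shows "walk is p q = q"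
  using assms
proof (induction "is" arbitrary: p)
  case (Cons k "is")
  show ?case
  proof (cases "k = i")
    case True
    then show ?thesis using step_reaches[of i q p] walk_self[of "is" q] Cons.prems by auto
  next
    case False
    then show ?thesis using Cons by auto
  qed
qed auto

text \<open>Each step may enlarge the distance to the target by the factor \<^const>\<open>L\<close>; the powers of \<^const>\<open>L\<close> keep all
  intermediate loops within the distance \<open>\<delta>\<close> required by the next step.\<close>

lemma gradient_walk:
  assumes "set is \<subseteq> I"
  shows "\<exists>C\<ge>0. \<forall>x\<in>loop_space A. \<forall>y\<in>loop_space A. (\<forall>t. L ^ length is * D (x t) (y t) < \<delta>) \<longrightarrow>
     (\<forall>l\<in>I. \<forall>t. y t \<in> cball_region l 2 \<longrightarrow>
       norm (grad (\<lambda>t. walk is (x t) (y t)) t (ch l) - grad x t (ch l))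
         \<le> C * (D (x t) (y t) + integral {0..1} (\<lambda>\<tau>. D (x \<tau>) (y \<tau>))))"
  using assms
proof (induction "is")
  case Nil
  show ?case by (intro exI[of _ 0]) simp
next
  case (Cons i "is")
  have i: "i \<in> I" using Cons by simp
  obtain C where C: "C \<ge> 0" "\<And>x y l t. x \<in> loop_space A \<Longrightarrow> y \<in> loop_space A \<Longrightarrow> (\<And>t. L ^ length is * D (x t) (y t) < \<delta>) \<Longrightarrow>
     l \<in> I \<Longrightarrow> y t \<in> cball_region l 2 \<Longrightarrow> norm (grad (\<lambda>t. walk is (x t) (y t)) t (ch l) - grad x t (ch l))
         \<le> C * (D (x t) (y t) + integral {0..1} (\<lambda>\<tau>. D (x \<tau>) (y \<tau>)))"
    using Cons by auto
  obtain C' where C': "C' \<ge> 0" "\<And>i x y l t. i \<in> I \<Longrightarrow> x \<in> loop_space A \<Longrightarrow> y \<in> loop_space A \<Longrightarrow> (\<And>t. L * D (x t) (y t) < \<delta>) \<Longrightarrow>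
     l \<in> I \<Longrightarrow> y t \<in> cball_region l 2 \<Longrightarrow> norm (grad (\<lambda>t. step i 1 (x t) (y t)) t (ch l) - grad x t (ch l))
         \<le> C' * (D (x t) (y t) + integral {0..1} (\<lambda>\<tau>. D (x \<tau>) (y \<tau>)))"
    using gradient_step by blast
  have "norm (grad (\<lambda>t. walk (i # is) (x t) (y t)) t (ch l) - grad x t (ch l))
      \<le> (C * L + C') * (D (x t) (y t) + integral {0..1} (\<lambda>\<tau>. D (x \<tau>) (y \<tau>)))"
    if x: "x \<in> loop_space A" and y: "y \<in> loop_space A" and d: "\<And>t. L ^ length (i # is) * D (x t) (y t) < \<delta>"
      and l: "l \<in> I" "y t \<in> cball_region l 2" for x y l t
  proof -
    define x' where "x' = (\<lambda>t. step i 1 (x t) (y t))"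
    have pw: "1 \<le> L ^ length is" using L(1) by (rule one_le_power)
    have Ld: "L * D (x t) (y t) < \<delta>" for t
    proof -
      have "1 * (L * D (x t) (y t)) \<le> L ^ length is * (L * D (x t) (y t))"
        using pw L(1) D_nonneg by (intro mult_right_mono) auto
      then show ?thesis using d[of t] by (simp add: mult.assoc mult.left_commute)
    qed
    have dd: "D (x t) (y t) < \<delta>" for t
      using Ld[of t] mult_right_mono[OF L(1) D_nonneg[of "x t" "y t"]] by linarith
    have "bridge i x y 1 = x'" by (auto simp: bridge_def x'_def smooth_step_simps)
    then have x'L: "x' \<in> loop_space A" using loop_of_cylinder[OF bridge_cylinder[OF i x y dd], of 1] by simp
    have Dx': "D (x' t) (y t) \<le> L * D (x t) (y t)" for t
      unfolding x'_def by (rule step_D_le[OF i dd]) simp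
    have d': "L ^ length is * D (x' t) (y t) < \<delta>" for t
    proof -
      have "L ^ length is * D (x' t) (y t) \<le> L ^ length is * (L * D (x t) (y t))"
        using pw Dx'[of t] by (intro mult_left_mono) auto
      then show ?thesis using d[of t] by (simp add: mult.assoc mult.left_commute)
    qed
    have "integral {0..1} (\<lambda>\<tau>. D (x' \<tau>) (y \<tau>)) \<le> integral {0..1} (\<lambda>\<tau>. L * D (x \<tau>) (y \<tau>))"
      by (intro integral_le integrable_continuous_real D_loop_continuous x'L x y Dx' continuous_intros)
    then have "D (x' t) (y t) + integral {0..1} (\<lambda>\<tau>. D (x' \<tau>) (y \<tau>)) \<le> L * (D (x t) (y t) + integral {0..1} (\<lambda>\<tau>. D (x \<tau>) (y \<tau>)))"
      using Dx'[of t] by (simp add: distrib_left)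
    from mult_left_mono[OF this C(1)]
    have 1: "norm (grad (\<lambda>t. walk is (x' t) (y t)) t (ch l) - grad x' t (ch l)) \<le> C * (L * (D (x t) (y t) + integral {0..1} (\<lambda>\<tau>. D (x \<tau>) (y \<tau>))))"
      using C(2)[OF x'L y d' l] by linarith
    have 2: "norm (grad x' t (ch l) - grad x t (ch l)) \<le> C' * (D (x t) (y t) + integral {0..1} (\<lambda>\<tau>. D (x \<tau>) (y \<tau>)))"
      unfolding x'_def by (rule C'(2)[OF i x y Ld l])
    have "norm (grad (\<lambda>t. walk is (x' t) (y t)) t (ch l) - grad x t (ch l)) \<le>
        norm (grad (\<lambda>t. walk is (x' t) (y t)) t (ch l) - grad x' t (ch l)) + norm (grad x' t (ch l) - grad x t (ch l))"
      by (rule norm_diff_triangle_ineq[THEN order_trans[rotated]]) (simp add: algebra_simps)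
    then show ?thesis using 1 2 by (simp add: x'_def algebra_simps)
  qed
  then show ?case using C(1) C'(1) L(1) by (intro exI[of _ "C * L + C'"]) auto
qed

definition gradient_Lipschitz_within :: "real \<Rightarrow> real \<Rightarrow> bool" where
  "gradient_Lipschitz_within \<epsilon> C \<longleftrightarrow> (\<forall>x\<in>loop_space A. \<forall>y\<in>loop_space A. (\<forall>t. D (x t) (y t) < \<epsilon>) \<longrightarrow>
     (\<forall>l\<in>I. \<forall>t. y t \<in> cball_region l 2 \<longrightarrow>
       norm (grad y t (ch l) - grad x t (ch l)) \<le> C * (D (x t) (y t) + integral {0..1} (\<lambda>\<tau>. D (x \<tau>) (y \<tau>)))))"

text \<open>Walking through all balls of the cover leads from any loop to any sufficiently close one, because
  every point of the target lies in one of the balls of radius one.\<close>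

lemma gradient_Lipschitz: "\<exists>C\<ge>0. \<exists>\<epsilon>>0. \<epsilon> \<le> \<delta> \<and> gradient_Lipschitz_within \<epsilon> C"
proof -
  obtain "is" where is_I: "set is = I" using finite_list[OF finite_I] by blast
  obtain C where C: "C \<ge> 0" "\<And>x y l t. x \<in> loop_space A \<Longrightarrow> y \<in> loop_space A \<Longrightarrow> (\<And>t. L ^ length is * D (x t) (y t) < \<delta>) \<Longrightarrow>
     l \<in> I \<Longrightarrow> y t \<in> cball_region l 2 \<Longrightarrow> norm (grad (\<lambda>t. walk is (x t) (y t)) t (ch l) - grad x t (ch l))
         \<le> C * (D (x t) (y t) + integral {0..1} (\<lambda>\<tau>. D (x \<tau>) (y \<tau>)))"
    using gradient_walk[of "is"] is_I by auto
  have arrive: "walk is p q = q" for p q using walk_reaches[of "is"] is_I region_cover by blast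
  define \<epsilon> where "\<epsilon> = \<delta> / L ^ length is"
  have pw: "1 \<le> L ^ length is" using L(1) by (rule one_le_power)
  have e: "0 < \<epsilon>" "\<epsilon> \<le> \<delta>" using \<delta>_pos pw by (auto simp: \<epsilon>_def divide_le_eq_1 field_simps)
  have small: "L ^ length is * D p q < \<delta>" if "D p q < \<epsilon>" for p q
    using that pw by (simp add: \<epsilon>_def field_simps)
  have "norm (grad y t (ch l) - grad x t (ch l)) \<le> C * (D (x t) (y t) + integral {0..1} (\<lambda>\<tau>. D (x \<tau>) (y \<tau>)))"
    if "x \<in> loop_space A" "y \<in> loop_space A" "\<And>t. D (x t) (y t) < \<epsilon>" "l \<in> I" "y t \<in> cball_region l 2" for x y l t
    using C(2)[OF that(1,2) small[OF that(3)] that(4,5)] unfolding arrive by simp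
  then show ?thesis unfolding gradient_Lipschitz_within_def using C(1) e by blast
qed

end

section \<open>The heat equation for the components of the embedding\<close>

text \<open>Partial derivatives within the half cylinder. They are smooth up to the boundary, which yields the
  uniform bounds there, and are ordinary partial derivatives in the interior.\<close>

definition part_s :: "(real \<times> real) set \<Rightarrow> (real \<times> real \<Rightarrow> real) \<Rightarrow> real \<times> real \<Rightarrow> real" where
  "part_s S f z = frechet_derivative f (at z within S) (1, 0)"

definition part_t :: "(real \<times> real) set \<Rightarrow> (real \<times> real \<Rightarrow> real) \<Rightarrow> real \<times> real \<Rightarrow> real" where
  "part_t S f z = frechet_derivative f (at z within S) (0, 1)"

lemma smooth_part: "smooth_on S f \<Longrightarrow> smooth_on S (part_s S f)" "smooth_on S f \<Longrightarrow> smooth_on S (part_t S f)"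
  unfolding part_s_def[abs_def] part_t_def[abs_def] by (erule smooth_on_derivative)+

lemma slice_derivatives:
  fixes f :: "real \<times> real \<Rightarrow> 'b::euclidean_space"
  assumes "(f has_derivative f') (at (s, t))"
  shows "((\<lambda>r. f (r, t)) has_vector_derivative f' (1, 0)) (at s)" "((\<lambda>r. f (s, r)) has_vector_derivative f' (0, 1)) (at t)"
proof -
  have lin: "linear f'" using assms by (rule has_derivative_linear)
  have "((\<lambda>r. (r, t)) has_derivative (\<lambda>h. (h, 0))) (at s)" "((\<lambda>r. (s, r)) has_derivative (\<lambda>h. (0, h))) (at t)"
    by (auto intro!: derivative_eq_intros)
  note d = this
  from has_derivative_compose[OF d(1) assms] has_derivative_compose[OF d(2) assms]
  have d1: "((\<lambda>r. f (r, t)) has_derivative (\<lambda>h. f' (h, 0))) (at s)"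
    and d2: "((\<lambda>r. f (s, r)) has_derivative (\<lambda>h. f' (0, h))) (at t)" by auto
  have c: "f' (h, 0) = h *\<^sub>R f' (1, 0)" "f' (0, h) = h *\<^sub>R f' (0, 1)" for h
    using linear_cmul[OF lin, of h "(1, 0)"] linear_cmul[OF lin, of h "(0, 1)"] by auto
  show "((\<lambda>r. f (r, t)) has_vector_derivative f' (1, 0)) (at s)"
    unfolding has_vector_derivative_def by (rule has_derivative_eq_rhs[OF d1]) (rule ext, rule c(1))
  show "((\<lambda>r. f (s, r)) has_vector_derivative f' (0, 1)) (at t)"
    unfolding has_vector_derivative_def by (rule has_derivative_eq_rhs[OF d2]) (rule ext, rule c(2))
qed

lemma partial_derivatives:
  assumes f: "smooth_on S f" and \<Omega>: "open \<Omega>" "\<Omega> \<subseteq> S" "(s, t) \<in> \<Omega>"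
  shows "((\<lambda>r. f (r, t)) has_real_derivative part_s S f (s, t)) (at s)"
    "((\<lambda>r. f (s, r)) has_real_derivative part_t S f (s, t)) (at t)"
proof -
  have "at (s, t) within S = at (s, t)" using \<Omega> at_within_open_subset by blast
  then have "(f has_derivative frechet_derivative f (at (s, t) within S)) (at (s, t))"
    using smooth_on_has_derivative[OF f, of "(s, t)"] \<Omega> by auto
  from slice_derivatives[OF this]
  show "((\<lambda>r. f (r, t)) has_real_derivative part_s S f (s, t)) (at s)"
    "((\<lambda>r. f (s, r)) has_real_derivative part_t S f (s, t)) (at t)"
    by (auto simp: part_s_def part_t_def has_real_derivative_iff_has_vector_derivative)
qed

lemma mixed_partials:
  assumes f: "smooth_on S f" and \<Omega>: "open \<Omega>" "\<Omega> \<subseteq> S" "z \<in> \<Omega>"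
  shows "part_t S (part_s S f) z = part_s S (part_t S f) z"
proof -
  have at: "at y within S = at y" if "y \<in> \<Omega>" for y using \<Omega> that at_within_open_subset by blast
  have fO: "smooth_on \<Omega> f" using smooth_on_Int_open[OF f \<Omega>(1)] \<Omega>(2) by (simp add: Int_absorb1)
  have conv: "frechet_derivative (\<lambda>y. frechet_derivative f (at y within S) v) (at z within S) =
      frechet_derivative (\<lambda>y. frechet_derivative f (at y) v) (at z)" for v
  proof -
    have "((\<lambda>y. frechet_derivative f (at y within S) v) has_derivative
       frechet_derivative (\<lambda>y. frechet_derivative f (at y within S) v) (at z within S)) (at z)"
      using smooth_on_has_derivative[OF smooth_on_derivative[OF f, of v], of z] \<Omega> at by auto
    then have "((\<lambda>y. frechet_derivative f (at y) v) has_derivative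
       frechet_derivative (\<lambda>y. frechet_derivative f (at y within S) v) (at z within S)) (at z)"
      by (rule has_derivative_transform_within_open[OF _ \<Omega>(1,3)]) (simp add: at)
    then show ?thesis by (rule frechet_derivative_at)
  qed
  show ?thesis
    unfolding part_s_def[abs_def] part_t_def[abs_def] conv
    by (rule smooth_second_derivative_symmetric[OF fO \<Omega>(1,3)])
qed

lemma part_diff:
  assumes S: "fat S" and f: "smooth_on S f" and h: "smooth_on S h" and z: "z \<in> S"
  shows "part_s S (\<lambda>z. f z - h z) z = part_s S f z - part_s S h z"
    "part_t S (\<lambda>z. f z - h z) z = part_t S f z - part_t S h z"
  unfolding part_s_def part_t_def
  using frechet_derivative_fat[OF S z has_derivative_diff[OF smooth_on_has_derivative[OF f z] smooth_on_has_derivative[OF h z]]]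
  by simp_all

lemma part_t_cong: "z \<in> S \<Longrightarrow> (\<And>y. y \<in> S \<Longrightarrow> f y = h y) \<Longrightarrow> part_t S f z = part_t S h z"
  unfolding part_t_def using frechet_derivative_cong_on[of z S f h] by simp

text \<open>For \<open>B x a a - B y a' a'\<close>, change one entry at a time.\<close>

lemma bilinear_quadratic_Lipschitz:
  fixes B :: "'a::euclidean_space \<Rightarrow> 'c::euclidean_space \<Rightarrow> 'c \<Rightarrow> 'b::euclidean_space"
  assumes bil: "bilinear (B x)" "bilinear (B y)" and C: "C \<ge> 0"
    and bd: "\<And>v w. norm (B y v w) \<le> C * norm v * norm w" "\<And>v w. norm (B x v w - B y v w) \<le> C * norm (x - y) * norm v * norm w"
    and M: "norm a \<le> M" "norm a' \<le> M"
  shows "norm (B x a a - B y a' a') \<le> C * M\<^sup>2 * norm (x - y) + 2 * C * M * norm (a - a')"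
proof -
  have M0: "0 \<le> M" using M norm_ge_zero order_trans by blast
  have "B x a a - B y a' a' = (B x a a - B y a a) + (B y (a - a') a + B y a' (a - a'))"
    by (simp add: bilinear_lsub[OF bil(2)] bilinear_rsub[OF bil(2)])
  then have "norm (B x a a - B y a' a') \<le> norm (B x a a - B y a a) + (norm (B y (a - a') a) + norm (B y a' (a - a')))"
    by (metis norm_triangle_mono norm_triangle_ineq order_refl)
  also have "\<dots> \<le> C * norm (x - y) * M * M + (C * norm (a - a') * M + C * M * norm (a - a'))"
  proof (intro add_mono)
    show "norm (B x a a - B y a a) \<le> C * norm (x - y) * M * M"
      by (rule order_trans[OF bd(2)]) (use C M M0 in \<open>intro mult_mono mult_nonneg_nonneg; simp\<close>)
    show "norm (B y (a - a') a) \<le> C * norm (a - a') * M"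
      by (rule order_trans[OF bd(1)]) (use C M M0 in \<open>intro mult_mono mult_nonneg_nonneg; simp\<close>)
    show "norm (B y a' (a - a')) \<le> C * M * norm (a - a')"
      by (rule order_trans[OF bd(1)]) (use C M M0 in \<open>intro mult_mono mult_nonneg_nonneg; simp\<close>)
  qed
  finally show ?thesis by (simp add: power2_eq_square algebra_simps)
qed

context ball_cover
begin

text \<open>A component of the embedding in the coordinates of a ball, with its first two derivatives.\<close>

definition coord :: "'m \<times> 'e \<Rightarrow> 'm \<Rightarrow> 'e \<Rightarrow> real" where
  "coord j l x = emb j (inv_chart (ch l) x)"

definition dcoord :: "'m \<times> 'e \<Rightarrow> 'm \<Rightarrow> 'e \<Rightarrow> 'e \<Rightarrow> real" where
  "dcoord j l x v = frechet_derivative (coord j l) (at x) v"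

definition ddcoord :: "'m \<times> 'e \<Rightarrow> 'm \<Rightarrow> 'e \<Rightarrow> 'e \<Rightarrow> 'e \<Rightarrow> real" where
  "ddcoord j l x v w = frechet_derivative (\<lambda>y. dcoord j l y w) (at x) v"

text \<open>For a function \<open>f\<close> on the manifold and a solution \<open>u\<close> of the heat equation,
  \<open>\<partial>\<^sub>s f(u) - \<partial>\<^sub>t\<^sup>2 f(u)\<close> is \<open>df\<close> applied to the gradient minus the Hessian of \<open>f\<close> on \<open>\<partial>\<^sub>t u\<close>. This is that
  expression in coordinates, with \<open>a\<close> in place of \<open>\<partial>\<^sub>t u\<close> and \<open>b\<close> in place of the gradient; the Hessian is
  the second derivative minus the Christoffel term.\<close>

definition reaction :: "'m \<times> 'e \<Rightarrow> 'm \<Rightarrow> 'e \<Rightarrow> 'e \<Rightarrow> 'e \<Rightarrow> real" where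
  "reaction j l x a b = dcoord j l x (\<Gamma> (ch l) x a a + b) - ddcoord j l x a a"

definition reaction_Lipschitz_on :: "real \<Rightarrow> real \<Rightarrow> 'm \<times> 'e \<Rightarrow> 'm \<Rightarrow> bool" where
  "reaction_Lipschitz_on M C j l \<longleftrightarrow> (\<forall>x\<in>cball (ctr l) (3 * rad l). \<forall>y\<in>cball (ctr l) (3 * rad l). \<forall>a a' b b'.
     norm a \<le> M \<longrightarrow> norm a' \<le> M \<longrightarrow> norm b \<le> M \<longrightarrow> norm b' \<le> M \<longrightarrow>
     \<bar>reaction j l x a b - reaction j l y a' b'\<bar> \<le> C * (norm (x - y) + norm (a - a') + norm (b - b')))"

context
  fixes j l assumes j: "j \<in> J" and l: "l \<in> I"
begin

lemma coord_smooth: "smooth_on (img_chart (ch l)) (coord j l)"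
  using emb_smooth[OF j] ch[OF l] by (auto simp: smooth_function_def coord_def[abs_def])

lemma dcoord_smooth: "smooth_on (img_chart (ch l)) (\<lambda>x. dcoord j l x v)"
  unfolding dcoord_def by (rule smooth_on_derivative_open[OF coord_smooth chart_facts(2)[OF ch[OF l]]])

lemma dcoord_linear: "x \<in> img_chart (ch l) \<Longrightarrow> linear (dcoord j l x)"
  unfolding dcoord_def[abs_def]
  by (rule has_derivative_linear[OF smooth_on_has_derivative_open[OF coord_smooth chart_facts(2)[OF ch[OF l]]]])

lemma ddcoord_smooth: "smooth_on (img_chart (ch l)) (\<lambda>x. ddcoord j l x v w)"
  unfolding ddcoord_def by (rule smooth_on_derivative_open[OF dcoord_smooth chart_facts(2)[OF ch[OF l]]])

lemma ddcoord_bilinear: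
  assumes x: "x \<in> img_chart (ch l)" shows "bilinear (ddcoord j l x)"
  unfolding bilinear_def ddcoord_def[abs_def]
  using derivative_of_linear_family[OF dcoord_smooth dcoord_linear chart_facts(2)[OF ch[OF l]] x]
    has_derivative_linear[OF smooth_on_has_derivative_open[OF dcoord_smooth chart_facts(2)[OF ch[OF l]] x]]
  by auto

lemma reaction_Lipschitz_chart:
  assumes M: "M \<ge> 0"
  shows "\<exists>C. reaction_Lipschitz_on M C j l"
proof -
  let ?K = "cball (ctr l) (3 * rad l)" and ?c = "ch l"
  note c = ch[OF l] and K = compact_cball convex_cball cball3_sub[OF l]
  have img: "x \<in> img_chart ?c" if "x \<in> ?K" for x using that cball3_sub[OF l] by auto
  obtain P where P: "P \<ge> 0" "\<And>x v. x \<in> ?K \<Longrightarrow> norm (dcoord j l x v) \<le> P * norm v"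
    "\<And>x y v. x \<in> ?K \<Longrightarrow> y \<in> ?K \<Longrightarrow> norm (dcoord j l x v - dcoord j l y v) \<le> P * norm (x - y) * norm v"
    using smooth_linear_family_Lipschitz[OF dcoord_smooth dcoord_linear[OF img] chart_facts(2)[OF c] K] by blast
  obtain Q where Q: "Q \<ge> 0" "\<And>x v w. x \<in> ?K \<Longrightarrow> norm (ddcoord j l x v w) \<le> Q * norm v * norm w"
    "\<And>x y v w. x \<in> ?K \<Longrightarrow> y \<in> ?K \<Longrightarrow> norm (ddcoord j l x v w - ddcoord j l y v w) \<le> Q * norm (x - y) * norm v * norm w"
    using smooth_bilinear_family_Lipschitz[OF ddcoord_smooth ddcoord_bilinear[OF img] chart_facts(2)[OF c] K] by blast
  obtain R where R: "R \<ge> 0" "\<And>x v w. x \<in> ?K \<Longrightarrow> norm (\<Gamma> ?c x v w) \<le> R * norm v * norm w"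
    "\<And>x y v w. x \<in> ?K \<Longrightarrow> y \<in> ?K \<Longrightarrow> norm (\<Gamma> ?c x v w - \<Gamma> ?c y v w) \<le> R * norm (x - y) * norm v * norm w"
    using christoffel_Lipschitz[OF c K] by blast
  define C where "C = P * (R * M\<^sup>2 + M) + P * (R * M\<^sup>2 + 2 * R * M + 1) + (Q * M\<^sup>2 + 2 * Q * M)"
  have C0: "C \<ge> 0" using P(1) Q(1) R(1) M by (simp add: C_def)
  have "\<bar>reaction j l x a b - reaction j l y a' b'\<bar> \<le> C * (norm (x - y) + norm (a - a') + norm (b - b'))"
    if x: "x \<in> ?K" and y: "y \<in> ?K" and n: "norm a \<le> M" "norm a' \<le> M" "norm b \<le> M" "norm b' \<le> M" for x y a a' b b'
  proof -
    let ?W = "norm (x - y) + norm (a - a') + norm (b - b')"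
    let ?p = "\<Gamma> ?c x a a + b" and ?q = "\<Gamma> ?c y a' a' + b'"
    have "norm (ddcoord j l x a a - ddcoord j l y a' a') \<le> Q * M\<^sup>2 * norm (x - y) + 2 * Q * M * norm (a - a')"
      by (rule bilinear_quadratic_Lipschitz[OF ddcoord_bilinear[OF img[OF x]] ddcoord_bilinear[OF img[OF y]] Q(1) Q(2)[OF y] Q(3)[OF x y] n(1,2)])
    also have "\<dots> \<le> Q * M\<^sup>2 * ?W + 2 * Q * M * ?W"
      using Q(1) M by (intro add_mono mult_left_mono) auto
    finally have d2: "\<bar>ddcoord j l x a a - ddcoord j l y a' a'\<bar> \<le> (Q * M\<^sup>2 + 2 * Q * M) * ?W" by (simp add: algebra_simps)
    have g: "norm (\<Gamma> ?c x a a - \<Gamma> ?c y a' a') \<le> R * M\<^sup>2 * norm (x - y) + 2 * R * M * norm (a - a')"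
      by (rule bilinear_quadratic_Lipschitz[OF christoffel_bilinear[OF c img[OF x]] christoffel_bilinear[OF c img[OF y]] R(1) R(2)[OF y] R(3)[OF x y] n(1,2)])
    have "norm (?p - ?q) \<le> norm (\<Gamma> ?c x a a - \<Gamma> ?c y a' a') + norm (b - b')"
      by (simp add: add_diff_add norm_triangle_ineq)
    also have "\<dots> \<le> R * M\<^sup>2 * ?W + 2 * R * M * ?W + 1 * ?W"
      by (intro add_mono order_trans[OF g] mult_left_mono) (use R(1) M in auto)
    finally have pq: "norm (?p - ?q) \<le> (R * M\<^sup>2 + 2 * R * M + 1) * ?W" by (simp add: algebra_simps)
    have "norm ?p \<le> R * norm a * norm a + norm b" by (intro norm_triangle_mono R(2)[OF x] order_refl)
    also have "\<dots> \<le> R * M * M + M" using R(1) M n by (intro add_mono mult_mono) auto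
    finally have p: "norm ?p \<le> R * M\<^sup>2 + M" by (simp add: power2_eq_square mult.assoc)
    have "dcoord j l x ?p - dcoord j l y ?q = (dcoord j l x ?p - dcoord j l y ?p) + dcoord j l y (?p - ?q)"
      by (simp add: linear_diff[OF dcoord_linear[OF img[OF y]]])
    then have "\<bar>dcoord j l x ?p - dcoord j l y ?q\<bar> \<le> norm (dcoord j l x ?p - dcoord j l y ?p) + norm (dcoord j l y (?p - ?q))"
      by simp
    also have "\<dots> \<le> P * ?W * (R * M\<^sup>2 + M) + P * ((R * M\<^sup>2 + 2 * R * M + 1) * ?W)"
    proof (intro add_mono)
      show "norm (dcoord j l x ?p - dcoord j l y ?p) \<le> P * ?W * (R * M\<^sup>2 + M)"
        by (rule order_trans[OF P(3)[OF x y]]) (use P(1) p in \<open>intro mult_mono mult_left_mono mult_nonneg_nonneg; simp\<close>)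
      show "norm (dcoord j l y (?p - ?q)) \<le> P * ((R * M\<^sup>2 + 2 * R * M + 1) * ?W)"
        by (rule order_trans[OF P(2)[OF y] mult_left_mono[OF pq P(1)]])
    qed
    finally have d1: "\<bar>dcoord j l x ?p - dcoord j l y ?q\<bar> \<le> P * ?W * (R * M\<^sup>2 + M) + P * ((R * M\<^sup>2 + 2 * R * M + 1) * ?W)" .
    have "\<bar>reaction j l x a b - reaction j l y a' b'\<bar> \<le> \<bar>dcoord j l x ?p - dcoord j l y ?q\<bar> + \<bar>ddcoord j l x a a - ddcoord j l y a' a'\<bar>"
      unfolding reaction_def by linarith
    also have "\<dots> \<le> C * ?W" using d1 d2 by (simp add: C_def algebra_simps)
    finally show ?thesis .
  qed
  then show ?thesis unfolding reaction_Lipschitz_on_def by blast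
qed

end

lemma reaction_Lipschitz:
  assumes M: "M \<ge> 0" shows "\<exists>C\<ge>1. \<forall>z\<in>J \<times> I. reaction_Lipschitz_on M C (fst z) (snd z)"
proof (rule finite_uniform_bound)
  show "finite (J \<times> I)" using finite_J finite_I by simp
  show "\<exists>C. reaction_Lipschitz_on M C (fst z) (snd z)" if "z \<in> J \<times> I" for z
    using that reaction_Lipschitz_chart[OF _ _ M] by auto
  fix z and C C' :: real
  assume C: "reaction_Lipschitz_on M C (fst z) (snd z)" and CC: "C \<le> C'"
  have "C * (norm (x - y) + norm (a - a') + norm (b - b')) \<le> C' * (norm (x - y) + norm (a - a') + norm (b - b'))" for x y a a' b b' :: 'e
    using CC by (intro mult_right_mono) auto
  then show "reaction_Lipschitz_on M C' (fst z) (snd z)"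
    using C unfolding reaction_Lipschitz_on_def by (blast intro: order_trans)
qed

definition along :: "(real \<Rightarrow> real \<Rightarrow> 'm) \<Rightarrow> 'm \<times> 'e \<Rightarrow> real \<times> real \<Rightarrow> real" where
  "along u j z = emb j (u (fst z) (snd z))"

lemma along_smooth:
  assumes "smooth_cylinder A T u" "fat (T \<times> (UNIV :: real set))" "j \<in> J" shows "smooth_on (T \<times> UNIV) (along u j)"
  using smooth_function_along[OF emb_smooth[OF assms(3)], of "T \<times> UNIV" "\<lambda>(s, t). u s t"] assms
  by (simp add: smooth_cylinder_def along_def[abs_def] case_prod_beta')

definition chart_dt :: "'m \<Rightarrow> (real \<Rightarrow> real \<Rightarrow> 'm) \<Rightarrow> real \<Rightarrow> real \<Rightarrow> 'e" where
  "chart_dt l u s t = vector_derivative (\<lambda>r. \<phi> l (u s r)) (at t)"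

context
  fixes T u \<Omega> s t l
  assumes cyl: "smooth_cylinder A T u" and fatT: "fat (T \<times> UNIV :: (real \<times> real) set)"
    and \<Omega>: "open \<Omega>" "\<Omega> \<subseteq> T \<times> UNIV" "(s, t) \<in> \<Omega>" and l: "l \<in> I" and dom: "u s t \<in> dom_chart (ch l)"
begin

definition nbhd :: "(real \<times> real) set" where
  "nbhd = \<Omega> \<inter> (\<lambda>z. u (fst z) (snd z)) -` dom_chart (ch l)"

lemma cyl_smooth: "smooth_map A (T \<times> UNIV) (\<lambda>z. u (fst z) (snd z))"
  using cyl by (simp add: smooth_cylinder_def case_prod_beta')

lemma nbhd: "open nbhd" "(s, t) \<in> nbhd" "nbhd \<subseteq> \<Omega>"
proof -
  have "continuous_on \<Omega> (\<lambda>z. u (fst z) (snd z))"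
    using cyl_smooth \<Omega>(2) unfolding smooth_map_def by (meson continuous_on_subset)
  then show "open nbhd" unfolding nbhd_def by (rule preimage_open[OF _ \<Omega>(1) chart_facts(1)[OF ch[OF l]]])
qed (use \<Omega> dom in \<open>auto simp: nbhd_def\<close>)

definition X :: "real \<times> real \<Rightarrow> 'e" where
  "X z = \<phi> l (u (fst z) (snd z))"

lemma X_smooth: "smooth_on nbhd X"
proof -
  have "smooth_on ((T \<times> UNIV) \<inter> (\<lambda>z. u (fst z) (snd z)) -` dom_chart (ch l)) X"
    using cyl_smooth ch[OF l] by (auto simp: smooth_map_def comp_def X_def[abs_def])
  from smooth_on_Int_open[OF this nbhd(1)]
  have "smooth_on ((T \<times> UNIV) \<inter> (\<lambda>z. u (fst z) (snd z)) -` dom_chart (ch l) \<inter> nbhd) X" .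
  moreover have "(T \<times> UNIV) \<inter> (\<lambda>z. u (fst z) (snd z)) -` dom_chart (ch l) \<inter> nbhd = nbhd"
    using \<Omega>(2) by (auto simp: nbhd_def)
  ultimately show ?thesis by simp
qed

lemma X_img: "z \<in> nbhd \<Longrightarrow> X z \<in> img_chart (ch l)"
  by (auto simp: nbhd_def X_def app_in_img)

lemma X_deriv: "z \<in> nbhd \<Longrightarrow> (X has_derivative frechet_derivative X (at z)) (at z)"
  by (rule smooth_on_has_derivative_open[OF X_smooth nbhd(1)])

lemma X_slices:
  assumes "(s', t') \<in> nbhd"
  shows "((\<lambda>r. X (r, t')) has_vector_derivative frechet_derivative X (at (s', t')) (1, 0)) (at s')"
    "((\<lambda>r. X (s', r)) has_vector_derivative frechet_derivative X (at (s', t')) (0, 1)) (at t')"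
  using slice_derivatives[OF X_deriv[OF assms]] by auto

lemma chart_dt_eq:
  assumes "(s', t') \<in> nbhd" shows "chart_dt l u s' t' = frechet_derivative X (at (s', t')) (0, 1)"
  using vector_derivative_at[OF X_slices(2)[OF assms]] by (simp add: chart_dt_def X_def)

lemma along_X: "z \<in> nbhd \<Longrightarrow> along u j z = coord j l (X z)"
  by (auto simp: along_def coord_def X_def nbhd_def inv_app[OF ch[OF l]])

lemma along_deriv:
  assumes j: "j \<in> J" and z: "z \<in> nbhd"
  shows "frechet_derivative (along u j) (at z within T \<times> UNIV) = (\<lambda>v. dcoord j l (X z) (frechet_derivative X (at z) v))"
proof -
  have "((\<lambda>z. coord j l (X z)) has_derivative (\<lambda>v. dcoord j l (X z) (frechet_derivative X (at z) v))) (at z)"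
    unfolding dcoord_def
    by (rule has_derivative_compose[OF X_deriv[OF z] smooth_on_has_derivative_open[OF coord_smooth[OF j l] chart_facts(2)[OF ch[OF l]] X_img[OF z]]])
  then have d: "(along u j has_derivative (\<lambda>v. dcoord j l (X z) (frechet_derivative X (at z) v))) (at z)"
    by (rule has_derivative_transform_within_open[OF _ nbhd(1) z]) (simp add: along_X)
  have "z \<in> T \<times> UNIV" using z nbhd(3) \<Omega>(2) by auto
  then show ?thesis by (rule frechet_derivative_fat[OF fatT _ has_derivative_at_withinI[OF d]])
qed

text \<open>In coordinates the heat equation is \<open>\<partial>\<^sub>s x = \<partial>\<^sub>t\<^sup>2 x + \<Gamma>(\<partial>\<^sub>t x, \<partial>\<^sub>t x) + grad\<close>. For a scalar function \<open>f\<close>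
  both \<open>\<partial>\<^sub>s f(x)\<close> and \<open>\<partial>\<^sub>t\<^sup>2 f(x)\<close> contain \<open>df(\<partial>\<^sub>t\<^sup>2 x)\<close>, which cancels and leaves first order terms only.\<close>

lemma heat_equation_along:
  assumes j: "j \<in> J" and heat: "heat_solution A g grad T u"
  shows "part_s (T \<times> UNIV) (along u j) (s, t) - part_t (T \<times> UNIV) (part_t (T \<times> UNIV) (along u j)) (s, t)
    = reaction j l (\<phi> l (u s t)) (chart_dt l u s t) (grad (u s) t (ch l))"
proof -
  let ?c = "ch l" and ?S = "T \<times> (UNIV :: real set)"
  define x where "x = \<phi> l (u s t)"
  define Xt where "Xt = (\<lambda>z. frechet_derivative X (at z) (0, 1))"
  define a where "a = chart_dt l u s t"
  define Xs where "Xs = frechet_derivative X (at (s, t)) (1, 0)"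
  define Xtt where "Xtt = frechet_derivative Xt (at (s, t)) (0, 1)"
  have xX: "X (s, t) = x" by (simp add: X_def x_def)
  have aX: "Xt (s, t) = a" using chart_dt_eq[OF nbhd(2)] by (simp add: Xt_def a_def)
  have sXt: "smooth_on nbhd Xt" unfolding Xt_def[abs_def] by (rule smooth_on_derivative_open[OF X_smooth nbhd(1)])
  have dXt: "(Xt has_derivative frechet_derivative Xt (at (s, t))) (at (s, t))"
    by (rule smooth_on_has_derivative_open[OF sXt nbhd(1,2)])
  have inat: "?c \<in> charts_at A (u s t)" using dom ch[OF l] by (simp add: charts_at_def)
  have sT: "at s within T = at s"
  proof -
    obtain U W where U: "open U" "open W" "(s, t) \<in> U \<times> W" "U \<times> W \<subseteq> \<Omega>"
      using open_prod_elim[OF \<Omega>(1,3)] .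
    then have "U \<subseteq> T" using \<Omega>(2) by auto
    then show ?thesis using U at_within_open_subset[of s U T] by auto
  qed
  have "d_s A T u s t ?c = Xs"
    using inat vector_derivative_at[OF X_slices(1)[OF nbhd(2)]] by (simp add: velocity_def sT X_def Xs_def)
  moreover have "d_t A u s t ?c = a" "velocity A UNIV (u s) t ?c = a"
    using inat by (auto simp: velocity_def a_def chart_dt_def)
  moreover have "vector_derivative (\<lambda>r. d_t A u s r ?c) (at t) = Xtt"
  proof -
    have 1: "((\<lambda>r. Xt (s, r)) has_vector_derivative Xtt) (at t)"
      unfolding Xtt_def by (rule slice_derivatives(2)[OF dXt])
    have 2: "open {r. (s, r) \<in> nbhd}"
      using continuous_open_preimage[OF continuous_on_Pair[OF continuous_on_const[of UNIV s] continuous_on_id] open_UNIV nbhd(1)]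
      by (simp add: vimage_def)
    have 3: "Xt (s, r) = d_t A u s r ?c" if "r \<in> {r. (s, r) \<in> nbhd}" for r
      using that chart_dt_eq[of s r] ch[OF l] by (auto simp: velocity_def Xt_def chart_dt_def charts_at_def nbhd_def)
    have "((\<lambda>r. d_t A u s r ?c) has_vector_derivative Xtt) (at t)"
      by (rule has_vector_derivative_transform_within_open[OF 1 2 _ 3]) (use nbhd(2) in simp)
    then show ?thesis by (rule vector_derivative_at)
  qed
  ultimately have "cov_deriv A g UNIV (u s) (d_t A u s) t ?c = Xtt + \<Gamma> ?c x a a"
    using inat by (simp add: cov_deriv_def x_def)
  moreover have "s \<in> T" using \<Omega> by auto
  then have "d_s A T u s t ?c - cov_deriv A g UNIV (u s) (d_t A u s) t ?c - grad (u s) t ?c = 0"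
    using heat inat unfolding heat_solution_def by blast
  ultimately have eq: "Xs = Xtt + \<Gamma> ?c x a a + grad (u s) t ?c"
    using \<open>d_s A T u s t ?c = Xs\<close> by (simp add: algebra_simps)
  have ps: "part_s ?S (along u j) (s, t) = dcoord j l x Xs"
    using along_deriv[OF j nbhd(2)] by (simp add: part_s_def xX Xs_def)
  have "((\<lambda>z. dcoord j l (X z) (Xt z)) has_derivative
      (\<lambda>v. frechet_derivative (\<lambda>y. dcoord j l y (Xt (s, t))) (at (X (s, t))) (frechet_derivative X (at (s, t)) v)
         + dcoord j l (X (s, t)) (frechet_derivative Xt (at (s, t)) v))) (at (s, t))"
    by (rule linear_family_has_derivative[OF dcoord_smooth[OF j l] dcoord_linear[OF j l] chart_facts(2)[OF ch[OF l]]
          X_deriv[OF nbhd(2)] X_img[OF nbhd(2)] dXt])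
  then have "(part_t ?S (along u j) has_derivative
      (\<lambda>v. frechet_derivative (\<lambda>y. dcoord j l y (Xt (s, t))) (at (X (s, t))) (frechet_derivative X (at (s, t)) v)
         + dcoord j l (X (s, t)) (frechet_derivative Xt (at (s, t)) v))) (at (s, t))"
    by (rule has_derivative_transform_within_open[OF _ nbhd(1,2)]) (simp add: part_t_def along_deriv[OF j] Xt_def)
  from frechet_derivative_fat[OF fatT _ has_derivative_at_withinI[OF this]] \<Omega>
  have "part_t ?S (part_t ?S (along u j)) (s, t) = ddcoord j l x a a + dcoord j l x Xtt"
    using aX by (auto simp: part_t_def[of _ "part_t _ _"] ddcoord_def xX Xtt_def Xt_def)
  moreover have "linear (dcoord j l x)" using dcoord_linear[OF j l X_img[OF nbhd(2)]] xX by simp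
  ultimately show ?thesis
    unfolding ps eq reaction_def x_def[symmetric] a_def[symmetric] by (simp add: linear_add)
qed

text \<open>Near a point where the cutoff is one, chart coordinates are among the embedding coordinates, so
  their derivatives are derivatives of functions that are globally defined on the cylinder.\<close>

lemma chart_dt_components:
  assumes "u s t \<in> ball_region l 3" "b \<in> Basis"
  shows "chart_dt l u s t \<bullet> b = part_t (T \<times> UNIV) (along u (l, b)) (s, t)"
proof -
  have j: "(l, b) \<in> J" using assms l by (simp add: J_def)
  let ?N = "nbhd \<inter> (\<lambda>z. u (fst z) (snd z)) -` ball_region l 3"
  have "continuous_on nbhd (\<lambda>z. u (fst z) (snd z))"
    using cyl_smooth nbhd(3) \<Omega>(2) unfolding smooth_map_def by (meson continuous_on_subset)
  then have N: "open ?N" by (rule preimage_open[OF _ nbhd(1) ball_region_open[OF l]])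
  have "((\<lambda>z. X z \<bullet> b) has_derivative (\<lambda>v. frechet_derivative X (at (s, t)) v \<bullet> b)) (at (s, t))"
    by (intro has_derivative_inner_left X_deriv nbhd(2))
  then have "(along u (l, b) has_derivative (\<lambda>v. frechet_derivative X (at (s, t)) v \<bullet> b)) (at (s, t))"
  proof (rule has_derivative_transform_within_open[OF _ N])
    show "(s, t) \<in> ?N" using assms nbhd(2) by simp
    fix z assume "z \<in> ?N"
    then have "cut 3 l (u (fst z) (snd z)) = 1" by (intro cut_one[OF l]) (auto simp: ball_region_def cball_region_def)
    then show "X z \<bullet> b = along u (l, b) z" using assms(2) by (auto simp: X_def along_def emb_def nonzero_Basis)
  qed
  from frechet_derivative_fat[OF fatT _ has_derivative_at_withinI[OF this]] \<Omega>
  show ?thesis using chart_dt_eq[OF nbhd(2)] by (auto simp: part_t_def)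
qed

end

end

section \<open>Uniqueness\<close>

lemma periodic_frac:
  fixes x :: "real \<Rightarrow> 'a"
  assumes "\<And>t. x (t + 1) = x t"
  shows "x (frac t) = x t"
proof -
  interpret periodic_fun_simple' x by standard (rule assms)
  have "x (frac t + of_int \<lfloor>t\<rfloor>) = x (frac t)" by (rule plus_of_int)
  then show ?thesis by (simp add: frac_def)
qed

lemma frac_in_unit: "frac (t :: real) \<in> {0..1}"
  using frac_ge_0[of t] frac_lt_1[of t] by simp

text \<open>At the infimum of the parameters where \<open>P\<close> fails, \<open>P\<close> holds by closedness, and then also a little
  beyond.\<close>

lemma forward_continuation:
  fixes P :: "real \<Rightarrow> bool"
  assumes P0: "P 0" and closed: "closed {s \<in> {0..}. P s}"
    and step: "\<And>s. 0 \<le> s \<Longrightarrow> P s \<Longrightarrow> \<exists>\<eta>>0. \<forall>r\<in>{s..s+\<eta>}. P r"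
    and s: "0 \<le> s"
  shows "P s"
proof (rule ccontr)
  assume nP: "\<not> P s"
  define B where "B = {r \<in> {0..}. \<not> P r}"
  have ne: "B \<noteq> {}" and bd: "bdd_below B" using nP s by (auto simp: B_def)
  define m where "m = Inf B"
  have m0: "0 \<le> m" unfolding m_def by (rule cInf_greatest[OF ne]) (auto simp: B_def)
  have below: "P r" if "0 \<le> r" "r < m" for r
    using that cInf_lower[OF _ bd, of r] by (auto simp: B_def m_def)
  have "P m"
  proof (cases "m = 0")
    case False
    then have "0 < m" using m0 by simp
    have "closure {0..<m} \<subseteq> {s \<in> {0..}. P s}" by (rule closure_minimal[OF _ closed]) (use below in auto)
    then have "m \<in> {s \<in> {0..}. P s}" by (rule subsetD) (use \<open>0 < m\<close> in simp)
    then show ?thesis by simp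
  qed (use P0 in simp)
  then obtain \<eta> where \<eta>: "\<eta> > 0" "\<And>r. r \<in> {m..m+\<eta>} \<Longrightarrow> P r" using step[OF m0] by blast
  have "Inf B < m + \<eta>" using \<eta>(1) by (simp add: m_def)
  then obtain b where b: "b \<in> B" "b < m + \<eta>" using cInf_lessD[OF ne] by blast
  then have "m \<le> b" using cInf_lower[OF b(1) bd] by (simp add: m_def)
  then show False using \<eta>(2)[of b] b by (auto simp: B_def)
qed

context ball_cover
begin

text \<open>Coordinate vectors in a ball are controlled by the embedding components that belong to this ball.\<close>

lemma norm_le_J:
  assumes l: "l \<in> I" and h: "\<And>b. b \<in> Basis \<Longrightarrow> x \<bullet> b = h (l, b)"
  shows "norm (x :: 'e) \<le> (\<Sum>j\<in>J. \<bar>h j\<bar>)"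
proof -
  have "norm x \<le> (\<Sum>b\<in>Basis. \<bar>x \<bullet> b\<bar>)" by (rule norm_le_l1)
  also have "\<dots> = (\<Sum>j\<in>Pair l ` Basis. \<bar>h j\<bar>)"
    by (subst sum.reindex) (auto simp: inj_on_def h)
  also have "\<dots> \<le> (\<Sum>j\<in>J. \<bar>h j\<bar>)"
    by (rule sum_mono2) (use finite_J l in \<open>auto simp: J_def\<close>)
  finally show ?thesis .
qed

lemma cylinder_D_continuous:
  assumes "smooth_cylinder A T u" "smooth_cylinder A T v" "fat (T \<times> (UNIV :: real set))"
  shows "continuous_on (T \<times> UNIV) (\<lambda>z. D (u (fst z) (snd z)) (v (fst z) (snd z)))"
  using smooth_on_imp_continuous_on[OF along_smooth[OF assms(1,3)]] smooth_on_imp_continuous_on[OF along_smooth[OF assms(2,3)]]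
  unfolding D_def along_def[abs_def] by (intro continuous_intros) auto

end

context perturbed
begin

context
  fixes T u v \<alpha> \<beta>
  assumes hu: "heat_solution A g grad T u" and hv: "heat_solution A g grad T v"
    and fatT: "fat (T \<times> (UNIV :: real set))" and ab: "\<alpha> < \<beta>" "{\<alpha>..\<beta>} \<subseteq> T"
begin

abbreviation (input) "S \<equiv> T \<times> (UNIV :: real set)"

definition diff :: "'m \<times> 'e \<Rightarrow> real \<times> real \<Rightarrow> real" where
  "diff j z = along u j z - along v j z"

lemma cylinders: "smooth_cylinder A T u" "smooth_cylinder A T v"
  using hu hv by (auto simp: heat_solution_def)

lemma diff_smooth: "j \<in> J \<Longrightarrow> smooth_on S (diff j)"
  unfolding diff_def[abs_def] by (intro smooth_on_diff fatT along_smooth cylinders)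

lemma D_diff: "D (u s t) (v s t) = (\<Sum>j\<in>J. \<bar>diff j (s, t)\<bar>)"
  by (simp add: D_def diff_def along_def)

text \<open>The embedding components of a cylinder have continuous derivatives up to its boundary, which are
  therefore bounded on compact pieces.\<close>

lemma chart_dt_bounded:
  "\<exists>M\<ge>0. \<forall>s\<in>{\<alpha><..<\<beta>}. \<forall>t\<in>{0..1}. \<forall>l\<in>I. \<forall>w\<in>{u, v}. w s t \<in> ball_region l 3 \<longrightarrow> norm (chart_dt l w s t) \<le> M"
proof -
  have "\<exists>M\<ge>0. \<forall>s\<in>{\<alpha><..<\<beta>}. \<forall>t\<in>{0..1}. \<forall>l\<in>I. w s t \<in> ball_region l 3 \<longrightarrow> norm (chart_dt l w s t) \<le> M"
    if cyl: "smooth_cylinder A T w" for w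
  proof -
    have "continuous_on ({\<alpha>..\<beta>} \<times> {0..1}) (\<lambda>z. \<Sum>j\<in>J. \<bar>part_t S (along w j) z\<bar>)"
      using ab(2) by (intro continuous_intros continuous_on_subset[OF smooth_on_imp_continuous_on[OF smooth_part(2)[OF along_smooth[OF cyl fatT]]]]) auto
    then have "bounded ((\<lambda>z. \<Sum>j\<in>J. \<bar>part_t S (along w j) z\<bar>) ` ({\<alpha>..\<beta>} \<times> {0..1}))"
      by (intro compact_imp_bounded compact_continuous_image compact_Times) auto
    then obtain M where M: "\<And>z. z \<in> {\<alpha>..\<beta>} \<times> {0..1} \<Longrightarrow> \<bar>\<Sum>j\<in>J. \<bar>part_t S (along w j) z\<bar>\<bar> \<le> M"
      unfolding bounded_iff by (metis imageI real_norm_def)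
    have "norm (chart_dt l w s t) \<le> max M 0"
      if "s \<in> {\<alpha><..<\<beta>}" "t \<in> {0..1}" "l \<in> I" "w s t \<in> ball_region l 3" for s t l
    proof -
      have "norm (chart_dt l w s t) \<le> (\<Sum>j\<in>J. \<bar>part_t S (along w j) (s, t)\<bar>)"
        by (rule norm_le_J[OF that(3)], rule chart_dt_components[OF cyl fatT, of "{\<alpha><..<\<beta>} \<times> UNIV"])
          (use that ab(2) in \<open>auto simp: ball_region_def open_Times\<close>)
      also have "\<dots> \<le> M" using M[of "(s, t)"] that by auto
      finally show ?thesis by simp
    qed
    then show ?thesis by (intro exI[of _ "max M 0"]) auto
  qed
  from this[OF cylinders(1)] this[OF cylinders(2)]
  obtain M M' where "M \<ge> 0" "M' \<ge> 0"
    and M: "\<And>s t l. s \<in> {\<alpha><..<\<beta>} \<Longrightarrow> t \<in> {0..1} \<Longrightarrow> l \<in> I \<Longrightarrow> u s t \<in> ball_region l 3 \<Longrightarrow> norm (chart_dt l u s t) \<le> M"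
      "\<And>s t l. s \<in> {\<alpha><..<\<beta>} \<Longrightarrow> t \<in> {0..1} \<Longrightarrow> l \<in> I \<Longrightarrow> v s t \<in> ball_region l 3 \<Longrightarrow> norm (chart_dt l v s t) \<le> M'"
    by metis
  then show ?thesis
    by (intro exI[of _ "max M M'"]) (auto simp: le_max_iff_disj)
qed

text \<open>Subtract the equations satisfied by the embedding components of \<open>u\<close> and \<open>v\<close>, written in a common
  chart. The right hand sides are Lipschitz in position, velocity and gradient. Position and velocity
  differences are embedding components of the difference and their derivatives; for the gradients
  this is the Lipschitz estimate on the loop space, which contributes the nonlocal term.\<close>

lemma parabolic_difference:
  assumes grad_Lip: "CG \<ge> 0" "\<epsilon> \<le> \<delta>" "gradient_Lipschitz_within \<epsilon> CG"
    and close: "\<And>s t. s \<in> {\<alpha>..\<beta>} \<Longrightarrow> D (u s t) (v s t) < \<epsilon>"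
  shows "\<exists>C. parabolic_family J \<alpha> \<beta> C (\<lambda>j s t. diff j (s, t)) (\<lambda>j s t. part_s S (diff j) (s, t))
     (\<lambda>j s t. part_t S (diff j) (s, t)) (\<lambda>j s t. part_t S (part_t S (diff j)) (s, t)) (\<lambda>j s t. part_s S (part_t S (diff j)) (s, t))"
proof -
  define \<Omega> where "\<Omega> = {\<alpha><..<\<beta>} \<times> (UNIV :: real set)"
  have \<Omega>: "open \<Omega>" "\<Omega> \<subseteq> S" using ab(2) by (auto simp: \<Omega>_def open_Times)
  obtain M1 where M1: "M1 \<ge> 0" "\<And>s t l w. s \<in> {\<alpha><..<\<beta>} \<Longrightarrow> t \<in> {0..1} \<Longrightarrow> l \<in> I \<Longrightarrow> w \<in> {u, v} \<Longrightarrow>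
      w s t \<in> ball_region l 3 \<Longrightarrow> norm (chart_dt l w s t) \<le> M1"
    using chart_dt_bounded by blast
  obtain N where N: "N \<ge> 0" "\<And>x i t. x \<in> loop_space A \<Longrightarrow> i \<in> I \<Longrightarrow> x t \<in> cball_region i 3 \<Longrightarrow> norm (grad x t (ch i)) \<le> N"
    using grad_chart_bounded by blast
  define M where "M = max M1 N"
  have M0: "M \<ge> 0" using M1(1) by (simp add: M_def)
  obtain K where K: "K \<ge> 1" "\<And>j l. j \<in> J \<Longrightarrow> l \<in> I \<Longrightarrow> reaction_Lipschitz_on M K j l"
    using reaction_Lipschitz[OF M0] by fastforce
  define C where "C = K * (1 + CG)"
  have C0: "C \<ge> 0" using K(1) grad_Lip(1) by (simp add: C_def)
  have ineq: "\<bar>part_s S (diff j) (s, t) - part_t S (part_t S (diff j)) (s, t)\<bar> \<le>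
      C * ((\<Sum>k\<in>J. \<bar>diff k (s, t)\<bar>) + (\<Sum>k\<in>J. \<bar>part_t S (diff k) (s, t)\<bar>) + (\<Sum>k\<in>J. integral {0..1} (\<lambda>\<tau>. \<bar>diff k (s, \<tau>)\<bar>)))"
    if j: "j \<in> J" and s: "s \<in> {\<alpha><..<\<beta>}" and t: "t \<in> {0..1}" for j s t
  proof -
    have st: "(s, t) \<in> \<Omega>" "(s, t) \<in> S" and sT: "s \<in> T" using s ab(2) by (auto simp: \<Omega>_def)
    have loops: "u s \<in> loop_space A" "v s \<in> loop_space A" using loop_of_cylinder cylinders sT by blast+
    have cl: "D (u s t) (v s t) < \<epsilon>" for t using close s by simp
    obtain l where l: "l \<in> I" "v s t \<in> ball_region l 1" using region_cover by blast
    have vl: "v s t \<in> ball_region l 3" "v s t \<in> cball_region l 2" "v s t \<in> cball_region l (5/2)"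
      using l rad[OF l(1)] by (auto simp: ball_region_def cball_region_def)
    have ul: "u s t \<in> ball_region l 3" "norm (\<phi> l (u s t) - \<phi> l (v s t)) \<le> D (u s t) (v s t)"
      using adjacent[OF l(1) vl(3), of "u s t"] cl[of t] grad_Lip(2) by auto
    have doms: "u s t \<in> dom_chart (ch l)" "v s t \<in> dom_chart (ch l)" using ul vl by (auto simp: ball_region_def)
    have cb: "u s t \<in> cball_region l 3" "v s t \<in> cball_region l 3"
      using ul(1) vl(1) by (auto simp: ball_region_def cball_region_def)
    let ?au = "chart_dt l u s t" and ?av = "chart_dt l v s t" and ?gu = "grad (u s) t (ch l)" and ?gv = "grad (v s) t (ch l)"
    note eu = heat_equation_along[OF cylinders(1) fatT \<Omega> st(1) l(1) doms(1) j hu]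
    note ev = heat_equation_along[OF cylinders(2) fatT \<Omega> st(1) l(1) doms(2) j hv]
    have sm: "smooth_on S (along u k)" "smooth_on S (along v k)" if "k \<in> J" for k
      using along_smooth cylinders fatT that by blast+
    have dt: "part_t S (diff k) z = part_t S (along u k) z - part_t S (along v k) z" if "k \<in> J" "z \<in> S" for k z
      unfolding diff_def[abs_def] by (rule part_diff(2)[OF fatT sm[OF that(1)] that(2)])
    have "part_s S (diff j) (s, t) = part_s S (along u j) (s, t) - part_s S (along v j) (s, t)"
      unfolding diff_def[abs_def] by (rule part_diff(1)[OF fatT sm[OF j] st(2)])
    moreover have "part_t S (part_t S (diff j)) (s, t) = part_t S (\<lambda>z. part_t S (along u j) z - part_t S (along v j) z) (s, t)"
      by (rule part_t_cong[OF st(2) dt[OF j]])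
    moreover have "\<dots> = part_t S (part_t S (along u j)) (s, t) - part_t S (part_t S (along v j)) (s, t)"
      by (rule part_diff(2)[OF fatT smooth_part(2)[OF sm(1)[OF j]] smooth_part(2)[OF sm(2)[OF j]] st(2)])
    ultimately have "\<bar>part_s S (diff j) (s, t) - part_t S (part_t S (diff j)) (s, t)\<bar> =
       \<bar>reaction j l (\<phi> l (u s t)) ?au ?gu - reaction j l (\<phi> l (v s t)) ?av ?gv\<bar>"
      using eu ev by simp
    also have "\<dots> \<le> K * (norm (\<phi> l (u s t) - \<phi> l (v s t)) + norm (?au - ?av) + norm (?gu - ?gv))"
    proof (rule K(2)[OF j l(1), unfolded reaction_Lipschitz_on_def, rule_format])
      show "\<phi> l (u s t) \<in> cball (ctr l) (3 * rad l)" "\<phi> l (v s t) \<in> cball (ctr l) (3 * rad l)"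
        using cb by (auto simp: cball_region_def)
      show "norm ?au \<le> M" "norm ?av \<le> M"
        using M1(2)[OF s t l(1), of u] M1(2)[OF s t l(1), of v] ul(1) vl(1) by (auto simp: M_def le_max_iff_disj)
      show "norm ?gu \<le> M" "norm ?gv \<le> M"
        using N(2)[OF loops(1) l(1) cb(1)] N(2)[OF loops(2) l(1) cb(2)] by (auto simp: M_def le_max_iff_disj)
    qed
    also have "\<dots> \<le> K * (D (u s t) (v s t) + (\<Sum>k\<in>J. \<bar>part_t S (diff k) (s, t)\<bar>)
        + CG * (D (u s t) (v s t) + integral {0..1} (\<lambda>\<tau>. D (u s \<tau>) (v s \<tau>))))"
    proof (intro mult_left_mono add_mono ul(2))
      show "norm (?au - ?av) \<le> (\<Sum>k\<in>J. \<bar>part_t S (diff k) (s, t)\<bar>)"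
      proof (rule norm_le_J[OF l(1)])
        fix b :: 'e assume b: "b \<in> Basis"
        then have "(l, b) \<in> J" using l(1) by (simp add: J_def)
        then show "(?au - ?av) \<bullet> b = part_t S (diff (l, b)) (s, t)"
          using chart_dt_components[OF cylinders(1) fatT \<Omega> st(1) l(1) doms(1) ul(1) b]
            chart_dt_components[OF cylinders(2) fatT \<Omega> st(1) l(1) doms(2) vl(1) b] dt st(2)
          by (simp add: inner_diff_left)
      qed
      show "norm (?gu - ?gv) \<le> CG * (D (u s t) (v s t) + integral {0..1} (\<lambda>\<tau>. D (u s \<tau>) (v s \<tau>)))"
        using grad_Lip(3) loops cl l(1) vl(2) unfolding gradient_Lipschitz_within_def by (simp add: norm_minus_commute)
    qed (use K(1) in simp)
    also have "\<dots> \<le> K * ((1 + CG) * (D (u s t) (v s t) + (\<Sum>k\<in>J. \<bar>part_t S (diff k) (s, t)\<bar>) + integral {0..1} (\<lambda>\<tau>. D (u s \<tau>) (v s \<tau>))))"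
    proof (rule mult_left_mono)
      have "0 \<le> (\<Sum>k\<in>J. \<bar>part_t S (diff k) (s, t)\<bar>)" by (rule sum_nonneg) auto
      moreover have "0 \<le> integral {0..1} (\<lambda>\<tau>. D (u s \<tau>) (v s \<tau>))"
        by (intro integral_nonneg integrable_continuous_real D_loop_continuous loops D_nonneg)
      ultimately show "D (u s t) (v s t) + (\<Sum>k\<in>J. \<bar>part_t S (diff k) (s, t)\<bar>)
        + CG * (D (u s t) (v s t) + integral {0..1} (\<lambda>\<tau>. D (u s \<tau>) (v s \<tau>)))
        \<le> (1 + CG) * (D (u s t) (v s t) + (\<Sum>k\<in>J. \<bar>part_t S (diff k) (s, t)\<bar>) + integral {0..1} (\<lambda>\<tau>. D (u s \<tau>) (v s \<tau>)))"
        using grad_Lip(1) by (simp add: algebra_simps)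
    qed (use K(1) in simp)
    also have "integral {0..1} (\<lambda>\<tau>. D (u s \<tau>) (v s \<tau>)) = (\<Sum>k\<in>J. integral {0..1} (\<lambda>\<tau>. \<bar>diff k (s, \<tau>)\<bar>))"
      unfolding D_diff
      by (intro Henstock_Kurzweil_Integration.integral_sum finite_J integrable_continuous_real continuous_intros)
        (auto simp: diff_def along_def intro!: continuous_intros emb_loop_continuous loops)
    finally show ?thesis by (simp add: C_def D_diff mult.assoc)
  qed
  have "parabolic_family J \<alpha> \<beta> C (\<lambda>j s t. diff j (s, t)) (\<lambda>j s t. part_s S (diff j) (s, t))
     (\<lambda>j s t. part_t S (diff j) (s, t)) (\<lambda>j s t. part_t S (part_t S (diff j)) (s, t)) (\<lambda>j s t. part_s S (part_t S (diff j)) (s, t))"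
  proof
    fix j assume j: "j \<in> J"
    note sm = diff_smooth[OF j] and ps = smooth_part(1)[OF diff_smooth[OF j]] and pt = smooth_part(2)[OF diff_smooth[OF j]]
    have cont: "continuous_on (Q \<times> UNIV) (\<lambda>(s, t). f (s, t))" if "smooth_on S f" "Q \<subseteq> T" for f :: "real \<times> real \<Rightarrow> real" and Q
      using continuous_on_subset[OF smooth_on_imp_continuous_on[OF that(1)], of "Q \<times> UNIV"] that(2)
      by (auto simp: case_prod_eta)
    have sub: "{\<alpha><..<\<beta>} \<subseteq> T" using ab(2) by auto
    show "continuous_on ({\<alpha>..\<beta>} \<times> UNIV) (\<lambda>(s, t). diff j (s, t))" by (rule cont[OF sm ab(2)])
    show "continuous_on ({\<alpha><..<\<beta>} \<times> UNIV) (\<lambda>(s, t). part_s S (diff j) (s, t))" by (rule cont[OF ps sub])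
    show "continuous_on ({\<alpha><..<\<beta>} \<times> UNIV) (\<lambda>(s, t). part_t S (diff j) (s, t))" by (rule cont[OF pt sub])
    show "continuous_on ({\<alpha><..<\<beta>} \<times> UNIV) (\<lambda>(s, t). part_t S (part_t S (diff j)) (s, t))" by (rule cont[OF smooth_part(2)[OF pt] sub])
    show "continuous_on ({\<alpha><..<\<beta>} \<times> UNIV) (\<lambda>(s, t). part_s S (part_t S (diff j)) (s, t))" by (rule cont[OF smooth_part(1)[OF pt] sub])
    fix s t :: real assume s: "s \<in> {\<alpha><..<\<beta>}"
    then have st: "(s, t) \<in> \<Omega>" by (simp add: \<Omega>_def)
    show "((\<lambda>s. diff j (s, t)) has_real_derivative part_s S (diff j) (s, t)) (at s)"
      "((\<lambda>t. diff j (s, t)) has_real_derivative part_t S (diff j) (s, t)) (at t)"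
      by (rule partial_derivatives[OF sm \<Omega> st])+
    show "((\<lambda>t. part_t S (diff j) (s, t)) has_real_derivative part_t S (part_t S (diff j)) (s, t)) (at t)"
      "((\<lambda>s. part_t S (diff j) (s, t)) has_real_derivative part_s S (part_t S (diff j)) (s, t)) (at s)"
      by (rule partial_derivatives[OF pt \<Omega> st])+
    show "((\<lambda>t. part_s S (diff j) (s, t)) has_real_derivative part_s S (part_t S (diff j)) (s, t)) (at t)"
      using partial_derivatives(2)[OF ps \<Omega> st] mixed_partials[OF sm \<Omega> st] by simp
    show "diff j (s, t + 1) = diff j (s, t)"
      using cylinders s sub by (auto simp: diff_def along_def smooth_cylinder_def)
    assume "t \<in> {0..1}"
    then show "\<bar>part_s S (diff j) (s, t) - part_t S (part_t S (diff j)) (s, t)\<bar> \<le>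
      C * ((\<Sum>k\<in>J. \<bar>diff k (s, t)\<bar>) + (\<Sum>k\<in>J. \<bar>part_t S (diff k) (s, t)\<bar>) + (\<Sum>k\<in>J. integral {0..1} (\<lambda>\<tau>. \<bar>diff k (s, \<tau>)\<bar>)))"
      by (rule ineq[OF j s])
  qed (use finite_J ab C0 in auto)
  then show ?thesis by blast
qed

lemma local_uniqueness:
  assumes grad_Lip: "CG \<ge> 0" "\<epsilon> \<le> \<delta>" "gradient_Lipschitz_within \<epsilon> CG"
    and close: "\<And>s t. s \<in> {\<alpha>..\<beta>} \<Longrightarrow> D (u s t) (v s t) < \<epsilon>"
    and agree: "(\<forall>t. u \<alpha> t = v \<alpha> t) \<or> (\<forall>t. u \<beta> t = v \<beta> t)" and s: "s \<in> {\<alpha>..\<beta>}"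
  shows "u s t = v s t"
proof -
  obtain C where fam: "parabolic_family J \<alpha> \<beta> C (\<lambda>j s t. diff j (s, t)) (\<lambda>j s t. part_s S (diff j) (s, t))
     (\<lambda>j s t. part_t S (diff j) (s, t)) (\<lambda>j s t. part_t S (part_t S (diff j)) (s, t)) (\<lambda>j s t. part_s S (part_t S (diff j)) (s, t))"
    using parabolic_difference[OF grad_Lip close] by blast
  interpret parabolic_family J \<alpha> \<beta> C "\<lambda>j s t. diff j (s, t)" "\<lambda>j s t. part_s S (diff j) (s, t)"
     "\<lambda>j s t. part_t S (diff j) (s, t)" "\<lambda>j s t. part_t S (part_t S (diff j)) (s, t)" "\<lambda>j s t. part_s S (part_t S (diff j)) (s, t)"
    by (rule fam)
  have zero: "energy r = 0" if "\<forall>t. u r t = v r t" for r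
    unfolding energy_def using that by (simp add: diff_def along_def)
  have "energy s = 0" using agree
  proof
    assume "\<forall>t. u \<alpha> t = v \<alpha> t"
    then show ?thesis by (rule forward_uniqueness[OF zero s])
  next
    assume "\<forall>t. u \<beta> t = v \<beta> t"
    then show ?thesis by (rule backward_uniqueness[OF zero s])
  qed
  then have "D (u s (frac t)) (v s (frac t)) = 0"
    unfolding D_diff using zero_energy[OF _ s _ frac_in_unit[of t]] by simp
  then have "u s (frac t) = v s (frac t)" by (rule D_eq_0_imp_eq)
  then show ?thesis
    using periodic_frac[of "u s" t] periodic_frac[of "v s" t] cylinders s ab(2) by (auto simp: smooth_cylinder_def)
qed

end

text \<open>Where the solutions agree, they remain close for a short time by uniform continuity on compact
  sets, and closeness is all that local uniqueness asks for.\<close>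

lemma extension_near:
  assumes hu: "heat_solution A g grad T u" and hv: "heat_solution A g grad T v"
    and fatT: "fat (T \<times> (UNIV :: real set))" and T: "closed T" and s0: "s0 \<in> T" "\<forall>t. u s0 t = v s0 t"
  shows "\<exists>\<eta>>0. ({s0..s0+\<eta>} \<subseteq> T \<longrightarrow> (\<forall>r\<in>{s0..s0+\<eta>}. \<forall>t. u r t = v r t)) \<and>
     ({s0-\<eta>..s0} \<subseteq> T \<longrightarrow> (\<forall>r\<in>{s0-\<eta>..s0}. \<forall>t. u r t = v r t))"
proof -
  have cyl: "smooth_cylinder A T u" "smooth_cylinder A T v" using hu hv by (auto simp: heat_solution_def)
  obtain CG \<epsilon> where e: "CG \<ge> 0" "0 < \<epsilon>" "\<epsilon> \<le> \<delta>" and Lip: "gradient_Lipschitz_within \<epsilon> CG"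
    using gradient_Lipschitz by blast
  let ?K = "(T \<inter> cball s0 1) \<times> {0..1::real}"
  let ?f = "\<lambda>z. D (u (fst z) (snd z)) (v (fst z) (snd z))"
  have "continuous_on ?K ?f" by (rule continuous_on_subset[OF cylinder_D_continuous[OF cyl fatT]]) auto
  moreover have "compact ?K" using T by (intro compact_Times closed_Int_compact) auto
  ultimately have "uniformly_continuous_on ?K ?f" by (rule compact_uniformly_continuous)
  then obtain d where d: "d > 0" "\<And>z z'. z \<in> ?K \<Longrightarrow> z' \<in> ?K \<Longrightarrow> dist z' z < d \<Longrightarrow> dist (?f z') (?f z) < \<epsilon>"
    unfolding uniformly_continuous_on_def using e(2) by metis
  define \<eta> where "\<eta> = min 1 (d / 2)"
  have \<eta>: "\<eta> > 0" "\<eta> \<le> 1" "\<eta> < d" using d(1) by (auto simp: \<eta>_def)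
  have close: "D (u s t) (v s t) < \<epsilon>" if s: "s \<in> T" "\<bar>s - s0\<bar> \<le> \<eta>" for s t
  proof -
    have "dist (?f (s, frac t)) (?f (s0, frac t)) < \<epsilon>"
      by (rule d(2)) (use s s0 \<eta> frac_in_unit[of t] in \<open>auto simp: dist_Pair_Pair dist_real_def\<close>)
    then have "D (u s (frac t)) (v s (frac t)) < \<epsilon>" using s0(2) by (simp add: D_self dist_real_def)
    moreover have "u s (frac t) = u s t" "v s (frac t) = v s t"
      using periodic_frac[of "u s" t] periodic_frac[of "v s" t] cyl s(1) by (auto simp: smooth_cylinder_def)
    ultimately show ?thesis by simp
  qed
  have "u r t = v r t" if sub: "{s0..s0+\<eta>} \<subseteq> T" and r: "r \<in> {s0..s0+\<eta>}" for r t
    by (rule local_uniqueness[OF hu hv fatT _ sub e(1,3) Lip close]) (use \<eta> s0 r sub in auto)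
  moreover have "u r t = v r t" if sub: "{s0-\<eta>..s0} \<subseteq> T" and r: "r \<in> {s0-\<eta>..s0}" for r t
    by (rule local_uniqueness[OF hu hv fatT _ sub e(1,3) Lip close]) (use \<eta> s0 r sub in auto)
  ultimately show ?thesis using \<eta>(1) by blast
qed

lemma agreement_closed:
  assumes hu: "heat_solution A g grad T u" and hv: "heat_solution A g grad T v"
    and fatT: "fat (T \<times> (UNIV :: real set))" and T: "closed T"
  shows "closed {s \<in> T. \<forall>t. u s t = v s t}"
proof -
  have cyl: "smooth_cylinder A T u" "smooth_cylinder A T v" using hu hv by (auto simp: heat_solution_def)
  have "closed {s \<in> T. D (u s t) (v s t) = 0}" for t
  proof (rule continuous_closed_preimage_constant[OF _ T])
    show "continuous_on T (\<lambda>s. D (u s t) (v s t))"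
      by (rule continuous_on_compose2[OF cylinder_D_continuous[OF cyl fatT] continuous_on_Pair[OF continuous_on_id continuous_on_const[of T t]], simplified]) auto
  qed
  moreover have "{s \<in> T. \<forall>t. u s t = v s t} = (\<Inter>t. {s \<in> T. D (u s t) (v s t) = 0})"
    using D_eq_0_imp_eq D_self by auto
  ultimately show ?thesis by auto
qed

lemma forward_unique_continuation:
  assumes hu: "heat_solution A g grad {0..} u" and hv: "heat_solution A g grad {0..} v"
    and agree: "\<forall>t. u 0 t = v 0 t" and s: "0 \<le> s"
  shows "\<forall>t. u s t = v s t"
proof (rule forward_continuation[where P="\<lambda>s. \<forall>t. u s t = v s t", OF agree _ _ s])
  show "closed {s \<in> {0..}. \<forall>t. u s t = v s t}" by (rule agreement_closed[OF hu hv fat_halfplanes(1)]) auto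
  fix s :: real assume "0 \<le> s" "\<forall>t. u s t = v s t"
  then show "\<exists>\<eta>>0. \<forall>r\<in>{s..s+\<eta>}. \<forall>t. u r t = v r t"
    using extension_near[OF hu hv fat_halfplanes(1), of s] by fastforce
qed

text \<open>The reflection \<open>s \<mapsto> - s\<close> reduces the continuation argument, though not the local uniqueness behind
  it, to the forward case.\<close>

lemma backward_unique_continuation:
  assumes hu: "heat_solution A g grad {..0} u" and hv: "heat_solution A g grad {..0} v"
    and agree: "\<forall>t. u 0 t = v 0 t" and s: "s \<le> 0"
  shows "\<forall>t. u s t = v s t"
proof -
  have "\<forall>t. u (- (- s)) t = v (- (- s)) t"
  proof (rule forward_continuation[where P="\<lambda>s. \<forall>t. u (- s) t = v (- s) t"])
    have "closed {s \<in> {..0}. \<forall>t. u s t = v s t}" by (rule agreement_closed[OF hu hv fat_halfplanes(2)]) auto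
    then have "closed (uminus ` {s \<in> {..0}. \<forall>t. u s t = v s t})" by (rule closed_negations)
    moreover have "uminus ` {s \<in> {..0}. \<forall>t. u s t = v s t} = {s \<in> {0..}. \<forall>t. u (- s) t = v (- s) t}"
      by (auto intro!: image_eqI[of _ uminus "- _"])
    ultimately show "closed {s \<in> {0..}. \<forall>t. u (- s) t = v (- s) t}" by simp
    fix s :: real assume s: "0 \<le> s" "\<forall>t. u (- s) t = v (- s) t"
    then obtain \<eta> where "\<eta> > 0" "\<And>r t. r \<in> {- s - \<eta>..- s} \<Longrightarrow> u r t = v r t"
      using extension_near[OF hu hv fat_halfplanes(2), of "- s"] by fastforce
    then show "\<exists>\<eta>>0. \<forall>r\<in>{s..s+\<eta>}. \<forall>t. u (- r) t = v (- r) t" by (intro exI[of _ \<eta>]) auto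
  qed (use agree s in auto)
  then show ?thesis by simp
qed

end

theorem theorem5p4:
  fixes A :: "('m::t2_space, 'e::euclidean_space) chart set"
    and g :: "('m, 'e) metric"
    and V :: "(real \<Rightarrow> 'm) \<Rightarrow> real"
    and grad :: "(real \<Rightarrow> 'm) \<Rightarrow> real \<Rightarrow> ('m, 'e) tvec"
  assumes "closed_manifold A"
    and "riemannian_metric A g"
    and "smooth_functional A V"
    and "is_L2_gradient A g V grad"
    and "axiom_V0 A g V grad"
    and "axiom_V1 A g grad"
  shows "(\<forall>u v.
            heat_solution A g grad {0..} u \<longrightarrow> heat_solution A g grad {0..} v \<longrightarrow>
            (\<forall>t. u 0 t = v 0 t) \<longrightarrow>
            (\<forall>s\<in>{0..}. \<forall>t. u s t = v s t)) \<and>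
         (\<forall>u v c0.
            heat_solution A g grad {..0} u \<longrightarrow> heat_solution A g grad {..0} v \<longrightarrow>
            c0 > 0 \<longrightarrow>
            (\<forall>s\<in>{..0}. action A g V (u s) \<le> c0) \<longrightarrow> (\<forall>s\<in>{..0}. action A g V (v s) \<le> c0) \<longrightarrow>
            (\<forall>t. u 0 t = v 0 t) \<longrightarrow>
            (\<forall>s\<in>{..0}. \<forall>t. u s t = v s t))"
proof -
  interpret R: closed_riemannian A g by standard (fact assms)+
  obtain I :: "'m set" and ch ctr rad where "finite I"
    "\<forall>i\<in>I. ch i \<in> A \<and> rad i > 0 \<and> cball (ctr i) (4 * rad i) \<subseteq> img_chart (ch i)"
    "\<forall>p. \<exists>i\<in>I. p \<in> dom_chart (ch i) \<and> dist (ctr i) (app_chart (ch i) p) < rad i"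
    using R.finite_ball_cover by blast
  then interpret perturbed A g I ch ctr rad V grad
    by unfold_locales (use assms in auto)
  show ?thesis
    using forward_unique_continuation backward_unique_continuation by (intro conjI allI impI ballI) auto
qed

end
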